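(* Let $C:\{0,1\}^n\times\{0,1\}^t\to\{0,1\}$ be a $(k,\epsilon)$-strong extractor with an $s$-bit seed, and let $S_1,\dots,S_m\subset[d]$ be a weak $(t,r)$-design. Then Trevisan's extractor $\mathrm{Ext}_C:\{0,1\}^n\times\{0,1\}^d\to\{0,1\}^m$ is a quantum-proof $(k+rm+\log(1/\epsilon),\,6m\sqrt{\epsilon})$-strong extractor with an $s'$-bit seed, where $s'=d-\big(t-s-\log\frac{1}{3\sqrt{\epsilon}}\big)$.
   Context: Logarithms base 2; $x_S$ denotes the bits of $x$ at positions in $S$; $\|A\|_{\mathrm{tr}}=\mathrm{tr}\sqrt{A^\dagger A}$; $\rho_{U_m}=2^{-m}\mathbb{1}$. Conditional min-entropy: $H_{\min}(A|B)_\rho=\max_{\sigma_B}\sup\{\lambda:2^{-\lambda}\mathbb{1}_A\otimes\sigma_B\ge\rho_{AB}\}$ over density operators $\sigma_B$; for trivial $B$ it is $-\log\max_xP_X(x)$. A function $\mathrm{Ext}:\{0,1\}^n\times\{0,1\}^d\to\{0,1\}^m$ is a $(k,\epsilon)$-strong extractor with an $s$-bit seed if for every random variable $X$ with $H_{\min}(X)\ge k$ and every random variable $Y$ on $\{0,1\}^d$ independent of $X$ with $H_{\min}(Y)\ge s$, $\frac12\|\rho_{\mathrm{Ext}(X,Y)Y}-\rho_{U_m}\otimes\rho_Y\|_{\mathrm{tr}}\le\epsilon$. It is a quantum-proof $(k,\epsilon)$-strong extractor with an $s$-bit seed if for every state $\rho_{XE}$ classical on $X$ with $H_{\min}(X|E)\ge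 k$ and every $Y$ independent of $XE$ with $H_{\min}(Y)\ge s$, $\frac12\|\rho_{\mathrm{Ext}(X,Y)YE}-\rho_{U_m}\otimes\rho_Y\otimes\rho_E\|_{\mathrm{tr}}\le\epsilon$. Weak $(t,r)$-design: sets $S_1,\dots,S_m\subset[d]$ with $|S_i|=t$ and $\sum_{j=1}^{i-1}2^{|S_j\cap S_i|}\le rm$ for all $i$. Trevisan's extractor: $\mathrm{Ext}_C(x,y)=C(x,y_{S_1})\cdots C(x,y_{S_m})$. *)

theory Defs
  imports "HOL-Analysis.Analysis" "Jordan_Normal_Form.Matrix"
begin

text \<open>Bit strings in {0,1}^n are encoded as natural numbers x < 2^n; bit i of x
  (i < n) is the bit at position i.  A register holding an n-bit string has
  the computational basis indexed by {0..<2^n}.\<close>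

definition adj :: "complex mat \<Rightarrow> complex mat" where
  "adj A = mat (dim_col A) (dim_row A) (\<lambda>(i,j). cnj (A $$ (j,i)))"

definition mtrace :: "complex mat \<Rightarrow> complex" where
  "mtrace A = (\<Sum>i<dim_row A. A $$ (i,i))"

definition psd :: "complex mat \<Rightarrow> bool" where
  "psd A \<longleftrightarrow> dim_col A = dim_row A \<and>
     (\<forall>v :: nat \<Rightarrow> complex.
        let q = (\<Sum>i<dim_row A. \<Sum>j<dim_row A. cnj (v i) * A $$ (i,j) * v j)
        in Im q = 0 \<and> Re q \<ge> 0)"

definition mat_le :: "complex mat \<Rightarrow> complex mat \<Rightarrow> bool" where
  "mat_le A B \<longleftrightarrow> dim_row A = dim_row B \<and> dim_col A = dim_col B \<and> psd (B - A)"

definition density :: "nat \<Rightarrow> complex mat \<Rightarrow> bool" where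
  "density N \<sigma> \<longleftrightarrow> \<sigma> \<in> carrier_mat N N \<and> psd \<sigma> \<and> mtrace \<sigma> = 1"

definition msqrt :: "complex mat \<Rightarrow> complex mat" where
  "msqrt A = (THE B. psd B \<and> dim_row B = dim_row A \<and> B * B = A)"

definition trace_norm :: "complex mat \<Rightarrow> real" where
  "trace_norm A = Re (mtrace (msqrt (adj A * A)))"

text \<open>Kronecker (tensor) product; index of (i,k) is i * dim B + k.\<close>
definition kron :: "complex mat \<Rightarrow> complex mat \<Rightarrow> complex mat" where
  "kron A B = mat (dim_row A * dim_row B) (dim_col A * dim_col B)
     (\<lambda>(i,j). A $$ (i div dim_row B, j div dim_col B) * B $$ (i mod dim_row B, j mod dim_col B))"

definition proj :: "nat \<Rightarrow> nat \<Rightarrow> complex mat" where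
  "proj N i = mat N N (\<lambda>(a,b). if a = i \<and> b = i then 1 else 0)"

definition diag_state :: "nat \<Rightarrow> (nat \<Rightarrow> real) \<Rightarrow> complex mat" where
  "diag_state N p = mat N N (\<lambda>(a,b). if a = b then complex_of_real (p a) else 0)"

definition mat_sum :: "nat \<Rightarrow> nat \<Rightarrow> ('i \<Rightarrow> complex mat) \<Rightarrow> 'i set \<Rightarrow> complex mat" where
  "mat_sum nr nc f I = mat nr nc (\<lambda>ij. \<Sum>a\<in>I. f a $$ ij)"

definition Hmin :: "nat \<Rightarrow> nat \<Rightarrow> complex mat \<Rightarrow> real" where
  "Hmin dA dB \<rho> = Sup {lam. \<exists>\<sigma>. density dB \<sigma> \<and>
      mat_le \<rho> (complex_of_real (2 powr (-lam)) \<cdot>\<^sub>m kron (1\<^sub>m dA) \<sigma>)}"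

definition is_dist :: "nat \<Rightarrow> (nat \<Rightarrow> real) \<Rightarrow> bool" where
  "is_dist N p \<longleftrightarrow> (\<forall>i<N. p i \<ge> 0) \<and> (\<Sum>i<N. p i) = 1"

definition Hmin_cl :: "nat \<Rightarrow> (nat \<Rightarrow> real) \<Rightarrow> real" where
  "Hmin_cl N p = - log 2 (Max (p ` {..<N}))"

definition strong_extractor ::
  "nat \<Rightarrow> nat \<Rightarrow> nat \<Rightarrow> (nat \<Rightarrow> nat \<Rightarrow> nat) \<Rightarrow> real \<Rightarrow> real \<Rightarrow> real \<Rightarrow> bool" where
  "strong_extractor n d m Ext k \<epsilon> s \<longleftrightarrow>
     (\<forall>p q. is_dist (2^n) p \<longrightarrow> Hmin_cl (2^n) p \<ge> k \<longrightarrow>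
            is_dist (2^d) q \<longrightarrow> Hmin_cl (2^d) q \<ge> s \<longrightarrow>
       (let N = 2^m * 2^d;
            \<rho>out = mat_sum N N
               (\<lambda>(x,y). complex_of_real (p x * q y) \<cdot>\<^sub>m kron (proj (2^m) (Ext x y)) (proj (2^d) y))
               ({..<2^n} \<times> {..<2^d});
            \<rho>ideal = kron (complex_of_real (1 / 2^m) \<cdot>\<^sub>m 1\<^sub>m (2^m)) (diag_state (2^d) q)
        in 1/2 * trace_norm (\<rho>out - \<rho>ideal) \<le> \<epsilon>))"

text \<open>A state rho_XE classical on X (X an n-bit string), given by the family
  x |-> rho_x of subnormalised states on C^dE:
  rho_XE = sum_x |x><x| \<otimes> rho_x.\<close>
definition cq_state :: "nat \<Rightarrow> nat \<Rightarrow> (nat \<Rightarrow> complex mat) \<Rightarrow> bool" where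
  "cq_state n dE \<rho> \<longleftrightarrow> (\<forall>x<2^n. \<rho> x \<in> carrier_mat dE dE \<and> psd (\<rho> x)) \<and>
     (\<Sum>x<2^n. mtrace (\<rho> x)) = 1"

definition cq_joint :: "nat \<Rightarrow> nat \<Rightarrow> (nat \<Rightarrow> complex mat) \<Rightarrow> complex mat" where
  "cq_joint n dE \<rho> = mat_sum (2^n * dE) (2^n * dE) (\<lambda>x. kron (proj (2^n) x) (\<rho> x)) {..<2^n}"

definition cq_marginal :: "nat \<Rightarrow> nat \<Rightarrow> (nat \<Rightarrow> complex mat) \<Rightarrow> complex mat" where
  "cq_marginal n dE \<rho> = mat_sum dE dE \<rho> {..<2^n}"

definition quantum_proof_strong_extractor ::
  "nat \<Rightarrow> nat \<Rightarrow> nat \<Rightarrow> (nat \<Rightarrow> nat \<Rightarrow> nat) \<Rightarrow> real \<Rightarrow> real \<Rightarrow> real \<Rightarrow> bool" where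
  "quantum_proof_strong_extractor n d m Ext k \<epsilon> s \<longleftrightarrow>
     (\<forall>dE \<rho> q. cq_state n dE \<rho> \<longrightarrow> Hmin (2^n) dE (cq_joint n dE \<rho>) \<ge> k \<longrightarrow>
            is_dist (2^d) q \<longrightarrow> Hmin_cl (2^d) q \<ge> s \<longrightarrow>
       (let N = 2^m * 2^d * dE;
            \<rho>out = mat_sum N N
               (\<lambda>(x,y). complex_of_real (q y) \<cdot>\<^sub>m
                   kron (kron (proj (2^m) (Ext x y)) (proj (2^d) y)) (\<rho> x))
               ({..<2^n} \<times> {..<2^d});
            \<rho>ideal = kron (kron (complex_of_real (1 / 2^m) \<cdot>\<^sub>m 1\<^sub>m (2^m)) (diag_state (2^d) q))
                        (cq_marginal n dE \<rho>)
        in 1/2 * trace_norm (\<rho>out - \<rho>ideal) \<le> \<epsilon>))"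

text \<open>Positions [d] are {0..<d}.  Design sets S 0, ..., S (m-1).\<close>
definition weak_design :: "nat \<Rightarrow> nat \<Rightarrow> nat \<Rightarrow> real \<Rightarrow> (nat \<Rightarrow> nat set) \<Rightarrow> bool" where
  "weak_design m d t r S \<longleftrightarrow>
     (\<forall>i<m. S i \<subseteq> {..<d} \<and> card (S i) = t) \<and>
     (\<forall>i<m. (\<Sum>j<i. (2::real) ^ card (S j \<inter> S i)) \<le> r * m)"

definition restrict_bits :: "nat \<Rightarrow> nat set \<Rightarrow> nat" where
  "restrict_bits y S = (\<Sum>j<card S. if bit y (sorted_list_of_set S ! j) then 2^j else 0)"

definition trevisan_ext :: "(nat \<Rightarrow> nat \<Rightarrow> nat) \<Rightarrow> nat \<Rightarrow> (nat \<Rightarrow> nat set) \<Rightarrow> nat \<Rightarrow> nat \<Rightarrow> nat" where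
  "trevisan_ext C m S x y = (\<Sum>i<m. C x (restrict_bits y (S i)) * 2^i)"

end

theory Submission
  imports Defs "Jordan_Normal_Form.Spectral_Radius" "HOL-Library.Nat_Bijection"
begin

text \<open>
  The trace norm of a Hermitian block-diagonal matrix is attained by pairing it with contractions
  \<open>K z y\<close> on the side information, so the extractor error is a sum of expectations. A hybrid
  argument over the output bits reduces it to the bias of a single bit \<open>C(x, y\<^sub>S)\<close>, given the side
  information, the remaining seed and the earlier output bits.

  For one bit, Cauchy-Schwarz with respect to the averaged state bounds the bias by the square root
  of the bias against a classical adversary, who measures the side information with the pretty good
  measurement. Given the outcome of that measurement, the source either has min-entropy at least
  \<open>k\<close>, so that the classical extractor property applies, or the outcome is charged to the guessing
  probability of the source.
\<close>

section \<open>Spectral theorem for Hermitian matrices\<close>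

text \<open>The obstacle: a strong extractor lets the adversary choose the measurement of the side
  information after seeing the seed, so one cannot measure first and then quote the classical
  property; the test \<open>K\<close> depends on the seed \<open>V\<close>. Cauchy-Schwarz removes
  exactly this dependence. One factor contains \<open>K\<close> and is at most the trace of the
  average state, since \<open>K\<close> is a contraction; the other is quadratic in the ensemble,
  and one of its two copies can be read as a measurement determined by the ensemble alone, hence
  independent of the seed. The price is the square root of \<epsilon>. The earlier output bits also
  depend on the seed, but once the seed bits outside \<open>S i\<close> are fixed, a table depending
  on \<open>x\<close> alone determines them as a function of the rest. Conditioning on the table
  multiplies the guessing term by the number of tables, at most \<open>2 powr (r * m)\<close>; this
  and the summand \<open>log 2 (1 / \<epsilon>)\<close> are the entropy demanded beyond
  \<open>k\<close>. In \<open>6 * sqrt \<epsilon>\<close> one half is the bias of a single bit, the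
  other pays for the outer seed bits that leave too little entropy inside
  \<open>S i\<close>.\<close>

lemma adj_carrier [simp]: "A \<in> carrier_mat n m \<Longrightarrow> adj A \<in> carrier_mat m n"
  by (auto simp: adj_def)

lemma dim_adj [simp]: "dim_row (adj A) = dim_col A" "dim_col (adj A) = dim_row A"
  by (auto simp: adj_def)

lemma index_adj [simp]: "i < dim_col A \<Longrightarrow> j < dim_row A \<Longrightarrow> adj A $$ (i,j) = cnj (A $$ (j,i))"
  by (auto simp: adj_def)

lemma adj_adj [simp]: "adj (adj A) = A"
  by (rule eq_matI) auto

lemma index_mult_sum:
  "A \<in> carrier_mat n m \<Longrightarrow> B \<in> carrier_mat m l \<Longrightarrow> i < n \<Longrightarrow> j < l \<Longrightarrow>
   (A * B) $$ (i,j) = (\<Sum>k<m. A $$ (i,k) * B $$ (k,j))"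
  by (auto simp: scalar_prod_def atLeast0LessThan)

lemma adj_mult:
  assumes "A \<in> carrier_mat n m" "B \<in> carrier_mat m l"
  shows "adj (A * B) = adj B * adj A"
proof (rule eq_matI)
  fix i j assume "i < dim_row (adj B * adj A)" "j < dim_col (adj B * adj A)"
  with assms have "i < l" "j < n" by auto
  have "adj (A * B) $$ (i,j) = cnj ((A * B) $$ (j,i))" using assms \<open>i < l\<close> \<open>j < n\<close> by auto
  also have "\<dots> = (\<Sum>k<m. cnj (A $$ (j,k)) * cnj (B $$ (k,i)))"
    by (simp add: index_mult_sum[OF assms \<open>j < n\<close> \<open>i < l\<close>] del: index_mult_mat)
  also have "\<dots> = (adj B * adj A) $$ (i,j)"
    using assms \<open>i < l\<close> \<open>j < n\<close>
    by (subst index_mult_sum[where m = m]) (auto intro!: sum.cong)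
  finally show "adj (A * B) $$ (i,j) = (adj B * adj A) $$ (i,j)" .
qed (use assms in auto)

lemma adj_one [simp]: "adj (1\<^sub>m n) = 1\<^sub>m n"
  by (rule eq_matI) auto

lemma square_mult_carrier [simp]:
  "A \<in> carrier_mat n n \<Longrightarrow> B \<in> carrier_mat n n \<Longrightarrow> A * B \<in> carrier_mat n n"
  by simp

lemma square_mult_assoc:
  fixes A :: "complex mat"
  shows "A \<in> carrier_mat n n \<Longrightarrow> B \<in> carrier_mat n n \<Longrightarrow> C \<in> carrier_mat n n \<Longrightarrow>
   A * B * C = A * (B * C)"
  by simp

lemma square_mult_one [simp]:
  fixes A :: "complex mat"
  shows "A \<in> carrier_mat n n \<Longrightarrow> A * 1\<^sub>m n = A" "A \<in> carrier_mat n n \<Longrightarrow> 1\<^sub>m n * A = A"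
  by auto

lemma adj_zero [simp]: "adj (0\<^sub>m n m) = 0\<^sub>m m n"
  by (rule eq_matI) auto

section \<open>Unitaries, Householder reflections and splitting off one eigenvector\<close>

definition unitary_mat :: "nat \<Rightarrow> complex mat \<Rightarrow> bool" where
  "unitary_mat n U \<longleftrightarrow> U \<in> carrier_mat n n \<and> adj U * U = 1\<^sub>m n \<and> U * adj U = 1\<^sub>m n"

lemma unitary_mat_mult:
  assumes "unitary_mat n U" "unitary_mat n V"
  shows "unitary_mat n (U * V)"
proof -
  have [simp]: "U \<in> carrier_mat n n" "V \<in> carrier_mat n n" using assms by (auto simp: unitary_mat_def)
  have "adj V * adj U * (U * V) = adj V * (adj U * U) * V"
    by (simp add: square_mult_assoc[where n = n])
  moreover have "U * V * (adj V * adj U) = U * (V * adj V) * adj U"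
    by (simp add: square_mult_assoc[where n = n])
  ultimately show ?thesis
    using assms by (auto simp: unitary_mat_def adj_mult[where n = n and m = n and l = n])
qed

text \<open>The matrix is the Householder reflection exchanging \<open>v\<close> and the first basis vector.\<close>
lemma householder_exists:
  fixes v :: "nat \<Rightarrow> complex"
  assumes n: "0 < n" and norm: "(\<Sum>i<n. (cmod (v i))\<^sup>2) = 1" and real: "v 0 \<in> \<real>"
  shows "\<exists>H. H \<in> carrier_mat n n \<and> adj H = H \<and> H * H = 1\<^sub>m n \<and> (\<forall>i<n. H $$ (i,0) = v i)"
proof (cases "v 0 = 1")
  case True
  have "(\<Sum>i<n. (cmod (v i))\<^sup>2) = (cmod (v 0))\<^sup>2 + (\<Sum>i\<in>{..<n}-{0}. (cmod (v i))\<^sup>2)"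
    using n by (intro sum.remove) auto
  hence "(\<Sum>i\<in>{..<n}-{0}. (cmod (v i))\<^sup>2) = 0" using norm True by simp
  hence "v i = 0" if "i < n" "i \<noteq> 0" for i
    using that by (subst (asm) sum_nonneg_eq_0_iff) auto
  thus ?thesis using True by (intro exI[of _ "1\<^sub>m n"]) auto
next
  case False
  obtain r where r: "v 0 = of_real r" using real by (auto elim: Reals_cases)
  \<comment> \<open>\<open>u\<close> is \<open>v\<close> minus the first basis vector. Reality of
    \<open>v 0\<close> gives \<open>u\<close> the squared norm \<open>2 * b\<close> and makes
    \<open>cnj (u 0) = - b\<close>, so the reflection along \<open>u\<close> adds exactly
    \<open>u\<close> to the first basis vector. The case \<open>v 0 = 1\<close> is split off because
    \<open>b\<close> vanishes there.\<close>
  define u where "u i = v i - (if i = 0 then 1 else 0)" for i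
  define b where "b = 1 - v 0"
  have b: "b \<noteq> 0" "cnj b = b" using False r by (auto simp: b_def)
  have "(\<Sum>i<n. cnj (u i) * u i) = (\<Sum>i<n. cnj (v i) * v i - (if i = 0 then v i + cnj (v i) - 1 else 0))"
    by (intro sum.cong) (auto simp: u_def algebra_simps)
  also have "\<dots> = (\<Sum>i<n. complex_of_real ((cmod (v i))\<^sup>2)) - (v 0 + cnj (v 0) - 1)"
    using n by (simp add: sum_subtractf complex_norm_square[symmetric] mult.commute[of "cnj _"])
  also have "\<dots> = 2 * b"
    using norm unfolding of_real_sum[symmetric] by (simp add: b_def r)
  finally have uu: "(\<Sum>i<n. cnj (u i) * u i) = 2 * b" .
  define H where "H = mat n n (\<lambda>(i,j). (if i = j then 1 else 0) - u i * cnj (u j) / b)"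
  have H: "H \<in> carrier_mat n n" by (simp add: H_def)
  have "adj H = H" using b by (intro eq_matI) (auto simp: H_def mult.commute)
  moreover have "H * H = 1\<^sub>m n"
  proof (rule eq_matI)
    fix i j assume "i < dim_row (1\<^sub>m n :: complex mat)" "j < dim_col (1\<^sub>m n :: complex mat)"
    hence ij: "i < n" "j < n" by auto
    have "(H * H) $$ (i,j) = (\<Sum>k<n. ((if i = k then 1 else 0) - u i * cnj (u k) / b) *
        ((if k = j then 1 else 0) - u k * cnj (u j) / b))"
      using ij by (subst index_mult_sum[OF H H]) (auto simp: H_def)
    also have "\<dots> = (\<Sum>k<n. (if k = i then (if i = j then 1 else 0) - u i * cnj (u j) / b else 0)
        - (if k = j then u i * cnj (u j) / b else 0) + (u i * cnj (u j) / b^2) * (cnj (u k) * u k))"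
      by (intro sum.cong) (auto simp: algebra_simps power2_eq_square)
    also have "\<dots> = (if i = j then 1 else 0) - 2 * u i * cnj (u j) / b + (u i * cnj (u j) / b^2) * (2 * b)"
      unfolding uu[symmetric] sum_distrib_left using ij by (simp add: sum.distrib sum_subtractf)
    also have "\<dots> = 1\<^sub>m n $$ (i,j)" using b ij by (simp add: field_simps power2_eq_square)
    finally show "(H * H) $$ (i,j) = 1\<^sub>m n $$ (i,j)" .
  qed (auto simp: H_def)
  moreover have "\<forall>i<n. H $$ (i,0) = v i"
  proof (intro allI impI)
    fix i assume "i < n"
    have "cnj (u 0) = - b" by (simp add: u_def b_def r)
    thus "H $$ (i,0) = v i" using n b \<open>i < n\<close> by (simp add: H_def u_def)
  qed
  ultimately show ?thesis using H by blast
qed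

lemma adj_four_block_mat:
  assumes "A \<in> carrier_mat a b" "B \<in> carrier_mat a c" "C \<in> carrier_mat d b" "D \<in> carrier_mat d c"
  shows "adj (four_block_mat A B C D) = four_block_mat (adj A) (adj C) (adj B) (adj D)"
  using assms by (intro eq_matI) auto

lemma diag_state_carrier [simp]: "diag_state n l \<in> carrier_mat n n"
  by (simp add: diag_state_def)

lemma diag_state_Suc:
  "diag_state (Suc n) (case_nat e l) =
   four_block_mat (diag_state 1 (\<lambda>_. e)) (0\<^sub>m 1 n) (0\<^sub>m n 1) (diag_state n l)"
  by (rule eq_matI) (auto simp: diag_state_def split: nat.split)

text \<open>Induction step of the spectral theorem. Reflecting a unit eigenvector to the first basis
  vector turns the first column into the eigenvalue followed by zeros; hermiticity then clears the
  first row and makes the eigenvalue real, as \<open>diag_state\<close> requires.\<close>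

lemma hermitian_deflate:
  assumes A: "A \<in> carrier_mat (Suc n) (Suc n)" and herm: "adj A = A"
  shows "\<exists>H e B. H \<in> carrier_mat (Suc n) (Suc n) \<and> adj H = H \<and> H * H = 1\<^sub>m (Suc n) \<and>
     B \<in> carrier_mat n n \<and> adj B = B \<and>
     H * A * H = four_block_mat (diag_state 1 (\<lambda>_. e)) (0\<^sub>m 1 n) (0\<^sub>m n 1) B"
proof -
  let ?N = "Suc n"
  obtain e w where ew: "eigenvector A w e"
    using spectrum_non_empty[OF A] by (auto simp: spectrum_def eigenvalue_def)
  hence w: "w \<in> carrier_vec ?N" "w \<noteq> 0\<^sub>v ?N" and Aw: "A *\<^sub>v w = e \<cdot>\<^sub>v w"
    using A by (auto simp: eigenvector_def)
  define s where "s = (\<Sum>i<?N. (cmod (w $ i))\<^sup>2)"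
  have "s \<noteq> 0"
  proof
    assume "s = 0"
    hence "\<forall>i<?N. w $ i = 0" unfolding s_def by (subst (asm) sum_nonneg_eq_0_iff) auto
    thus False using w by (auto intro!: eq_vecI)
  qed
  moreover have "s \<ge> 0" unfolding s_def by (intro sum_nonneg) auto
  ultimately have s: "s > 0" by simp
  \<comment> \<open>Normalises \<open>w\<close> and turns its phase so that the first entry becomes
    real, as the reflection requires; if that entry is 0, any phase will do.\<close>
  define c where "c = (if w $ 0 = 0 then 1 else cnj (w $ 0) / cmod (w $ 0)) / sqrt s"
  have c: "cmod c = 1 / sqrt s" using s by (auto simp: c_def norm_divide)
  define v where "v i = c * w $ i" for i
  have "(\<Sum>i<?N. (cmod (v i))\<^sup>2) = (\<Sum>i<?N. (1 / sqrt s)\<^sup>2 * (cmod (w $ i))\<^sup>2)"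
    by (intro sum.cong refl) (simp add: v_def norm_mult c power_divide)
  also have "\<dots> = (1 / sqrt s)\<^sup>2 * s" by (simp only: s_def sum_distrib_left)
  finally have "(\<Sum>i<?N. (cmod (v i))\<^sup>2) = (1 / sqrt s)\<^sup>2 * s" .
  hence "(\<Sum>i<?N. (cmod (v i))\<^sup>2) = 1" using s by (simp add: power_divide)
  moreover have "v 0 \<in> \<real>"
  proof (cases "w $ 0 = 0")
    case False
    have "cnj (w $ 0) * w $ 0 = complex_of_real ((cmod (w $ 0))\<^sup>2)"
      by (subst complex_norm_square) (simp add: mult.commute)
    hence "v 0 = complex_of_real ((cmod (w $ 0))\<^sup>2 / cmod (w $ 0) / sqrt s)"
      using False by (simp add: v_def c_def)
    thus ?thesis by (metis Reals_of_real)
  qed (simp add: v_def)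
  ultimately obtain H where H: "H \<in> carrier_mat ?N ?N" "adj H = H" "H * H = 1\<^sub>m ?N"
    and Hv: "\<And>i. i < ?N \<Longrightarrow> H $$ (i,0) = v i"
    using householder_exists[of ?N v] by auto
  have AH: "(A * H) $$ (i,0) = e * H $$ (i,0)" if "i < ?N" for i
  proof -
    have "(A * H) $$ (i,0) = (\<Sum>k<?N. A $$ (i,k) * H $$ (k,0))"
      using that by (intro index_mult_sum[OF A H(1)]) auto
    also have "\<dots> = (\<Sum>k<?N. c * (A $$ (i,k) * w $ k))"
      by (intro sum.cong) (auto simp: Hv v_def)
    also have "\<dots> = c * (A *\<^sub>v w) $ i"
      using that A w(1) by (simp add: scalar_prod_def atLeast0LessThan sum_distrib_left distrib_left)
    also have "\<dots> = e * H $$ (i,0)" using that w(1) by (simp add: Aw Hv v_def)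
    finally show ?thesis .
  qed
  define A' where "A' = H * A * H"
  have A': "A' \<in> carrier_mat ?N ?N" "adj A' = A'"
    using H A herm by (auto simp: A'_def adj_mult[where n = ?N and m = ?N and l = ?N] square_mult_assoc[where n = ?N])
  have col0: "A' $$ (i,0) = (if i = 0 then e else 0)" if "i < ?N" for i
  proof -
    have "A' $$ (i,0) = (H * (A * H)) $$ (i,0)" using H A by (simp add: A'_def square_mult_assoc[where n = ?N])
    also have "\<dots> = (\<Sum>k<?N. H $$ (i,k) * (A * H) $$ (k,0))"
      using that H A by (intro index_mult_sum[where m = ?N]) auto
    also have "\<dots> = e * (\<Sum>k<?N. H $$ (i,k) * H $$ (k,0))"
      unfolding sum_distrib_left by (intro sum.cong) (auto simp: AH simp del: index_mult_mat)
    also have "\<dots> = e * (H * H) $$ (i,0)" using that by (subst index_mult_sum[OF H(1) H(1)]) auto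
    finally show ?thesis using that by (simp add: H(3))
  qed
  have sym: "A' $$ (i,j) = cnj (A' $$ (j,i))" if "i < ?N" "j < ?N" for i j
    using index_adj[of i A' j] A' that by auto
  have "cnj e = e" using col0[of 0] sym[of 0 0] by simp
  then obtain r where r: "e = complex_of_real r" by (metis Reals_cnj_iff Reals_cases)
  define B where "B = mat n n (\<lambda>(i,j). A' $$ (Suc i, Suc j))"
  have "adj B = B"
  proof (rule eq_matI)
    fix i j assume "i < dim_row B" "j < dim_col B"
    thus "adj B $$ (i,j) = B $$ (i,j)" using sym[of "Suc i" "Suc j"] by (simp add: B_def)
  qed (auto simp: B_def)
  moreover have "A' = four_block_mat (diag_state 1 (\<lambda>_. r)) (0\<^sub>m 1 n) (0\<^sub>m n 1) B"
  proof (rule eq_matI)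
    fix i j assume "i < dim_row (four_block_mat (diag_state 1 (\<lambda>_. r)) (0\<^sub>m 1 n) (0\<^sub>m n 1) B)"
      "j < dim_col (four_block_mat (diag_state 1 (\<lambda>_. r)) (0\<^sub>m 1 n) (0\<^sub>m n 1) B)"
    hence ij: "i < ?N" "j < ?N" by (auto simp: B_def diag_state_def)
    show "A' $$ (i,j) = four_block_mat (diag_state 1 (\<lambda>_. r)) (0\<^sub>m 1 n) (0\<^sub>m n 1) B $$ (i,j)"
      using ij col0[of i] col0[of j] sym[of 0 j] r
      by (cases i; cases j) (auto simp: B_def diag_state_def)
  qed (use A' in \<open>auto simp: B_def diag_state_def\<close>)
  moreover have "B \<in> carrier_mat n n" by (simp add: B_def)
  ultimately show ?thesis using H unfolding A'_def by blast
qed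

theorem hermitian_spectral:
  assumes "A \<in> carrier_mat n n" "adj A = A"
  shows "\<exists>U l. unitary_mat n U \<and> A = U * diag_state n l * adj U"
  using assms
proof (induction n arbitrary: A)
  case 0
  thus ?case by (intro exI[of _ "1\<^sub>m 0"] exI[of _ "\<lambda>_. 0"]) (auto simp: unitary_mat_def diag_state_def intro!: eq_matI)
next
  case (Suc n)
  let ?N = "Suc n"
  from hermitian_deflate[OF Suc.prems] obtain H e B where
    H: "H \<in> carrier_mat ?N ?N" "adj H = H" "H * H = 1\<^sub>m ?N" and B: "B \<in> carrier_mat n n" "adj B = B"
    and HAH: "H * A * H = four_block_mat (diag_state 1 (\<lambda>_. e)) (0\<^sub>m 1 n) (0\<^sub>m n 1) B"
    by blast
  from Suc.IH[OF B] obtain V l where V: "unitary_mat n V" and BV: "B = V * diag_state n l * adj V" by blast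
  have [simp]: "V \<in> carrier_mat n n" "adj V * V = 1\<^sub>m n" "V * adj V = 1\<^sub>m n"
    using V by (auto simp: unitary_mat_def)
  have [simp]: "diag_state n l \<in> carrier_mat n n" "diag_state 1 (\<lambda>_. e) \<in> carrier_mat 1 1" for e l
    by (rule diag_state_carrier)+
  \<comment> \<open>The unitary of the smaller block acts on all coordinates but the first, so that
    \<open>H * W\<close> diagonalises \<open>A\<close>.\<close>
  define W where "W = four_block_mat (1\<^sub>m 1) (0\<^sub>m 1 n) (0\<^sub>m n 1) V"
  let ?D = "diag_state ?N (case_nat e l)"
  have W: "W \<in> carrier_mat ?N ?N"
    using four_block_carrier_mat[of "1\<^sub>m 1 :: complex mat" 1 1 V n n] by (simp add: W_def)
  have adjW: "adj W = four_block_mat (1\<^sub>m 1) (0\<^sub>m 1 n) (0\<^sub>m n 1) (adj V)"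
    unfolding W_def by (subst adj_four_block_mat[where a = 1 and b = 1 and c = n and d = n]) auto
  have blk: "four_block_mat P (0\<^sub>m 1 n) (0\<^sub>m n 1) Q * four_block_mat P' (0\<^sub>m 1 n) (0\<^sub>m n 1) Q' =
      four_block_mat (P * P') (0\<^sub>m 1 n) (0\<^sub>m n 1) (Q * Q')"
    if "P \<in> carrier_mat 1 1" "P' \<in> carrier_mat 1 1" "Q \<in> carrier_mat n n" "Q' \<in> carrier_mat n n"
    for P P' Q Q' :: "complex mat"
    using that mult_four_block_mat[of P 1 1 "0\<^sub>m 1 n" n "0\<^sub>m n 1" n Q P' 1 "0\<^sub>m 1 n" n "0\<^sub>m n 1" Q'] by simp
  have one: "four_block_mat (1\<^sub>m 1) (0\<^sub>m 1 n) (0\<^sub>m n 1) (1\<^sub>m n) = (1\<^sub>m ?N :: complex mat)"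
    by (rule eq_matI) auto
  have uW: "unitary_mat ?N W"
    unfolding unitary_mat_def adjW using W by (simp add: W_def blk del: One_nat_def) simp
  have uH: "unitary_mat ?N H" using H by (simp add: unitary_mat_def)
  have D: "?D \<in> carrier_mat ?N ?N" by simp
  have WD: "H * A * H = W * ?D * adj W"
    unfolding HAH BV adjW unfolding W_def diag_state_Suc by (simp add: blk del: One_nat_def)
  have "A = (H * H) * A * (H * H)" using Suc.prems H by simp
  also have "\<dots> = H * (H * A * H) * H" using Suc.prems(1) H(1) by (simp add: square_mult_assoc[where n = ?N])
  also have "\<dots> = (H * W) * ?D * adj (H * W)"
    unfolding WD using W H D by (simp add: square_mult_assoc[where n = ?N] adj_mult[where n = ?N and m = ?N and l = ?N])
  finally show ?case using unitary_mat_mult[OF uH uW] by blast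
qed

section \<open>Positive semidefinite matrices and their square roots\<close>

definition qform :: "complex mat \<Rightarrow> (nat \<Rightarrow> complex) \<Rightarrow> complex" where
  "qform A v = (\<Sum>i<dim_row A. \<Sum>j<dim_row A. cnj (v i) * A $$ (i,j) * v j)"

lemma psd_iff_qform:
  "psd A \<longleftrightarrow> dim_col A = dim_row A \<and> (\<forall>v. Im (qform A v) = 0 \<and> Re (qform A v) \<ge> 0)"
  by (simp add: psd_def qform_def Let_def)

lemma qform_carrier:
  "A \<in> carrier_mat n n \<Longrightarrow> qform A v = (\<Sum>i<n. \<Sum>j<n. cnj (v i) * A $$ (i,j) * v j)"
  by (simp add: qform_def)

lemma psdI:
  assumes "A \<in> carrier_mat n n" "\<And>v. Im (qform A v) = 0" "\<And>v. Re (qform A v) \<ge> 0"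
  shows "psd A"
  using assms by (auto simp: psd_iff_qform)

lemma psd_ReD: "psd A \<Longrightarrow> Re (qform A v) \<ge> 0" and psd_ImD: "psd A \<Longrightarrow> Im (qform A v) = 0"
  by (auto simp: psd_iff_qform)

lemma qform_two_point:
  assumes A: "A \<in> carrier_mat n n" and ij: "i < n" "j < n" "i \<noteq> j"
  shows "qform A (\<lambda>k. if k = i then a else if k = j then b else 0) =
     cnj a * A $$ (i,i) * a + cnj a * A $$ (i,j) * b + cnj b * A $$ (j,i) * a + cnj b * A $$ (j,j) * b"
proof -
  let ?v = "\<lambda>k. if k = i then a else if k = j then b else 0"
  have *: "(\<Sum>k<n. f k * ?v k) = f i * a + f j * b" for f
  proof -
    have "(\<Sum>k<n. f k * ?v k) = (\<Sum>k\<in>{i,j}. f k * ?v k)"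
      using ij by (intro sum.mono_neutral_right) auto
    thus ?thesis using ij by simp
  qed
  have **: "(\<Sum>k<n. cnj (?v k) * f k) = cnj a * f i + cnj b * f j" for f
  proof -
    have "(\<Sum>k<n. cnj (?v k) * f k) = (\<Sum>k\<in>{i,j}. cnj (?v k) * f k)"
      using ij by (intro sum.mono_neutral_right) auto
    thus ?thesis using ij by simp
  qed
  have "qform A ?v = (\<Sum>k<n. cnj (?v k) * (\<Sum>l<n. A $$ (k,l) * ?v l))"
    unfolding qform_carrier[OF A] by (simp add: sum_distrib_left mult.assoc)
  thus ?thesis unfolding * ** by (simp add: algebra_simps)
qed

lemma qform_unit:
  assumes A: "A \<in> carrier_mat n n" and i: "i < n"
  shows "qform A (\<lambda>k. if k = i then 1 else 0) = A $$ (i,i)"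
proof -
  have "qform A (\<lambda>k. if k = i then 1 else 0) = (\<Sum>k<n. \<Sum>l<n. if l = i then if k = i then A $$ (i,i) else 0 else 0)"
    unfolding qform_carrier[OF A] by (intro sum.cong refl) auto
  thus ?thesis using i by simp
qed

lemma psd_diag:
  assumes "psd A" "A \<in> carrier_mat n n" "i < n"
  shows "Im (A $$ (i,i)) = 0" "Re (A $$ (i,i)) \<ge> 0"
  using psd_ReD[OF assms(1)] psd_ImD[OF assms(1)] qform_unit[OF assms(2,3)] by metis+

text \<open>Real values of the quadratic form already force hermiticity: test vectors with the two
  entries \<open>1, 1\<close> and \<open>1, \<i>\<close> expose the imaginary part of the sum and
  the real part of the difference of two mirrored entries.\<close>

lemma psd_adj:
  assumes psd: "psd A" and A: "A \<in> carrier_mat n n"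
  shows "adj A = A"
proof (rule eq_matI)
  fix i j assume "i < dim_row A" "j < dim_col A"
  hence ij: "i < n" "j < n" using A by auto
  show "adj A $$ (i,j) = A $$ (i,j)"
  proof (cases "i = j")
    case True
    thus ?thesis using psd_diag[OF psd A ij(1)] A ij by (auto simp: complex_eq_iff)
  next
    case False
    have d: "Im (A $$ (i,i)) = 0" "Im (A $$ (j,j)) = 0" using psd_diag[OF psd A] ij by auto
    note q = qform_two_point[OF A ij False]
    have "Im (A $$ (i,j)) + Im (A $$ (j,i)) = 0"
      using psd_ImD[OF psd, of "\<lambda>k. if k = i then 1 else if k = j then 1 else 0"] d unfolding q by simp
    moreover have "Re (A $$ (i,j)) - Re (A $$ (j,i)) = 0"
      using psd_ImD[OF psd, of "\<lambda>k. if k = i then 1 else if k = j then \<i> else 0"] d unfolding q by simp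
    ultimately show ?thesis using A ij by (auto simp: complex_eq_iff)
  qed
qed (use A in auto)

lemma hermitian_index:
  assumes "adj A = A" "A \<in> carrier_mat n n" "i < n" "j < n"
  shows "cnj (A $$ (i,j)) = A $$ (j,i)"
  using index_adj[of j A i] assms by auto

lemma qform_add: "A \<in> carrier_mat n n \<Longrightarrow> B \<in> carrier_mat n n \<Longrightarrow> qform (A + B) v = qform A v + qform B v"
  by (simp add: qform_carrier[where n = n] distrib_left distrib_right sum.distrib)

lemma qform_minus: "A \<in> carrier_mat n n \<Longrightarrow> B \<in> carrier_mat n n \<Longrightarrow> qform (A - B) v = qform A v - qform B v"
  by (simp add: qform_carrier[where n = n] minus_carrier_mat left_diff_distrib right_diff_distrib sum_subtractf)

lemma qform_smult: "A \<in> carrier_mat n n \<Longrightarrow> qform (c \<cdot>\<^sub>m A) v = c * qform A v"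
  by (simp add: qform_carrier[where n = n] sum_distrib_left mult_ac)

lemma qform_one: "qform (1\<^sub>m n) v = complex_of_real (\<Sum>i<n. (cmod (v i))\<^sup>2)"
proof -
  have "qform (1\<^sub>m n) v = (\<Sum>i<n. \<Sum>j<n. if i = j then cnj (v i) * v i else 0)"
    unfolding qform_carrier[OF one_carrier_mat] by (intro sum.cong refl) auto
  also have "\<dots> = (\<Sum>i<n. cnj (v i) * v i)" by simp
  finally show ?thesis by (simp add: complex_norm_square[symmetric] mult.commute[of "cnj _"])
qed

text \<open>A zero of a nonnegative form is a minimum. Moving coordinate \<open>i\<close> of
  \<open>v\<close> changes the form by a term linear in the \<open>i\<close>-th entry of the image
  of \<open>v\<close> and a quadratic one, so a small step against that entry would make the form
  negative.\<close>

lemma qform_zero_imp_kernel: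
  assumes psd: "psd A" and A: "A \<in> carrier_mat n n" and q: "qform A v = 0" and i: "i < n"
  shows "(\<Sum>j<n. A $$ (i,j) * v j) = 0"
proof -
  define z where "z = (\<Sum>j<n. A $$ (i,j) * v j)"
  have h: "adj A = A" using psd_adj[OF psd A] .
  have cz: "(\<Sum>j<n. cnj (v j) * A $$ (j,i)) = cnj z"
    unfolding z_def cnj_sum using i by (intro sum.cong) (auto simp: hermitian_index[OF h A i] mult.commute)
  let ?a = "A $$ (i,i)"
  have exp: "qform A (\<lambda>k. v k + (if k = i then c else 0)) = cnj c * z + cnj z * c + cnj c * ?a * c" for c
  proof -
    have "qform A (\<lambda>k. v k + (if k = i then c else 0)) =
       (\<Sum>k<n. \<Sum>j<n. cnj (v k) * A $$ (k,j) * v j + (if k = i then cnj c * (A $$ (i,j) * v j) else 0)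
          + (if j = i then cnj (v k) * A $$ (k,i) * c else 0) + (if j = i then if k = i then cnj c * ?a * c else 0 else 0))"
      unfolding qform_carrier[OF A] by (intro sum.cong refl) (auto simp: algebra_simps)
    also have "\<dots> = qform A v + (\<Sum>k<n. \<Sum>j<n. (if k = i then cnj c * (A $$ (i,j) * v j) else 0))
       + (\<Sum>k<n. cnj (v k) * A $$ (k,i) * c) + cnj c * ?a * c"
      using i by (simp add: sum.distrib qform_carrier[OF A] if_distrib[of "sum _"] cong: if_cong)
    also have "(\<Sum>k<n. \<Sum>j<n. (if k = i then cnj c * (A $$ (i,j) * v j) else 0)) = (\<Sum>k<n. if k = i then cnj c * z else 0)"
      by (intro sum.cong refl) (auto simp: z_def sum_distrib_left)
    also have "\<dots> = cnj c * z" using i by simp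
    also have "(\<Sum>k<n. cnj (v k) * A $$ (k,i) * c) = cnj z * c" by (simp add: cz flip: sum_distrib_right)
    finally show ?thesis using q by simp
  qed
  define a where "a = Re ?a"
  have a: "a \<ge> 0" "?a = of_real a" using psd_diag[OF psd A i] by (auto simp: a_def complex_eq_iff)
  \<comment> \<open>The 1 in the denominator covers a vanishing diagonal entry. Since
    \<open>t * a < 1\<close>, the step \<open>- t * z\<close> lowers the form by more than
    \<open>t\<close> times the squared modulus of \<open>z\<close>, unless
    \<open>z = 0\<close>.\<close>
  define t where "t = 1 / (a + 1)"
  have t: "t > 0" "t * a < 1" using a by (auto simp: t_def field_simps)
  let ?c = "- of_real t * z"
  have "cnj ?c * z + cnj z * ?c + cnj ?c * ?a * ?c = of_real (-2 * t + t * (t * a)) * (z * cnj z)"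
    by (simp add: a(2) algebra_simps)
  also have "\<dots> = of_real ((-2 * t + t * (t * a)) * (cmod z)\<^sup>2)"
    by (simp only: complex_norm_square[symmetric] of_real_mult)
  finally have "(-2 * t + t * (t * a)) * (cmod z)\<^sup>2 \<ge> 0"
    using psd_ReD[OF psd, of "\<lambda>k. v k + (if k = i then ?c else 0)"] unfolding exp by (metis Re_complex_of_real)
  moreover have "t * (t * a) < t * 1" using t by (intro mult_strict_left_mono)
  hence "-2 * t + t * (t * a) < 0" using t by linarith
  ultimately have "z = 0" using mult_neg_pos[of "-2 * t + t * (t * a)" "(cmod z)\<^sup>2"] by fastforce
  thus ?thesis by (simp add: z_def)
qed

text \<open>Reduces traces and congruences of the shape \<open>adj D * (B * D)\<close> to quadratic
  forms at the columns of \<open>D\<close>, without any spectral decomposition.\<close>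

lemma qform_mult_col:
  assumes "B \<in> carrier_mat n n" "D \<in> carrier_mat n n" "i < n"
  shows "(adj D * (B * D)) $$ (i,i) = qform B (\<lambda>k. D $$ (k,i))"
proof -
  have "(adj D * (B * D)) $$ (i,i) = (\<Sum>k<n. cnj (D $$ (k,i)) * (B * D) $$ (k,i))"
    using assms by (subst index_mult_sum[where m = n and n = n and l = n]) auto
  also have "\<dots> = (\<Sum>k<n. cnj (D $$ (k,i)) * (\<Sum>j<n. B $$ (k,j) * D $$ (j,i)))"
    using assms by (intro sum.cong refl arg_cong2[where f = "(*)"] index_mult_sum) auto
  finally show ?thesis using assms by (simp add: qform_carrier[OF assms(1)] sum_distrib_left mult.assoc)
qed

lemma mtrace_carrier: "A \<in> carrier_mat n n \<Longrightarrow> mtrace A = (\<Sum>i<n. A $$ (i,i))"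
  by (simp add: mtrace_def)

lemma mtrace_mult:
  assumes "A \<in> carrier_mat n m" "B \<in> carrier_mat m n"
  shows "mtrace (A * B) = (\<Sum>i<n. \<Sum>j<m. A $$ (i,j) * B $$ (j,i))"
proof -
  have "mtrace (A * B) = (\<Sum>i<n. (A * B) $$ (i,i))" using assms by (simp add: mtrace_def)
  also have "\<dots> = (\<Sum>i<n. \<Sum>j<m. A $$ (i,j) * B $$ (j,i))"
    by (intro sum.cong refl index_mult_sum[OF assms]) auto
  finally show ?thesis .
qed

lemma mtrace_mult_commute:
  assumes "A \<in> carrier_mat n m" "B \<in> carrier_mat m n"
  shows "mtrace (A * B) = mtrace (B * A)"
  unfolding mtrace_mult[OF assms] mtrace_mult[OF assms(2,1)]
  by (subst sum.swap) (simp add: mult.commute)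

lemma mtrace_add: "A \<in> carrier_mat n n \<Longrightarrow> B \<in> carrier_mat n n \<Longrightarrow> mtrace (A + B) = mtrace A + mtrace B"
  by (simp add: mtrace_def sum.distrib)

lemma hermitian_square_eq_zero:
  assumes D: "D \<in> carrier_mat n n" "adj D = D" and "D * D = 0\<^sub>m n n"
  shows "D = 0\<^sub>m n n"
proof (rule eq_matI)
  fix i j assume "i < dim_row (0\<^sub>m n n :: complex mat)" "j < dim_col (0\<^sub>m n n :: complex mat)"
  hence ij: "i < n" "j < n" by auto
  have "0 = (D * D) $$ (i,i)" using assms ij by simp
  also have "\<dots> = (\<Sum>k<n. D $$ (i,k) * D $$ (k,i))" using ij D by (subst index_mult_sum[where m = n]) auto
  also have "\<dots> = of_real (\<Sum>k<n. (cmod (D $$ (i,k)))\<^sup>2)"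
    unfolding of_real_sum using ij by (intro sum.cong refl)
      (simp add: hermitian_index[OF D(2,1), of i, symmetric] complex_norm_square del: of_real_power)
  finally have "(\<Sum>k<n. (cmod (D $$ (i,k)))\<^sup>2) = 0" by (metis of_real_eq_0_iff)
  hence "D $$ (i,j) = 0" using ij by (subst (asm) sum_nonneg_eq_0_iff) auto
  thus "D $$ (i,j) = 0\<^sub>m n n $$ (i,j)" using ij by simp
qed (use D in auto)

text \<open>With \<open>D = B - C\<close>, the identity \<open>B D + D C = 0\<close> forces \<open>tr (D B D) + tr (D C D) = 0\<close>;
  both traces are nonnegative, so \<open>B D = C D = 0\<close> and hence \<open>D\<^sup>2 = 0\<close>.\<close>
lemma psd_sqrt_unique:
  assumes B: "B \<in> carrier_mat n n" "psd B" and C: "C \<in> carrier_mat n n" "psd C" and eq: "B * B = C * C"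
  shows "B = C"
proof -
  define D where "D = B - C"
  have D: "D \<in> carrier_mat n n" using minus_carrier_mat[OF C(1)] by (simp add: D_def)
  have aB: "adj B = B" and aC: "adj C = C" using B C psd_adj by auto
  have "adj D = adj B - adj C" using B C by (intro eq_matI) (auto simp: D_def)
  hence aD: "adj D = D" by (simp add: aB aC D_def)
  have "B * D = B * B - B * C"
    unfolding D_def using B C by (simp add: mult_minus_distrib_mat[where nr = n and n = n and nc = n])
  moreover have "D * C = B * C - C * C"
    unfolding D_def using B C by (simp add: minus_mult_distrib_mat[where nr = n and n = n and nc = n])
  ultimately have "B * D + D * C = 0\<^sub>m n n" using B C by (intro eq_matI) (auto simp: eq)
  hence "D * (B * D) + D * (D * C) = 0\<^sub>m n n"
    using B C D by (subst mult_add_distrib_mat[symmetric, where nr = n and n = n and nc = n]) auto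
  hence "mtrace (D * (B * D)) + mtrace (D * (D * C)) = 0"
    using B C D by (subst mtrace_add[symmetric, where n = n]) (auto simp: mtrace_def)
  also have "mtrace (D * (D * C)) = mtrace (D * (C * D))"
    using mtrace_mult_commute[of D n n "D * C"] B C D by (simp add: square_mult_assoc[where n = n])
  finally have "mtrace (D * (B * D)) + mtrace (D * (C * D)) = 0" .
  moreover have tr: "mtrace (D * (X * D)) = (\<Sum>i<n. qform X (\<lambda>k. D $$ (k,i)))" if "X \<in> carrier_mat n n" for X
    using that D qform_mult_col[OF that D] by (simp add: mtrace_def aD)
  ultimately have sum0: "(\<Sum>i<n. Re (qform B (\<lambda>k. D $$ (k,i)))) + (\<Sum>i<n. Re (qform C (\<lambda>k. D $$ (k,i)))) = 0"
    using B C unfolding Re_sum[symmetric] plus_complex.sel(1)[symmetric] by simp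
  have nonneg: "(\<Sum>i<n. Re (qform X (\<lambda>k. D $$ (k,i)))) \<ge> 0" if "psd X" for X
    using psd_ReD[OF that] by (intro sum_nonneg) auto
  have zero: "X * D = 0\<^sub>m n n" if X: "X \<in> carrier_mat n n" "psd X"
    and s: "(\<Sum>i<n. Re (qform X (\<lambda>k. D $$ (k,i)))) = 0" for X
  proof (rule eq_matI)
    fix i j assume "i < dim_row (0\<^sub>m n n :: complex mat)" "j < dim_col (0\<^sub>m n n :: complex mat)"
    hence ij: "i < n" "j < n" by auto
    have "Re (qform X (\<lambda>k. D $$ (k,j))) = 0"
      using s ij psd_ReD[OF X(2)] by (subst (asm) sum_nonneg_eq_0_iff) auto
    hence "qform X (\<lambda>k. D $$ (k,j)) = 0" using psd_ImD[OF X(2)] by (auto simp: complex_eq_iff)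
    from qform_zero_imp_kernel[OF X(2,1) this ij(1)]
    show "(X * D) $$ (i,j) = 0\<^sub>m n n $$ (i,j)" using ij index_mult_sum[OF X(1) D ij] by simp
  qed (use X D in auto)
  have "B * D = 0\<^sub>m n n" "C * D = 0\<^sub>m n n"
    using zero[OF B] zero[OF C] nonneg[OF B(2)] nonneg[OF C(2)] sum0 by linarith+
  hence "D * D = 0\<^sub>m n n"
    using B C D unfolding D_def by (subst minus_mult_distrib_mat[where nr = n and n = n and nc = n]) auto
  hence "D = 0\<^sub>m n n" using hermitian_square_eq_zero[OF D aD] by simp
  hence "B $$ (i,j) = C $$ (i,j)" if "i < n" "j < n" for i j
    using that C index_minus_mat(1)[of i C j B] by (simp add: D_def)
  thus ?thesis using B(1) C(1) by (intro eq_matI) auto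
qed

text \<open>Makes the definite description in \<open>msqrt\<close> computable: by uniqueness, any
  positive square root of \<open>adj A * A\<close> that can be exhibited is the right one.\<close>

lemma trace_norm_eq:
  assumes A: "A \<in> carrier_mat n n" and B: "B \<in> carrier_mat n n" "psd B" "B * B = adj A * A"
  shows "trace_norm A = Re (mtrace B)"
proof -
  have "msqrt (adj A * A) = B"
    unfolding msqrt_def
  proof (rule the_equality)
    fix C assume C: "psd C \<and> dim_row C = dim_row (adj A * A) \<and> C * C = adj A * A"
    hence "C \<in> carrier_mat n n" using A by (auto simp: psd_def)
    thus "C = B" using psd_sqrt_unique[of C n B] B C by simp
  qed (use A B in auto)
  thus ?thesis by (simp add: trace_norm_def)
qed

section \<open>Trace norm duality\<close>

lemma qform_conj:
  assumes A: "A \<in> carrier_mat n n" and X: "X \<in> carrier_mat n n"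
  shows "qform (adj X * (A * X)) v = qform A (\<lambda>k. \<Sum>j<n. X $$ (k,j) * v j)"
proof (cases "n = 0")
  case True
  thus ?thesis using A X by (simp add: qform_def)
next
  case False
  \<comment> \<open>All columns of \<open>D\<close> equal \<open>v\<close>, so the form at
    \<open>v\<close> becomes a corner entry of a congruence. The corner exists only for positive
    \<open>n\<close>, hence the case distinction.\<close>
  define D where "D = mat n n (\<lambda>(k,j). v k)"
  have D: "D \<in> carrier_mat n n" by (simp add: D_def)
  have "qform (adj X * (A * X)) v = qform (adj X * (A * X)) (\<lambda>k. D $$ (k,0))"
    using A X False by (simp add: qform_carrier[where n = n] D_def)
  also have "\<dots> = (adj D * ((adj X * (A * X)) * D)) $$ (0,0)"
    using False A X D by (intro qform_mult_col[symmetric, where n = n]) auto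
  also have "adj D * ((adj X * (A * X)) * D) = adj (X * D) * (A * (X * D))"
    using A X D by (simp add: square_mult_assoc[where n = n] adj_mult[where n = n and m = n and l = n])
  also have "\<dots> $$ (0,0) = qform A (\<lambda>k. (X * D) $$ (k,0))"
    using False A X D by (intro qform_mult_col[where n = n]) auto
  also have "\<dots> = qform A (\<lambda>k. \<Sum>j<n. X $$ (k,j) * v j)"
    unfolding qform_carrier[OF A]
  proof (intro sum.cong refl)
    fix i j assume "i \<in> {..<n}" "j \<in> {..<n}"
    moreover have "(X * D) $$ (k,0) = (\<Sum>j<n. X $$ (k,j) * v j)" if "k < n" for k
      using that False by (subst index_mult_sum[OF X D]) (auto simp: D_def)
    ultimately show "cnj ((X * D) $$ (i,0)) * A $$ (i,j) * (X * D) $$ (j,0) =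
       cnj (\<Sum>j<n. X $$ (i,j) * v j) * A $$ (i,j) * (\<Sum>ja<n. X $$ (j,ja) * v ja)"
      by (simp only: lessThan_iff)
  qed
  finally show ?thesis .
qed

lemma psd_conj:
  assumes "psd A" "A \<in> carrier_mat n n" "X \<in> carrier_mat n n"
  shows "psd (adj X * (A * X))"
  using assms by (intro psdI[of _ n]) (auto simp: qform_conj[where n = n] psd_ReD psd_ImD)

lemma qform_diag_state: "qform (diag_state n l) v = of_real (\<Sum>i<n. l i * (cmod (v i))\<^sup>2)"
proof -
  have "qform (diag_state n l) v = (\<Sum>i<n. \<Sum>j<n. if i = j then of_real (l i) * (v i * cnj (v i)) else 0)"
    unfolding qform_carrier[OF diag_state_carrier] by (intro sum.cong refl) (auto simp: diag_state_def)
  also have "\<dots> = (\<Sum>i<n. of_real (l i) * (v i * cnj (v i)))" by simp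
  finally show ?thesis by (simp only: complex_norm_square[symmetric] of_real_mult of_real_sum)
qed

lemma psd_diag_state: "(\<And>i. i < n \<Longrightarrow> l i \<ge> 0) \<Longrightarrow> psd (diag_state n l)"
  by (intro psdI[of _ n]) (auto simp: qform_diag_state intro!: sum_nonneg)

lemma diag_state_mult: "diag_state n a * diag_state n b = diag_state n (\<lambda>i. a i * b i)"
proof (rule eq_matI)
  fix i j assume "i < dim_row (diag_state n (\<lambda>i. a i * b i))" "j < dim_col (diag_state n (\<lambda>i. a i * b i))"
  hence ij: "i < n" "j < n" by (auto simp: diag_state_def)
  have "(diag_state n a * diag_state n b) $$ (i,j) = (\<Sum>k<n. diag_state n a $$ (i,k) * diag_state n b $$ (k,j))"
    using ij by (intro index_mult_sum) auto
  also have "\<dots> = (\<Sum>k<n. if k = i then (if i = j then of_real (a i * b i) else 0) else 0)"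
    using ij by (intro sum.cong) (auto simp: diag_state_def)
  finally show "(diag_state n a * diag_state n b) $$ (i,j) = diag_state n (\<lambda>i. a i * b i) $$ (i,j)"
    using ij by (simp add: diag_state_def)
qed (auto simp: diag_state_def)

lemma adj_diag_state [simp]: "adj (diag_state n a) = diag_state n a"
  by (rule eq_matI) (auto simp: diag_state_def)

lemma mtrace_diag_state: "mtrace (diag_state n a) = of_real (\<Sum>i<n. a i)"
  by (simp add: mtrace_def diag_state_def)

lemma trace_norm_diag_state: "trace_norm (diag_state n a) = (\<Sum>i<n. \<bar>a i\<bar>)"
  using trace_norm_eq[of "diag_state n a" n "diag_state n (\<lambda>i. \<bar>a i\<bar>)"]
  by (simp add: psd_diag_state diag_state_mult mtrace_diag_state)

text \<open>The unit ball dual to the trace norm on Hermitian matrices. It is written in the order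
  as K between -1 and 1, since it is used through pairings with positive matrices; hermiticity
  follows from positivity of \<open>1\<^sub>m n + K\<close>.\<close>

definition contraction :: "nat \<Rightarrow> complex mat \<Rightarrow> bool" where
  "contraction n K \<longleftrightarrow> K \<in> carrier_mat n n \<and> psd (1\<^sub>m n - K) \<and> psd (1\<^sub>m n + K)"

definition trace_ip :: "complex mat \<Rightarrow> complex mat \<Rightarrow> real" where
  "trace_ip A B = Re (mtrace (A * B))"

lemma trace_ip_sum:
  assumes "A \<in> carrier_mat n n" "B \<in> carrier_mat n n"
  shows "trace_ip A B = (\<Sum>i<n. \<Sum>j<n. Re (A $$ (i,j) * B $$ (j,i)))"
  by (simp add: trace_ip_def mtrace_mult[OF assms] Re_sum del: times_complex.sel)

lemma conj_mult:
  assumes U: "unitary_mat n U" and "D \<in> carrier_mat n n" "E \<in> carrier_mat n n"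
  shows "(U * D * adj U) * (U * E * adj U) = U * (D * E) * adj U"
proof -
  have u: "U \<in> carrier_mat n n" "adj U * U = 1\<^sub>m n" using U by (auto simp: unitary_mat_def)
  have "(U * D * adj U) * (U * E * adj U) = U * D * (adj U * U) * (E * adj U)"
    using u(1) assms by (simp add: square_mult_assoc[where n = n])
  also have "\<dots> = U * (D * E) * adj U"
    unfolding u(2) using u(1) assms by (simp add: square_mult_assoc[where n = n])
  finally show ?thesis .
qed

lemma mtrace_conj:
  assumes U: "unitary_mat n U" and D: "D \<in> carrier_mat n n"
  shows "mtrace (U * D * adj U) = mtrace D"
proof -
  have u: "U \<in> carrier_mat n n" "adj U * U = 1\<^sub>m n" using U by (auto simp: unitary_mat_def)
  have "mtrace (U * D * adj U) = mtrace (adj U * (U * D))"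
    using u D by (intro mtrace_mult_commute[where n = n and m = n]) auto
  also have "adj U * (U * D) = adj U * U * D" using u(1) D by (simp add: square_mult_assoc[where n = n])
  finally show ?thesis using u D by simp
qed

lemma unitary_adj: "unitary_mat n U \<Longrightarrow> unitary_mat n (adj U)"
  by (auto simp: unitary_mat_def)

lemma trace_ip_conj:
  assumes U: "unitary_mat n U" and "A \<in> carrier_mat n n" "B \<in> carrier_mat n n"
  shows "trace_ip (adj U * (A * U)) (adj U * (B * U)) = trace_ip A B"
proof -
  have u: "U \<in> carrier_mat n n" using U by (auto simp: unitary_mat_def)
  show ?thesis
    using conj_mult[OF unitary_adj[OF U] assms(2,3)] mtrace_conj[OF unitary_adj[OF U], of "A * B"] assms u
    by (simp add: trace_ip_def square_mult_assoc[where n = n])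
qed

lemma psd_conj_adj:
  assumes U: "U \<in> carrier_mat n n" and "D \<in> carrier_mat n n" "psd D"
  shows "psd (U * D * adj U)"
  using psd_conj[OF assms(3,2) adj_carrier[OF U]] assms by (simp add: square_mult_assoc[where n = n])

lemma diag_state_add: "diag_state n a + diag_state n b = diag_state n (\<lambda>i. a i + b i)"
  and diag_state_diff: "diag_state n a - diag_state n b = diag_state n (\<lambda>i. a i - b i)"
  and diag_state_one: "diag_state n (\<lambda>_. 1) = 1\<^sub>m n"
  by (rule eq_matI; auto simp: diag_state_def)+

lemma conj_add:
  assumes "U \<in> carrier_mat n n" "D \<in> carrier_mat n n" "E \<in> carrier_mat n n"
  shows "U * D * adj U + U * E * adj U = U * (D + E) * adj U"
  using assms by (simp add: mult_add_distrib_mat[where nr = n and n = n and nc = n]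
      add_mult_distrib_mat[where nr = n and n = n and nc = n])

lemma conj_diff:
  assumes "U \<in> carrier_mat n n" "D \<in> carrier_mat n n" "E \<in> carrier_mat n n"
  shows "U * D * adj U - U * E * adj U = U * (D - E) * adj U"
  using assms by (simp add: mult_minus_distrib_mat[where nr = n and n = n and nc = n]
      minus_mult_distrib_mat[where nr = n and n = n and nc = n])

text \<open>The optimal contraction is the sign of \<open>A\<close>: keep the eigenbasis and replace
  each eigenvalue by its sign, so that \<open>A * W\<close> is the absolute value of
  \<open>A\<close>.\<close>

theorem trace_norm_attained:
  assumes A: "A \<in> carrier_mat n n" "adj A = A"
  shows "\<exists>W. contraction n W \<and> trace_norm A = trace_ip A W"
proof -
  obtain U l where U: "unitary_mat n U" and AU: "A = U * diag_state n l * adj U"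
    using hermitian_spectral[OF A] by blast
  have u: "U \<in> carrier_mat n n" "U * adj U = 1\<^sub>m n" using U by (auto simp: unitary_mat_def)
  let ?B = "U * diag_state n (\<lambda>i. \<bar>l i\<bar>) * adj U"
  let ?W = "U * diag_state n (\<lambda>i. sgn (l i)) * adj U"
  have "psd ?B" using u by (intro psd_conj_adj psd_diag_state) auto
  moreover have "?B * ?B = adj A * A"
    unfolding A(2) unfolding AU using U by (simp add: conj_mult diag_state_mult)
  ultimately have tn: "trace_norm A = Re (mtrace ?B)" using A u by (intro trace_norm_eq[of A n]) auto
  have AW: "A * ?W = ?B"
    unfolding AU using U by (simp add: conj_mult diag_state_mult abs_sgn)
  have one: "1\<^sub>m n = U * diag_state n (\<lambda>_. 1) * adj U" using u by (simp add: diag_state_one)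
  have "psd (1\<^sub>m n - ?W)"
    unfolding one using u
    by (subst conj_diff[where n = n]) (auto simp: diag_state_diff sgn_if intro!: psd_conj_adj psd_diag_state)
  moreover have "psd (1\<^sub>m n + ?W)"
    unfolding one using u
    by (subst conj_add[where n = n]) (auto simp: diag_state_add sgn_if intro!: psd_conj_adj psd_diag_state)
  ultimately have "contraction n ?W" using u by (simp add: contraction_def)
  thus ?thesis using tn AW by (auto simp: trace_ip_def)
qed

text \<open>In an eigenbasis of \<open>A\<close> the pairing is a sum of nonnegative eigenvalues of
  \<open>A\<close> times diagonal entries of the rotated \<open>B\<close>, which stay
  nonnegative.\<close>

lemma trace_ip_psd_nonneg:
  assumes A: "A \<in> carrier_mat n n" "psd A" and B: "B \<in> carrier_mat n n" "psd B"
  shows "trace_ip A B \<ge> 0"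
proof -
  obtain U l where U: "unitary_mat n U" and AU: "A = U * diag_state n l * adj U"
    using hermitian_spectral[OF A(1) psd_adj[OF A(2,1)]] by blast
  have u: "U \<in> carrier_mat n n" "adj U * U = 1\<^sub>m n" using U by (auto simp: unitary_mat_def)
  have "adj U * (A * U) = (adj U * U) * diag_state n l * (adj U * U)"
    unfolding AU using u(1) by (simp add: square_mult_assoc[where n = n])
  hence D: "adj U * (A * U) = diag_state n l" using u by simp
  have l: "l i \<ge> 0" if "i < n" for i
    using psd_diag[OF psd_conj[OF A(2,1) u(1)], of n i] that A u unfolding D by (simp add: diag_state_def)
  define B' where "B' = adj U * (B * U)"
  have B': "B' \<in> carrier_mat n n" "psd B'" using psd_conj[OF B(2,1) u(1)] B u by (auto simp: B'_def)
  have "trace_ip A B = trace_ip (diag_state n l) B'"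
    using trace_ip_conj[OF U A(1) B(1)] by (simp add: D B'_def)
  also have "\<dots> = (\<Sum>i<n. \<Sum>j<n. if i = j then l i * Re (B' $$ (i,i)) else 0)"
    unfolding trace_ip_sum[OF diag_state_carrier B'(1)] by (intro sum.cong refl) (auto simp: diag_state_def)
  also have "\<dots> = (\<Sum>i<n. l i * Re (B' $$ (i,i)))" by simp
  also have "\<dots> \<ge> 0" using l psd_diag[OF B'(2,1)] by (intro sum_nonneg mult_nonneg_nonneg) auto
  finally show ?thesis .
qed

text \<open>Congruence with the real diagonal matrix of the weights \<open>s\<close>, written
  entrywise. It serves both the weighted contraction estimate and the pretty good
  measurement.\<close>

lemma psd_scale:
  assumes A: "A \<in> carrier_mat n n" "psd A"
  shows "psd (mat n n (\<lambda>(i,j). of_real (s i * s j) * A $$ (i,j)))"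
proof -
  let ?M = "mat n n (\<lambda>(i,j). of_real (s i * s j) * A $$ (i,j))"
  have M: "?M \<in> carrier_mat n n" by simp
  have "qform ?M v = qform A (\<lambda>i. of_real (s i) * v i)" for v
    unfolding qform_carrier[OF A(1)] qform_carrier[OF M] by (intro sum.cong refl) auto
  thus ?thesis using A by (intro psdI[OF M]) (auto simp: psd_ReD psd_ImD)
qed

section \<open>Bias of one bit against quantum side information\<close>

lemma trace_ip_minus_left:
  assumes "A \<in> carrier_mat n n" "B \<in> carrier_mat n n" "C \<in> carrier_mat n n"
  shows "trace_ip (A - B) C = trace_ip A C - trace_ip B C"
  using assms by (simp add: trace_ip_sum[where n = n] minus_carrier_mat algebra_simps sum_subtractf)

lemma trace_ip_smult_left:
  assumes "A \<in> carrier_mat n n" "B \<in> carrier_mat n n"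
  shows "trace_ip (complex_of_real c \<cdot>\<^sub>m A) B = c * trace_ip A B"
  using assms by (simp add: trace_ip_sum[where n = n] algebra_simps sum_distrib_left)

text \<open>The \<open>K\<close>-factor of Cauchy-Schwarz. Pair 1 - K, scaled by \<open>s\<close>
  from both sides, with 1 + K: both are positive, the terms linear in K cancel on the diagonal, and
  what remains is the difference of the two sides.\<close>

lemma contraction_weighted_frobenius:
  assumes K: "contraction n K" and s: "\<And>i. i < n \<Longrightarrow> s i \<ge> 0"
  shows "(\<Sum>i<n. \<Sum>j<n. s i * s j * (cmod (K $$ (i,j)))\<^sup>2) \<le> (\<Sum>i<n. (s i)\<^sup>2)"
proof -
  have Kc: "K \<in> carrier_mat n n" and p1: "psd (1\<^sub>m n - K)" and p2: "psd (1\<^sub>m n + K)"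
    using K by (auto simp: contraction_def)
  have c1: "1\<^sub>m n - K \<in> carrier_mat n n" and c2: "1\<^sub>m n + K \<in> carrier_mat n n"
    using Kc by (auto simp: minus_carrier_mat)
  have sym: "K $$ (j,i) = cnj (K $$ (i,j))" if "i < n" "j < n" for i j
    using hermitian_index[OF psd_adj[OF p2 c2] c2, of i j] that Kc by (auto split: if_splits)
  let ?M = "mat n n (\<lambda>(i,j). of_real (s i * s j) * (1\<^sub>m n - K) $$ (i,j))"
  have "0 \<le> trace_ip ?M (1\<^sub>m n + K)"
    using psd_scale[OF c1 p1] c2 p2 by (intro trace_ip_psd_nonneg[where n = n]) auto
  also have "trace_ip ?M (1\<^sub>m n + K) = (\<Sum>i<n. \<Sum>j<n. (if i = j then (s i)\<^sup>2 else 0) -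
      s i * s j * (cmod (K $$ (i,j)))\<^sup>2)"
    unfolding trace_ip_sum[OF mat_carrier c2]
  proof (intro sum.cong refl)
    fix i j assume "i \<in> {..<n}" "j \<in> {..<n}"
    hence ij: "i < n" "j < n" by auto
    have "Re (K $$ (i,j) * K $$ (j,i)) = (cmod (K $$ (i,j)))\<^sup>2"
      unfolding sym[OF ij] complex_norm_square[symmetric] by simp
    thus "Re (?M $$ (i,j) * (1\<^sub>m n + K) $$ (j,i)) =
        (if i = j then (s i)\<^sup>2 else 0) - s i * s j * (cmod (K $$ (i,j)))\<^sup>2"
      using ij Kc by (auto simp: algebra_simps power2_eq_square)
  qed
  finally show ?thesis by (simp add: sum_subtractf)
qed

lemma trace_ip_contraction_le:
  assumes K: "contraction n K" and A: "A \<in> carrier_mat n n" "psd A"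
  shows "\<bar>trace_ip A K\<bar> \<le> Re (mtrace A)"
proof -
  have Kc: "K \<in> carrier_mat n n" and p1: "psd (1\<^sub>m n - K)" and p2: "psd (1\<^sub>m n + K)"
    using K by (auto simp: contraction_def)
  have c1: "1\<^sub>m n - K \<in> carrier_mat n n" and c2: "1\<^sub>m n + K \<in> carrier_mat n n"
    using Kc by (auto simp: minus_carrier_mat)
  have "trace_ip A (1\<^sub>m n - K) = Re (mtrace A) - trace_ip A K"
    using A Kc by (simp add: trace_ip_def mult_minus_distrib_mat[where nr = n and n = n and nc = n] mtrace_def sum_subtractf)
  moreover have "trace_ip A (1\<^sub>m n + K) = Re (mtrace A) + trace_ip A K"
    using A Kc by (simp add: trace_ip_def mult_add_distrib_mat[where nr = n and n = n and nc = n] mtrace_def sum.distrib)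
  ultimately show ?thesis
    using trace_ip_psd_nonneg[OF A c1 p1] trace_ip_psd_nonneg[OF A c2 p2] by linarith
qed

text \<open>Cauchy-Schwarz in linearised form. With the parameter \<open>a\<close> still free, the
  estimates can be added up over matrix entries, seeds and classes before \<open>a\<close> is fixed
  once for all of them.\<close>

lemma amgm_weighted:
  fixes a w x y :: real
  assumes "a > 0" "w > 0"
  shows "x * y \<le> (a * (w * y\<^sup>2) + x\<^sup>2 / w / a) / 2"
proof -
  have "0 \<le> (a * w * y - x)\<^sup>2" by simp
  hence "2 * (a * w) * (x * y) \<le> (a * w)\<^sup>2 * y\<^sup>2 + x\<^sup>2" by (simp add: power2_eq_square algebra_simps)
  hence "x * y \<le> ((a * w)\<^sup>2 * y\<^sup>2 + x\<^sup>2) / (2 * (a * w))" using assms by (simp add: field_simps)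
  also have "\<dots> = (a * (w * y\<^sup>2) + x\<^sup>2 / w / a) / 2" using assms by (simp add: field_simps power2_eq_square)
  finally show ?thesis .
qed

text \<open>The extractor property in homogeneous form: \<open>P\<close> need not be normalised, and \<open>kk\<close> stands for \<open>2\<^sup>k\<close>.\<close>
definition fools_seed :: "'x set \<Rightarrow> 'v set \<Rightarrow> ('v \<Rightarrow> real) \<Rightarrow> ('x \<Rightarrow> 'v \<Rightarrow> real) \<Rightarrow> real \<Rightarrow> real \<Rightarrow> bool" where
  "fools_seed X V q c kk e \<longleftrightarrow> (\<forall>P. (\<forall>x\<in>X. 0 \<le> P x) \<longrightarrow> (\<forall>x\<in>X. kk * P x \<le> sum P X) \<longrightarrow>
     (\<Sum>v\<in>V. q v * \<bar>\<Sum>x\<in>X. c x v * P x\<bar>) \<le> e * sum P X)"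

text \<open>Either \<open>P\<close> is flat enough for the extractor property, or a single heavy
  point has more than a \<open>1 / kk\<close> share of the mass; then the trivial bound
  \<open>sum P X\<close> already lies below \<open>kk * b\<close>. Adding both bounds avoids
  recording which case occurred.\<close>

lemma fools_seed_bound:
  assumes fin: "finite X" "finite V" and kk: "kk > 0" and e: "e \<ge> 0"
    and q: "\<And>v. v \<in> V \<Longrightarrow> q v \<ge> 0" "sum q V = 1"
    and c: "\<And>x v. x \<in> X \<Longrightarrow> v \<in> V \<Longrightarrow> \<bar>c x v\<bar> \<le> 1"
    and fools: "fools_seed X V q c kk e"
    and P: "\<And>x. x \<in> X \<Longrightarrow> 0 \<le> P x" "\<And>x. x \<in> X \<Longrightarrow> P x \<le> b" and b: "b \<ge> 0"
  shows "(\<Sum>v\<in>V. q v * \<bar>\<Sum>x\<in>X. c x v * P x\<bar>) \<le> e * sum P X + kk * b"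
proof (cases "\<forall>x\<in>X. kk * P x \<le> sum P X")
  case True
  hence "(\<Sum>v\<in>V. q v * \<bar>\<Sum>x\<in>X. c x v * P x\<bar>) \<le> e * sum P X"
    using fools P unfolding fools_seed_def by blast
  thus ?thesis using kk b by (smt (verit) mult_nonneg_nonneg)
next
  case False
  then obtain x where x: "x \<in> X" "sum P X < kk * P x" by auto
  have s: "sum P X \<ge> 0" using P by (intro sum_nonneg) auto
  have "\<bar>\<Sum>x\<in>X. c x v * P x\<bar> \<le> sum P X" if "v \<in> V" for v
  proof -
    have "\<bar>\<Sum>x\<in>X. c x v * P x\<bar> \<le> (\<Sum>x\<in>X. \<bar>c x v * P x\<bar>)" by (rule sum_abs)
    also have "\<dots> \<le> sum P X"
      using c[OF _ that] P by (intro sum_mono) (auto simp: abs_mult intro!: mult_left_le_one_le)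
    finally show ?thesis .
  qed
  hence "(\<Sum>v\<in>V. q v * \<bar>\<Sum>x\<in>X. c x v * P x\<bar>) \<le> (\<Sum>v\<in>V. q v * sum P X)"
    using q by (intro sum_mono mult_left_mono) auto
  also have "\<dots> = sum P X" using q by (simp flip: sum_distrib_right)
  also have "\<dots> \<le> kk * b" using x P(2)[OF x(1)] kk by (smt (verit) mult_left_mono)
  finally show ?thesis using mult_nonneg_nonneg[OF e s] by linarith
qed

text \<open>The matrices \<open>M x = R\<^sup>-\<^sup>1\<^sup>/\<^sup>2 \<rho> x R\<^sup>-\<^sup>1\<^sup>/\<^sup>2\<close> form the pretty good measurement of the ensemble \<open>\<rho>\<close>;
  measuring with it reduces the quantum side information to a classical guess \<open>x'\<close>, distributed
  jointly with \<open>x\<close> as \<open>P x x'\<close>. The shift by \<open>\<delta>\<close> makes \<open>R\<close> invertible.\<close>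
lemma one_bit_diagonal:
  fixes \<rho> :: "'x \<Rightarrow> complex mat" and K :: "'v \<Rightarrow> complex mat" and c :: "'x \<Rightarrow> 'v \<Rightarrow> real"
    and \<delta> :: real
  assumes fin: "finite X" "finite V" and kk: "kk > 0" and e: "e \<ge> 0"
    and q: "\<And>v. v \<in> V \<Longrightarrow> q v \<ge> 0" "sum q V = 1"
    and c: "\<And>x v. x \<in> X \<Longrightarrow> v \<in> V \<Longrightarrow> \<bar>c x v\<bar> \<le> 1"
    and fools: "fools_seed X V q c kk e"
    and rho: "\<And>x. x \<in> X \<Longrightarrow> \<rho> x \<in> carrier_mat n n" "\<And>x. x \<in> X \<Longrightarrow> psd (\<rho> x)"
    and diag: "\<And>i j. i < n \<Longrightarrow> j < n \<Longrightarrow> (\<Sum>x\<in>X. \<rho> x $$ (i,j)) = (if i = j then of_real (\<mu> i) else 0)"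
    and sig: "\<sigma> \<in> carrier_mat n n" "psd \<sigma>" and \<eta>: "\<eta> \<ge> 0"
    and dom: "\<And>x. x \<in> X \<Longrightarrow> psd (complex_of_real \<eta> \<cdot>\<^sub>m \<sigma> - \<rho> x)"
    and K: "\<And>v. v \<in> V \<Longrightarrow> contraction n (K v)"
    and \<delta>: "\<delta> > 0" and a: "a > 0"
  shows "(\<Sum>v\<in>V. q v * (\<Sum>x\<in>X. c x v * trace_ip (\<rho> x) (K v)))
     \<le> (a * (sum \<mu> {..<n} + \<delta> * n) + (e * sum \<mu> {..<n} + kk * \<eta> * Re (mtrace \<sigma>)) / a) / 2"
proof -
  have \<mu>: "\<mu> i \<ge> 0" if "i < n" for i
  proof -
    have "\<mu> i = Re (\<Sum>x\<in>X. \<rho> x $$ (i,i))" using diag[OF that that] by simp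
    also have "\<dots> \<ge> 0" unfolding Re_sum using psd_diag[OF rho(2,1)] that by (intro sum_nonneg) auto
    finally show ?thesis .
  qed
  \<comment> \<open>Eigenvalues of the square root of the shifted average state. That state is
    diagonal here, so multiplying by its powers is an entrywise scaling.\<close>
  define s where "s i = sqrt (\<mu> i + \<delta>)" for i
  have s: "s i > 0" "s i * s i = \<mu> i + \<delta>" if "i < n" for i using \<mu>[OF that] \<delta> by (auto simp: s_def)
  have ratio: "\<mu> i / (s i * s i) \<le> 1" if "i < n" for i
    unfolding s(2)[OF that] using \<mu>[OF that] \<delta> by simp
  have rsym: "cnj (\<rho> x $$ (i,j)) = \<rho> x $$ (j,i)" if "x \<in> X" "i < n" "j < n" for x i j
    using hermitian_index[OF psd_adj[OF rho(2,1)] rho(1)] that by blast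
  define M where "M x = mat n n (\<lambda>(i,j). of_real (1 / s i * (1 / s j)) * \<rho> x $$ (i,j))" for x
  have Mc: "M x \<in> carrier_mat n n" for x by (simp add: M_def)
  have Mp: "psd (M x)" if "x \<in> X" for x
    unfolding M_def by (rule psd_scale[OF rho(1)[OF that] rho(2)[OF that]])
  define P where "P x x' = trace_ip (\<rho> x) (M x')" for x x'
  have Pe: "P x x' = (\<Sum>i<n. \<Sum>j<n. Re (\<rho> x $$ (i,j) * \<rho> x' $$ (j,i)) / (s i * s j))" if "x \<in> X" for x x'
    unfolding P_def trace_ip_sum[OF rho(1)[OF that] Mc]
    by (intro sum.cong refl) (auto simp: M_def field_simps)
  have P0: "P x x' \<ge> 0" if "x \<in> X" "x' \<in> X" for x x'
    unfolding P_def using that rho Mc Mp by (intro trace_ip_psd_nonneg[where n = n]) auto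
  \<comment> \<open>A bound on \<open>P x x'\<close> independent of \<open>x\<close>: the domination
    of \<open>\<rho> x\<close> by \<open>\<sigma>\<close>, tested against outcome \<open>x'\<close>.
    As the operators \<open>M x'\<close> sum to at most the identity, these bounds add up to at most
    \<open>\<eta>\<close> times the trace of \<open>\<sigma>\<close>.\<close>
  define b where "b x' = \<eta> * trace_ip \<sigma> (M x')" for x'
  have b0: "b x' \<ge> 0" if "x' \<in> X" for x'
    unfolding b_def using that \<eta> sig Mc Mp by (intro mult_nonneg_nonneg trace_ip_psd_nonneg[where n = n]) auto
  have Pb: "P x x' \<le> b x'" if "x \<in> X" "x' \<in> X" for x x'
  proof -
    have "0 \<le> trace_ip (complex_of_real \<eta> \<cdot>\<^sub>m \<sigma> - \<rho> x) (M x')"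
      using that rho Mc Mp dom by (intro trace_ip_psd_nonneg[where n = n]) (auto simp: minus_carrier_mat)
    also have "\<dots> = b x' - P x x'"
      using sig rho(1)[OF that(1)] Mc by (simp add: trace_ip_minus_left[where n = n] trace_ip_smult_left[where n = n] b_def P_def)
    finally show ?thesis by simp
  qed
  \<comment> \<open>Up to normalisation \<open>P\<close> is the joint law of source value and guess.
    The shift by \<open>\<delta>\<close> makes the measurement incomplete, hence an
    inequality.\<close>
  have sumP: "(\<Sum>x'\<in>X. \<Sum>x\<in>X. P x x') \<le> sum \<mu> {..<n}"
  proof -
    have "(\<Sum>x'\<in>X. \<Sum>x\<in>X. P x x') = (\<Sum>i<n. \<Sum>j<n. Re ((\<Sum>x\<in>X. \<rho> x $$ (i,j)) * (\<Sum>x\<in>X. \<rho> x $$ (j,i))) / (s i * s j))"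
    proof -
      have "(\<Sum>x'\<in>X. \<Sum>x\<in>X. P x x') = (\<Sum>x'\<in>X. \<Sum>x\<in>X. \<Sum>i<n. \<Sum>j<n. Re (\<rho> x $$ (i,j) * \<rho> x' $$ (j,i)) / (s i * s j))"
        by (intro sum.cong refl Pe)
      also have "\<dots> = (\<Sum>x'\<in>X. \<Sum>i<n. \<Sum>j<n. \<Sum>x\<in>X. Re (\<rho> x $$ (i,j) * \<rho> x' $$ (j,i)) / (s i * s j))"
        by (subst sum.swap, subst (2) sum.swap) (rule refl)
      also have "\<dots> = (\<Sum>i<n. \<Sum>j<n. \<Sum>x'\<in>X. \<Sum>x\<in>X. Re (\<rho> x $$ (i,j) * \<rho> x' $$ (j,i)) / (s i * s j))"
        by (subst sum.swap, subst (2) sum.swap) (rule refl)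
      also have "\<dots> = (\<Sum>i<n. \<Sum>j<n. Re ((\<Sum>x\<in>X. \<rho> x $$ (i,j)) * (\<Sum>x\<in>X. \<rho> x $$ (j,i))) / (s i * s j))"
        unfolding sum_product Re_sum sum_divide_distrib
        by (intro sum.cong refl sum.swap)
      finally show ?thesis .
    qed
    also have "\<dots> = (\<Sum>i<n. \<Sum>j<n. if i = j then \<mu> i * (\<mu> i / (s i * s i)) else 0)"
      by (intro sum.cong refl) (auto simp: diag)
    also have "\<dots> = (\<Sum>i<n. \<mu> i * (\<mu> i / (s i * s i)))" by simp
    also have "\<dots> \<le> sum \<mu> {..<n}"
    proof (intro sum_mono mult_left_le)
      fix i assume "i \<in> {..<n}"
      thus "\<mu> i \<ge> 0" "\<mu> i / (s i * s i) \<le> 1" using \<mu> ratio by auto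
    qed
    finally show ?thesis .
  qed
  have sumb: "(\<Sum>x'\<in>X. b x') \<le> \<eta> * Re (mtrace \<sigma>)"
  proof -
    have "(\<Sum>x'\<in>X. trace_ip \<sigma> (M x')) = (\<Sum>x'\<in>X. \<Sum>i<n. \<Sum>j<n. Re (\<sigma> $$ (i,j) * \<rho> x' $$ (j,i)) / (s i * s j))"
      unfolding trace_ip_sum[OF sig(1) Mc]
      by (intro sum.cong refl) (auto simp: M_def field_simps)
    also have "\<dots> = (\<Sum>i<n. \<Sum>j<n. \<Sum>x'\<in>X. Re (\<sigma> $$ (i,j) * \<rho> x' $$ (j,i)) / (s i * s j))"
      by (subst sum.swap, subst (2) sum.swap) (rule refl)
    also have "\<dots> = (\<Sum>i<n. \<Sum>j<n. Re (\<sigma> $$ (i,j) * (\<Sum>x'\<in>X. \<rho> x' $$ (j,i))) / (s i * s j))"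
      unfolding sum_distrib_left Re_sum sum_divide_distrib ..
    also have "\<dots> = (\<Sum>i<n. \<Sum>j<n. if i = j then Re (\<sigma> $$ (i,i)) * (\<mu> i / (s i * s i)) else 0)"
      by (intro sum.cong refl) (auto simp: diag)
    also have "\<dots> = (\<Sum>i<n. Re (\<sigma> $$ (i,i)) * (\<mu> i / (s i * s i)))" by simp
    also have "\<dots> \<le> (\<Sum>i<n. Re (\<sigma> $$ (i,i)))"
    proof (intro sum_mono mult_left_le)
      fix i assume "i \<in> {..<n}"
      thus "Re (\<sigma> $$ (i,i)) \<ge> 0" "\<mu> i / (s i * s i) \<le> 1"
        using ratio psd_diag[OF sig(2,1)] by auto
    qed
    also have "\<dots> = Re (mtrace \<sigma>)" using sig by (simp add: mtrace_def)
    finally show ?thesis unfolding b_def sum_distrib_left[symmetric] using \<eta> by (rule mult_left_mono)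
  qed
  \<comment> \<open>The weighted squared Hilbert-Schmidt norm of the operator \<open>D\<close>
    introduced below. Read as a double sum over the ensemble, it is the bias reached by an adversary
    who obtains \<open>x'\<close> without knowing \<open>v\<close> and then predicts the bit by
    \<open>c x' v\<close>.\<close>
  define Q where "Q v = (\<Sum>x'\<in>X. c x' v * (\<Sum>x\<in>X. c x v * P x x'))" for v
  have amgm: "(\<Sum>x\<in>X. c x v * trace_ip (\<rho> x) (K v)) \<le> (a * (sum \<mu> {..<n} + \<delta> * n) + Q v / a) / 2" if v: "v \<in> V" for v
  proof -
    define D where "D i j = (\<Sum>x\<in>X. of_real (c x v) * \<rho> x $$ (i,j))" for i j
    have Kc: "K v \<in> carrier_mat n n" using K[OF v] by (simp add: contraction_def)
    have "(\<Sum>x\<in>X. c x v * trace_ip (\<rho> x) (K v)) =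
        (\<Sum>x\<in>X. \<Sum>i<n. \<Sum>j<n. Re (of_real (c x v) * \<rho> x $$ (i,j) * K v $$ (j,i)))"
      by (intro sum.cong refl) (simp add: trace_ip_sum[OF rho(1) Kc] sum_distrib_left algebra_simps)
    also have "\<dots> = (\<Sum>i<n. \<Sum>j<n. \<Sum>x\<in>X. Re (of_real (c x v) * \<rho> x $$ (i,j) * K v $$ (j,i)))"
      by (subst sum.swap, subst (2) sum.swap) (rule refl)
    also have "\<dots> = (\<Sum>i<n. \<Sum>j<n. Re (D i j * K v $$ (j,i)))"
      unfolding D_def sum_distrib_right Re_sum ..
    \<comment> \<open>Cauchy-Schwarz entry by entry, with weight \<open>s i * s j\<close> on the
      entries of \<open>K v\<close> and the inverse weight on those of \<open>D\<close>.\<close>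
    also have "\<dots> \<le> (\<Sum>i<n. \<Sum>j<n. (a * (s i * s j * (cmod (K v $$ (j,i)))\<^sup>2) + (cmod (D i j))\<^sup>2 / (s i * s j) / a) / 2)"
    proof (intro sum_mono)
      fix i j assume "i \<in> {..<n}" "j \<in> {..<n}"
      hence "s i * s j > 0" using s by simp
      have "Re (D i j * K v $$ (j,i)) \<le> cmod (D i j * K v $$ (j,i))" by (rule complex_Re_le_cmod)
      also have "\<dots> = cmod (D i j) * cmod (K v $$ (j,i))" by (rule norm_mult)
      also have "\<dots> \<le> (a * (s i * s j * (cmod (K v $$ (j,i)))\<^sup>2) + (cmod (D i j))\<^sup>2 / (s i * s j) / a) / 2"
        by (rule amgm_weighted[OF a \<open>s i * s j > 0\<close>])
      finally show "Re (D i j * K v $$ (j,i)) \<le> (a * (s i * s j * (cmod (K v $$ (j,i)))\<^sup>2) + (cmod (D i j))\<^sup>2 / (s i * s j) / a) / 2" .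
    qed
    also have "\<dots> = (a * (\<Sum>i<n. \<Sum>j<n. s i * s j * (cmod (K v $$ (j,i)))\<^sup>2) + (\<Sum>i<n. \<Sum>j<n. (cmod (D i j))\<^sup>2 / (s i * s j)) / a) / 2"
      by (simp only: sum.distrib sum_distrib_left sum_divide_distrib add_divide_distrib)
    also have "(\<Sum>i<n. \<Sum>j<n. s i * s j * (cmod (K v $$ (j,i)))\<^sup>2) \<le> sum \<mu> {..<n} + \<delta> * n"
    proof -
      have "(\<Sum>i<n. \<Sum>j<n. s i * s j * (cmod (K v $$ (j,i)))\<^sup>2) = (\<Sum>j<n. \<Sum>i<n. s j * s i * (cmod (K v $$ (j,i)))\<^sup>2)"
        by (subst sum.swap) (simp add: mult.commute)
      also have "\<dots> \<le> (\<Sum>i<n. (s i)\<^sup>2)"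
        using s(1) less_imp_le by (intro contraction_weighted_frobenius[OF K[OF v]]) blast
      also have "\<dots> = (\<Sum>i<n. \<mu> i + \<delta>)"
        using s(2) by (intro sum.cong refl) (simp add: power2_eq_square)
      finally show ?thesis by (simp add: sum.distrib mult.commute)
    qed
    also have "(\<Sum>i<n. \<Sum>j<n. (cmod (D i j))\<^sup>2 / (s i * s j)) = Q v"
    proof -
      have "Q v = (\<Sum>x'\<in>X. \<Sum>x\<in>X. \<Sum>i<n. \<Sum>j<n. Re (of_real (c x v) * \<rho> x $$ (i,j) * (of_real (c x' v) * \<rho> x' $$ (j,i))) / (s i * s j))"
        unfolding Q_def sum_distrib_left
        by (intro sum.cong refl) (simp add: Pe sum_distrib_left algebra_simps)
      also have "\<dots> = (\<Sum>x'\<in>X. \<Sum>i<n. \<Sum>j<n. \<Sum>x\<in>X. Re (of_real (c x v) * \<rho> x $$ (i,j) * (of_real (c x' v) * \<rho> x' $$ (j,i))) / (s i * s j))"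
        by (subst sum.swap, subst (2) sum.swap) (rule refl)
      also have "\<dots> = (\<Sum>i<n. \<Sum>j<n. \<Sum>x'\<in>X. \<Sum>x\<in>X. Re (of_real (c x v) * \<rho> x $$ (i,j) * (of_real (c x' v) * \<rho> x' $$ (j,i))) / (s i * s j))"
        by (subst sum.swap, subst (2) sum.swap) (rule refl)
      also have "\<dots> = (\<Sum>i<n. \<Sum>j<n. Re (D i j * D j i) / (s i * s j))"
        unfolding sum_product Re_sum sum_divide_distrib D_def
        by (intro sum.cong refl sum.swap)
      also have "\<dots> = (\<Sum>i<n. \<Sum>j<n. (cmod (D i j))\<^sup>2 / (s i * s j))"
      proof (intro sum.cong refl arg_cong2[where f = "(/)"])
        fix i j assume "i \<in> {..<n}" "j \<in> {..<n}"
        hence "D j i = cnj (D i j)" unfolding D_def cnj_sum by (intro sum.cong) (auto simp: rsym)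
        hence "D i j * D j i = of_real ((cmod (D i j))\<^sup>2)" by (simp only: complex_norm_square)
        thus "Re (D i j * D j i) = (cmod (D i j))\<^sup>2" by (simp only: Re_complex_of_real)
      qed
      finally show ?thesis ..
    qed
    finally show ?thesis using a by (simp add: divide_right_mono)
  qed
  have "(\<Sum>v\<in>V. q v * Q v) = (\<Sum>x'\<in>X. \<Sum>v\<in>V. q v * (c x' v * (\<Sum>x\<in>X. c x v * P x x')))"
    unfolding Q_def sum_distrib_left by (rule sum.swap)
  \<comment> \<open>For each guess \<open>x'\<close> the sign \<open>c x' v\<close> is absorbed by
    an absolute value; what is left is an unnormalised source \<open>\<lambda>x. P x x'\<close> that
    does not depend on \<open>v\<close>, so the extractor property can be applied.\<close>
  also have "\<dots> \<le> (\<Sum>x'\<in>X. e * (\<Sum>x\<in>X. P x x') + kk * b x')"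
  proof (intro sum_mono)
    fix x' assume x': "x' \<in> X"
    have "(\<Sum>v\<in>V. q v * (c x' v * (\<Sum>x\<in>X. c x v * P x x'))) \<le> (\<Sum>v\<in>V. q v * \<bar>\<Sum>x\<in>X. c x v * P x x'\<bar>)"
    proof (intro sum_mono mult_left_mono q(1))
      fix v assume "v \<in> V"
      have "c x' v * (\<Sum>x\<in>X. c x v * P x x') \<le> \<bar>c x' v\<bar> * \<bar>\<Sum>x\<in>X. c x v * P x x'\<bar>"
        by (metis abs_ge_self abs_mult)
      also have "\<dots> \<le> \<bar>\<Sum>x\<in>X. c x v * P x x'\<bar>"
        using c[OF x' \<open>v \<in> V\<close>] by (intro mult_left_le_one_le) auto
      finally show "c x' v * (\<Sum>x\<in>X. c x v * P x x') \<le> \<bar>\<Sum>x\<in>X. c x v * P x x'\<bar>" .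
    qed auto
    also have "\<dots> \<le> e * (\<Sum>x\<in>X. P x x') + kk * b x'"
      using fools_seed_bound[OF fin kk e q c fools, of "\<lambda>x. P x x'" "b x'"] P0 Pb b0 x' by blast
    finally show "(\<Sum>v\<in>V. q v * (c x' v * (\<Sum>x\<in>X. c x v * P x x'))) \<le> e * (\<Sum>x\<in>X. P x x') + kk * b x'" .
  qed
  also have "\<dots> = e * (\<Sum>x'\<in>X. \<Sum>x\<in>X. P x x') + kk * (\<Sum>x'\<in>X. b x')"
    by (simp only: sum.distrib sum_distrib_left)
  also have "\<dots> \<le> e * sum \<mu> {..<n} + kk * (\<eta> * Re (mtrace \<sigma>))"
    using sumP sumb e kk by (intro add_mono mult_left_mono) auto
  finally have Q: "(\<Sum>v\<in>V. q v * Q v) \<le> e * sum \<mu> {..<n} + kk * \<eta> * Re (mtrace \<sigma>)" by simp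
  have "(\<Sum>v\<in>V. q v * (\<Sum>x\<in>X. c x v * trace_ip (\<rho> x) (K v)))
     \<le> (\<Sum>v\<in>V. q v * ((a * (sum \<mu> {..<n} + \<delta> * n) + Q v / a) / 2))"
    using amgm q(1) by (intro sum_mono mult_left_mono) auto
  also have "\<dots> = (\<Sum>v\<in>V. q v * (a * (sum \<mu> {..<n} + \<delta> * n) / 2) + q v * Q v / (2 * a))"
    by (intro sum.cong refl) (use a in \<open>simp add: field_simps\<close>)
  also have "\<dots> = sum q V * (a * (sum \<mu> {..<n} + \<delta> * n) / 2) + (\<Sum>v\<in>V. q v * Q v) / (2 * a)"
    by (simp only: sum.distrib sum_distrib_right sum_divide_distrib)
  also have "\<dots> = (a * (sum \<mu> {..<n} + \<delta> * n) + (\<Sum>v\<in>V. q v * Q v) / a) / 2"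
    unfolding q(2) using a by (simp add: field_simps)
  also have "\<dots> \<le> (a * (sum \<mu> {..<n} + \<delta> * n) + (e * sum \<mu> {..<n} + kk * \<eta> * Re (mtrace \<sigma>)) / a) / 2"
    using Q a by (intro divide_right_mono add_left_mono) auto
  finally show ?thesis .
qed

section \<open>From a diagonal average state to a general one, and to classical side
  information\<close>

lemma qform_sum:
  assumes "\<And>x. x \<in> X \<Longrightarrow> A x \<in> carrier_mat n n"
  shows "qform (mat_sum n n A X) v = (\<Sum>x\<in>X. qform (A x) v)"
proof -
  have "(\<Sum>x\<in>X. qform (A x) v) = (\<Sum>x\<in>X. \<Sum>i<n. \<Sum>j<n. cnj (v i) * A x $$ (i,j) * v j)"
    using assms by (intro sum.cong refl qform_carrier)
  also have "\<dots> = (\<Sum>i<n. \<Sum>j<n. \<Sum>x\<in>X. cnj (v i) * A x $$ (i,j) * v j)"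
    by (subst sum.swap, subst (2) sum.swap) (rule refl)
  also have "\<dots> = qform (mat_sum n n A X) v"
    by (subst qform_carrier[of _ n]) (auto simp: mat_sum_def sum_distrib_left sum_distrib_right)
  finally show ?thesis ..
qed

lemma psd_mat_sum:
  assumes "\<And>x. x \<in> X \<Longrightarrow> A x \<in> carrier_mat n n" "\<And>x. x \<in> X \<Longrightarrow> psd (A x)"
  shows "psd (mat_sum n n A X)"
  by (rule psdI[of _ n])
    (auto simp: mat_sum_def[of n n A X] qform_sum[OF assms(1), unfolded mat_sum_def]
      psd_ReD[OF assms(2)] psd_ImD[OF assms(2)] intro!: sum_nonneg)

lemma index_conj:
  assumes "A \<in> carrier_mat n n" "U \<in> carrier_mat n n" "i < n" "j < n"
  shows "(adj U * (A * U)) $$ (i,j) = (\<Sum>k<n. \<Sum>l<n. cnj (U $$ (k,i)) * A $$ (k,l) * U $$ (l,j))"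
proof -
  have "(adj U * (A * U)) $$ (i,j) = (\<Sum>k<n. cnj (U $$ (k,i)) * (A * U) $$ (k,j))"
    using assms by (subst index_mult_sum[where m = n and n = n and l = n]) auto
  also have "\<dots> = (\<Sum>k<n. cnj (U $$ (k,i)) * (\<Sum>l<n. A $$ (k,l) * U $$ (l,j)))"
    using assms by (intro sum.cong refl arg_cong2[where f = "(*)"] index_mult_sum) auto
  finally show ?thesis by (simp add: sum_distrib_left mult.assoc)
qed

lemma contraction_conj:
  assumes U: "unitary_mat n U" and K: "contraction n K"
  shows "contraction n (adj U * (K * U))"
proof -
  have u: "U \<in> carrier_mat n n" "adj U * U = 1\<^sub>m n" using U by (auto simp: unitary_mat_def)
  have k: "K \<in> carrier_mat n n" "psd (1\<^sub>m n - K)" "psd (1\<^sub>m n + K)" using K by (auto simp: contraction_def)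
  have au: "adj U \<in> carrier_mat n n" using u by simp
  have one: "adj U * (1\<^sub>m n * U) = 1\<^sub>m n" using u by simp
  have "adj U * ((1\<^sub>m n - K) * U) = 1\<^sub>m n - adj U * (K * U)"
    using u(1) k(1) one au by (simp add: minus_mult_distrib_mat[where nr = n and n = n and nc = n]
        mult_minus_distrib_mat[where nr = n and n = n and nc = n] u(2))
  moreover have "adj U * ((1\<^sub>m n + K) * U) = 1\<^sub>m n + adj U * (K * U)"
    using u(1) k(1) one au by (simp add: add_mult_distrib_mat[where nr = n and n = n and nc = n]
        mult_add_distrib_mat[where nr = n and n = n and nc = n] u(2))
  ultimately show ?thesis
    using psd_conj[OF k(2) _ u(1)] psd_conj[OF k(3) _ u(1)] u(1) k(1)
    by (simp add: contraction_def minus_carrier_mat)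
qed

text \<open>Rotating everything into an eigenbasis of the average state makes it diagonal;
  positivity, domination, contractions and traces survive the rotation. The total trace
  \<open>T\<close> is left free because the lemma is meant for one class of sources at a
  time.\<close>

lemma one_bit_class:
  fixes \<rho> :: "'x \<Rightarrow> complex mat" and K :: "'v \<Rightarrow> complex mat" and c :: "'x \<Rightarrow> 'v \<Rightarrow> real"
    and \<delta> :: real
  assumes fin: "finite X" "finite V" and kk: "kk > 0" and e: "e \<ge> 0"
    and q: "\<And>v. v \<in> V \<Longrightarrow> q v \<ge> 0" "sum q V = 1"
    and c: "\<And>x v. x \<in> X \<Longrightarrow> v \<in> V \<Longrightarrow> \<bar>c x v\<bar> \<le> 1"
    and fools: "fools_seed X V q c kk e"
    and rho: "\<And>x. x \<in> X \<Longrightarrow> \<rho> x \<in> carrier_mat n n" "\<And>x. x \<in> X \<Longrightarrow> psd (\<rho> x)"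
    and sig: "\<sigma> \<in> carrier_mat n n" "psd \<sigma>" and \<eta>: "\<eta> \<ge> 0"
    and dom: "\<And>x. x \<in> X \<Longrightarrow> psd (complex_of_real \<eta> \<cdot>\<^sub>m \<sigma> - \<rho> x)"
    and K: "\<And>v. v \<in> V \<Longrightarrow> contraction n (K v)"
    and \<delta>: "\<delta> > 0" and a: "a > 0"
  defines "T \<equiv> (\<Sum>x\<in>X. Re (mtrace (\<rho> x)))"
  shows "(\<Sum>v\<in>V. q v * (\<Sum>x\<in>X. c x v * trace_ip (\<rho> x) (K v)))
     \<le> (a * (T + \<delta> * n) + (e * T + kk * \<eta> * Re (mtrace \<sigma>)) / a) / 2"
proof -
  define R where "R = mat_sum n n \<rho> X"
  have R: "R \<in> carrier_mat n n" by (simp add: R_def mat_sum_def)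
  have "psd R" unfolding R_def by (rule psd_mat_sum[OF rho])
  then obtain U l where U: "unitary_mat n U" and RU: "R = U * diag_state n l * adj U"
    using hermitian_spectral[OF R psd_adj[OF _ R]] by blast
  have u: "U \<in> carrier_mat n n" "adj U * U = 1\<^sub>m n" "U * adj U = 1\<^sub>m n" using U by (auto simp: unitary_mat_def)
  have "adj U * (R * U) = (adj U * U) * diag_state n l * (adj U * U)"
    unfolding RU using u(1) by (simp add: square_mult_assoc[where n = n])
  hence D: "adj U * (R * U) = diag_state n l" using u by simp
  define F where "F A = adj U * (A * U)" for A
  have Fc: "F A \<in> carrier_mat n n" if "A \<in> carrier_mat n n" for A using that u by (simp add: F_def)
  have Fp: "psd (F A)" if "A \<in> carrier_mat n n" "psd A" for A unfolding F_def by (rule psd_conj[OF that(2,1) u(1)])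
  have Ft: "mtrace (F A) = mtrace A" if "A \<in> carrier_mat n n" for A
    using mtrace_conj[OF unitary_adj[OF U] that] that u(1) by (simp add: F_def square_mult_assoc[where n = n])
  have diag: "(\<Sum>x\<in>X. F (\<rho> x) $$ (i,j)) = (if i = j then of_real (l i) else 0)" if ij: "i < n" "j < n" for i j
  proof -
    have "(\<Sum>x\<in>X. F (\<rho> x) $$ (i,j)) = (\<Sum>x\<in>X. \<Sum>k<n. \<Sum>l<n. cnj (U $$ (k,i)) * \<rho> x $$ (k,l) * U $$ (l,j))"
      unfolding F_def by (intro sum.cong refl index_conj rho(1) u(1) ij)
    also have "\<dots> = (\<Sum>k<n. \<Sum>l<n. \<Sum>x\<in>X. cnj (U $$ (k,i)) * \<rho> x $$ (k,l) * U $$ (l,j))"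
      by (subst sum.swap, subst (2) sum.swap) (rule refl)
    also have "\<dots> = (\<Sum>k<n. \<Sum>l<n. cnj (U $$ (k,i)) * R $$ (k,l) * U $$ (l,j))"
      by (intro sum.cong refl) (simp add: R_def mat_sum_def sum_distrib_left sum_distrib_right)
    also have "\<dots> = (adj U * (R * U)) $$ (i,j)" by (rule index_conj[OF R u(1) ij, symmetric])
    finally show ?thesis unfolding D using ij by (simp add: diag_state_def)
  qed
  have "T = (\<Sum>x\<in>X. \<Sum>i<n. Re (F (\<rho> x) $$ (i,i)))"
    unfolding T_def
  proof (intro sum.cong refl)
    fix x assume "x \<in> X"
    thus "Re (mtrace (\<rho> x)) = (\<Sum>i<n. Re (F (\<rho> x) $$ (i,i)))"
      unfolding Re_sum[symmetric] using Ft[OF rho(1)] mtrace_carrier[OF Fc[OF rho(1)]] by simp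
  qed
  also have "\<dots> = (\<Sum>i<n. Re (\<Sum>x\<in>X. F (\<rho> x) $$ (i,i)))" unfolding Re_sum by (rule sum.swap)
  also have "\<dots> = sum l {..<n}" by (intro sum.cong refl) (simp add: diag)
  finally have T: "T = sum l {..<n}" .
  have dom': "psd (complex_of_real \<eta> \<cdot>\<^sub>m F \<sigma> - F (\<rho> x))" if "x \<in> X" for x
  proof -
    have "complex_of_real \<eta> \<cdot>\<^sub>m F \<sigma> - F (\<rho> x) = F (complex_of_real \<eta> \<cdot>\<^sub>m \<sigma> - \<rho> x)"
      unfolding F_def using u(1) sig(1) rho(1)[OF that] adj_carrier[OF u(1)]
      by (simp add: minus_mult_distrib_mat[where nr = n and n = n and nc = n]
        mult_minus_distrib_mat[where nr = n and n = n and nc = n]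
        mult_smult_assoc_mat[where nr = n and n = n and nc = n] mult_smult_distrib[where nr = n and n = n and nc = n])
    moreover have "complex_of_real \<eta> \<cdot>\<^sub>m \<sigma> - \<rho> x \<in> carrier_mat n n"
      using rho(1)[OF that] by (simp add: minus_carrier_mat)
    ultimately show ?thesis using Fp[OF _ dom[OF that]] by simp
  qed
  have "(\<Sum>v\<in>V. q v * (\<Sum>x\<in>X. c x v * trace_ip (\<rho> x) (K v))) =
      (\<Sum>v\<in>V. q v * (\<Sum>x\<in>X. c x v * trace_ip (F (\<rho> x)) (F (K v))))"
    unfolding F_def using K rho(1)
    by (intro sum.cong refl arg_cong2[where f = "(*)"]) (simp add: trace_ip_conj[OF U] contraction_def)
  also have "\<dots> \<le> (a * (sum l {..<n} + \<delta> * n) + (e * sum l {..<n} + kk * \<eta> * Re (mtrace (F \<sigma>))) / a) / 2"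
  proof (rule one_bit_diagonal[OF fin kk e q c fools, where \<rho> = "\<lambda>x. F (\<rho> x)"])
    show "contraction n (F (K v))" if "v \<in> V" for v
      unfolding F_def by (rule contraction_conj[OF U K[OF that]])
  qed (use rho sig Fc Fp diag dom' \<eta> \<delta> a in auto)
  finally show ?thesis using sig Ft T by simp
qed

text \<open>The value \<open>g x\<close> splits the ensemble into classes, each an instance of the
  bound for one class. The main terms add up to the total trace 1, but the guessing term is paid
  once per class; this is the factor \<open>card G\<close> in the size condition.\<close>

lemma one_bit_side_information:
  fixes \<rho> :: "'x \<Rightarrow> complex mat" and K :: "'g \<Rightarrow> 'v \<Rightarrow> complex mat" and c :: "'x \<Rightarrow> 'v \<Rightarrow> real"
  assumes fin: "finite X" "finite V" "finite G" and kk: "kk > 0" and \<epsilon>: "\<epsilon> > 0"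
    and q: "\<And>v. v \<in> V \<Longrightarrow> q v \<ge> 0" "sum q V = 1"
    and c: "\<And>x v. x \<in> X \<Longrightarrow> v \<in> V \<Longrightarrow> \<bar>c x v\<bar> \<le> 1"
    and fools: "fools_seed X V q c kk (2 * \<epsilon>)"
    and rho: "\<And>x. x \<in> X \<Longrightarrow> \<rho> x \<in> carrier_mat n n" "\<And>x. x \<in> X \<Longrightarrow> psd (\<rho> x)"
    and tr: "(\<Sum>x\<in>X. Re (mtrace (\<rho> x))) = 1"
    and sig: "\<sigma> \<in> carrier_mat n n" "psd \<sigma>" "mtrace \<sigma> = 1" and \<eta>: "\<eta> \<ge> 0"
    and dom: "\<And>x. x \<in> X \<Longrightarrow> psd (complex_of_real \<eta> \<cdot>\<^sub>m \<sigma> - \<rho> x)"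
    and g: "\<And>x. x \<in> X \<Longrightarrow> g x \<in> G" and size: "kk * \<eta> * card G \<le> 2 * \<epsilon>"
    and K: "\<And>\<gamma> v. \<gamma> \<in> G \<Longrightarrow> v \<in> V \<Longrightarrow> contraction n (K \<gamma> v)"
  shows "(\<Sum>v\<in>V. q v * (\<Sum>x\<in>X. c x v * trace_ip (\<rho> x) (K (g x) v))) \<le> 3 * sqrt \<epsilon>"
proof -
  define cls where "cls \<gamma> = {x \<in> X. g x = \<gamma>}" for \<gamma>
  have split: "(\<Sum>\<gamma>\<in>G. \<Sum>x\<in>cls \<gamma>. f x) = sum f X" for f :: "'x \<Rightarrow> real"
    unfolding cls_def using g fin by (intro sum.group) auto
  define T where "T \<gamma> = (\<Sum>x\<in>cls \<gamma>. Re (mtrace (\<rho> x)))" for \<gamma>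
  have sumT: "sum T G = 1" unfolding T_def split by (rule tr)
  \<comment> \<open>Small enough that the shift, paid in \<open>n\<close> dimensions for each class,
    costs at most 1 in total; the added 1 keeps the denominator positive.\<close>
  define \<delta> where "\<delta> = 1 / (real n * card G + 1)"
  have \<delta>: "\<delta> > 0" "\<delta> * n * card G \<le> 1" by (auto simp: \<delta>_def divide_le_eq add_nonneg_pos)
  define a where "a = sqrt \<epsilon>"
  have a: "a > 0" "a * a = \<epsilon>" using \<epsilon> by (auto simp: a_def)
  have cls: "(\<Sum>v\<in>V. q v * (\<Sum>x\<in>cls \<gamma>. c x v * trace_ip (\<rho> x) (K \<gamma> v)))
     \<le> (a * (T \<gamma> + \<delta> * n) + (2 * \<epsilon> * T \<gamma> + kk * \<eta> * Re (mtrace \<sigma>)) / a) / 2" if \<gamma>: "\<gamma> \<in> G" for \<gamma>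
    unfolding T_def
  proof (rule one_bit_class)
    show "fools_seed (cls \<gamma>) V q c kk (2 * \<epsilon>)"
      unfolding fools_seed_def
    proof (intro allI impI)
      fix P assume P: "\<forall>x\<in>cls \<gamma>. 0 \<le> P x" "\<forall>x\<in>cls \<gamma>. kk * P x \<le> sum P (cls \<gamma>)"
      \<comment> \<open>A class inherits the extractor property, because weights on it extend by
        zero to weights on all of \<open>X\<close> with the same sums.\<close>
      define P' where "P' x = (if x \<in> cls \<gamma> then P x else 0)" for x
      have ext: "(\<Sum>x\<in>X. f x * P' x) = (\<Sum>x\<in>cls \<gamma>. f x * P x)" for f
        unfolding P'_def using fin by (intro sum.mono_neutral_cong_right) (auto simp: cls_def)
      from ext[of "\<lambda>_. 1"] have s: "sum P' X = sum P (cls \<gamma>)" by simp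
      have "sum P (cls \<gamma>) \<ge> 0" using P by (intro sum_nonneg) auto
      with P have "\<forall>x\<in>X. kk * P' x \<le> sum P' X" "\<forall>x\<in>X. 0 \<le> P' x" unfolding s by (auto simp: P'_def)
      with fools have "(\<Sum>v\<in>V. q v * \<bar>\<Sum>x\<in>X. c x v * P' x\<bar>) \<le> 2 * \<epsilon> * sum P' X"
        unfolding fools_seed_def by blast
      thus "(\<Sum>v\<in>V. q v * \<bar>\<Sum>x\<in>cls \<gamma>. c x v * P x\<bar>) \<le> 2 * \<epsilon> * sum P (cls \<gamma>)"
        unfolding ext s .
    qed
  qed (use fin kk \<epsilon> q c rho sig \<eta> dom K[OF \<gamma>] \<delta> a in \<open>auto simp: cls_def\<close>)
  have "(\<Sum>v\<in>V. q v * (\<Sum>x\<in>X. c x v * trace_ip (\<rho> x) (K (g x) v))) =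
      (\<Sum>v\<in>V. \<Sum>\<gamma>\<in>G. q v * (\<Sum>x\<in>cls \<gamma>. c x v * trace_ip (\<rho> x) (K \<gamma> v)))"
    unfolding split[symmetric] sum_distrib_left[of _ _ G]
    by (intro sum.cong refl arg_cong2[where f = "(*)"]) (auto simp: cls_def)
  also have "\<dots> = (\<Sum>\<gamma>\<in>G. \<Sum>v\<in>V. q v * (\<Sum>x\<in>cls \<gamma>. c x v * trace_ip (\<rho> x) (K \<gamma> v)))"
    by (rule sum.swap)
  also have "\<dots> \<le> (\<Sum>\<gamma>\<in>G. (a * (T \<gamma> + \<delta> * n) + (2 * \<epsilon> * T \<gamma> + kk * \<eta> * Re (mtrace \<sigma>)) / a) / 2)"
    by (intro sum_mono cls)
  also have "\<dots> = (a * (sum T G + \<delta> * n * card G) + (2 * \<epsilon> * sum T G + kk * \<eta> * card G) / a) / 2"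
    by (simp add: sig sum.distrib flip: sum_divide_distrib sum_distrib_left) (simp add: algebra_simps)
  \<comment> \<open>With \<open>a * a = \<epsilon>\<close> the trace and the shift contribute
    \<open>a / 2\<close> each, the extractor bias and the guessing term \<open>a\<close>
    each.\<close>
  also have "\<dots> \<le> (a * (1 + 1) + (2 * \<epsilon> * 1 + 2 * \<epsilon>) / a) / 2"
    unfolding sumT using \<delta> a size by (intro divide_right_mono add_mono mult_left_mono) auto
  also have "\<dots> = 3 * a" using a by (simp add: field_simps)
  finally show ?thesis by (simp add: a_def)
qed

section \<open>Block-diagonal matrices and min-entropy\<close>

text \<open>A direct sum of \<open>D\<close> blocks of size \<open>n\<close>. The index
  \<open>w * n + a\<close> agrees with that of \<open>kron\<close>, so this is a classical register
  followed by a quantum one.\<close>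

definition block_diag :: "nat \<Rightarrow> nat \<Rightarrow> (nat \<Rightarrow> complex mat) \<Rightarrow> complex mat" where
  "block_diag D n f = mat (D * n) (D * n)
     (\<lambda>(i,j). if i div n = j div n then f (i div n) $$ (i mod n, j mod n) else 0)"

lemma block_diag_carrier [simp]: "block_diag D n f \<in> carrier_mat (D * n) (D * n)"
  by (simp add: block_diag_def)

lemma block_index_less: "w < D \<Longrightarrow> a < n \<Longrightarrow> w * n + a < D * (n::nat)"
proof -
  assume "w < D" "a < n"
  hence "w * n + a < (w + 1) * n" by simp
  also have "\<dots> \<le> D * n" using \<open>w < D\<close> by (intro mult_right_mono) auto
  finally show ?thesis .
qed

lemma sum_blocks: "(\<Sum>i<D * n. f i) = (\<Sum>w<D. \<Sum>a<n. f (w * n + a))"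
  for f :: "nat \<Rightarrow> 'a::comm_monoid_add"
proof (induction D)
  case (Suc D)
  have "(\<Sum>i<Suc D * n. f i) = (\<Sum>i<D * n. f i) + (\<Sum>i\<in>{D * n..<D * n + n}. f i)"
    by (simp add: lessThan_atLeast0 sum.atLeastLessThan_concat add.commute)
  also have "(\<Sum>i\<in>{D * n..<D * n + n}. f i) = (\<Sum>a<n. f (D * n + a))"
    using sum.shift_bounds_nat_ivl[of f 0 "D * n" n] by (simp add: lessThan_atLeast0 add.commute)
  finally show ?case using Suc by simp
qed simp

lemma sum_blocks_diag:
  fixes g :: "nat \<Rightarrow> nat \<Rightarrow> 'a::comm_monoid_add"
  assumes "\<And>i j. i < D * n \<Longrightarrow> j < D * n \<Longrightarrow> i div n \<noteq> j div n \<Longrightarrow> g i j = 0"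
  shows "(\<Sum>i<D * n. \<Sum>j<D * n. g i j) = (\<Sum>w<D. \<Sum>a<n. \<Sum>b<n. g (w * n + a) (w * n + b))"
  unfolding sum_blocks
proof (rule sum.cong[OF refl], rule sum.cong[OF refl])
  fix w a assume wa: "w \<in> {..<D}" "a \<in> {..<n}"
  have "(\<Sum>w'<D. \<Sum>b<n. g (w * n + a) (w' * n + b)) =
      (\<Sum>w'<D. if w' = w then \<Sum>b<n. g (w * n + a) (w * n + b) else 0)"
  proof (intro sum.cong refl)
    fix w' assume w': "w' \<in> {..<D}"
    show "(\<Sum>b<n. g (w * n + a) (w' * n + b)) = (if w' = w then \<Sum>b<n. g (w * n + a) (w * n + b) else 0)"
    proof (cases "w' = w")
      case False
      have "g (w * n + a) (w' * n + b) = 0" if "b < n" for b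
        using that wa w' False by (intro assms) (auto simp: block_index_less)
      thus ?thesis using False by simp
    qed simp
  qed
  thus "(\<Sum>w'<D. \<Sum>b<n. g (w * n + a) (w' * n + b)) = (\<Sum>b<n. g (w * n + a) (w * n + b))"
    using wa by simp
qed

lemma qform_block_diag:
  assumes "\<And>w. w < D \<Longrightarrow> f w \<in> carrier_mat n n"
  shows "qform (block_diag D n f) v = (\<Sum>w<D. qform (f w) (\<lambda>a. v (w * n + a)))"
proof -
  have "qform (block_diag D n f) v = (\<Sum>w<D. \<Sum>a<n. \<Sum>b<n.
      cnj (v (w * n + a)) * block_diag D n f $$ (w * n + a, w * n + b) * v (w * n + b))"
    unfolding qform_carrier[OF block_diag_carrier] by (rule sum_blocks_diag) (auto simp: block_diag_def)
  also have "\<dots> = (\<Sum>w<D. qform (f w) (\<lambda>a. v (w * n + a)))"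
  proof (intro sum.cong refl)
    fix w assume w: "w \<in> {..<D}"
    have "qform (f w) (\<lambda>a. v (w * n + a)) = (\<Sum>a<n. \<Sum>b<n. cnj (v (w * n + a)) * f w $$ (a,b) * v (w * n + b))"
      using w by (intro qform_carrier assms) auto
    also have "\<dots> = (\<Sum>a<n. \<Sum>b<n. cnj (v (w * n + a)) * block_diag D n f $$ (w * n + a, w * n + b) * v (w * n + b))"
      using w by (intro sum.cong refl) (auto simp: block_diag_def block_index_less)
    finally show "(\<Sum>a<n. \<Sum>b<n. cnj (v (w * n + a)) * block_diag D n f $$ (w * n + a, w * n + b) * v (w * n + b))
      = qform (f w) (\<lambda>a. v (w * n + a))" ..
  qed
  finally show ?thesis .
qed

lemma psd_block_diag_iff:
  assumes f: "\<And>w. w < D \<Longrightarrow> f w \<in> carrier_mat n n"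
  shows "psd (block_diag D n f) \<longleftrightarrow> (\<forall>w<D. psd (f w))"
proof
  assume p: "psd (block_diag D n f)"
  show "\<forall>w<D. psd (f w)"
  proof (intro allI impI)
    fix w assume w: "w < D"
    have "qform (f w) v = qform (block_diag D n f) (\<lambda>i. if i div n = w then v (i mod n) else 0)" for v
    proof -
      have "qform (block_diag D n f) (\<lambda>i. if i div n = w then v (i mod n) else 0) =
        (\<Sum>w'<D. qform (f w') (\<lambda>a. if (w' * n + a) div n = w then v ((w' * n + a) mod n) else 0))"
        by (rule qform_block_diag[OF f])
      also have "\<dots> = (\<Sum>w'<D. if w' = w then qform (f w) v else 0)"
      proof (intro sum.cong refl)
        fix w' assume "w' \<in> {..<D}"
        hence "f w' \<in> carrier_mat n n" using f by auto
        from qform_carrier[OF this] qform_carrier[OF f[OF w]]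
        show "qform (f w') (\<lambda>a. if (w' * n + a) div n = w then v ((w' * n + a) mod n) else 0) =
          (if w' = w then qform (f w) v else 0)" by auto
      qed
      finally show ?thesis using w by simp
    qed
    thus "psd (f w)" using p f[OF w] by (intro psdI[of _ n]) (auto simp: psd_ReD psd_ImD)
  qed
next
  assume "\<forall>w<D. psd (f w)"
  thus "psd (block_diag D n f)"
    using f by (intro psdI[of _ "D * n"]) (auto simp: qform_block_diag psd_ReD psd_ImD intro!: sum_nonneg)
qed

text \<open>In terms of quadratic forms, compressing a contraction to a block and taking signed
  averages of contractions become immediate.\<close>

lemma contraction_iff:
  "contraction n K \<longleftrightarrow> K \<in> carrier_mat n n \<and>
     (\<forall>v. Im (qform K v) = 0 \<and> \<bar>Re (qform K v)\<bar> \<le> (\<Sum>i<n. (cmod (v i))\<^sup>2))"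
proof (cases "K \<in> carrier_mat n n")
  case True
  have "qform (1\<^sub>m n - K) v = of_real (\<Sum>i<n. (cmod (v i))\<^sup>2) - qform K v"
    "qform (1\<^sub>m n + K) v = of_real (\<Sum>i<n. (cmod (v i))\<^sup>2) + qform K v" for v
    using qform_minus[OF one_carrier_mat True] qform_add[OF one_carrier_mat True] by (auto simp: qform_one)
  thus ?thesis using True unfolding contraction_def psd_iff_qform
    by (auto simp: abs_le_iff) (smt (verit))+
qed (simp add: contraction_def)

text \<open>Only the diagonal blocks of the optimal contraction meet a block-diagonal matrix, and
  each block is again a contraction, as vectors extended by zero show. So the test may be chosen
  after reading the classical register.\<close>

lemma trace_norm_block_diag_attained:
  assumes f: "\<And>w. w < D \<Longrightarrow> f w \<in> carrier_mat n n" "\<And>w. w < D \<Longrightarrow> adj (f w) = f w"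
  shows "\<exists>K. (\<forall>w<D. contraction n (K w)) \<and> trace_norm (block_diag D n f) = (\<Sum>w<D. trace_ip (f w) (K w))"
proof -
  have "adj (block_diag D n f) = block_diag D n f"
  proof (rule eq_matI)
    fix i j assume "i < dim_row (block_diag D n f)" "j < dim_col (block_diag D n f)"
    hence ij: "i < D * n" "j < D * n" by (auto simp: block_diag_def)
    hence "n > 0" by (cases n) auto
    hence w: "i div n < D" "i mod n < n" "j mod n < n" using ij by (auto simp: div_less_iff_less_mult mult.commute)
    show "adj (block_diag D n f) $$ (i,j) = block_diag D n f $$ (i,j)"
      using ij hermitian_index[OF f(2)[OF w(1)] f(1)[OF w(1)] w(3,2)] by (auto simp: block_diag_def)
  qed (auto simp: block_diag_def)
  then obtain W where W: "contraction (D * n) W" and tn: "trace_norm (block_diag D n f) = trace_ip (block_diag D n f) W"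
    using trace_norm_attained[OF block_diag_carrier] by blast
  have Wc: "W \<in> carrier_mat (D * n) (D * n)" using W by (simp add: contraction_def)
  define K where "K w = mat n n (\<lambda>(a,b). W $$ (w * n + a, w * n + b))" for w
  have Kc: "K w \<in> carrier_mat n n" for w by (simp add: K_def)
  have "contraction n (K w)" if w: "w < D" for w
  proof -
    define e where "e v i = (if i div n = w then v (i mod n) else 0)" for v :: "nat \<Rightarrow> complex" and i
    have e: "e v (w' * n + a) = (if w' = w then v a else 0)" if "a < n" for v w' a
      using that by (auto simp: e_def)
    have "qform W (e v) = qform (K w) v" for v
    proof -
      have "qform W (e v) = (\<Sum>w1<D. \<Sum>a<n. \<Sum>w2<D. \<Sum>b<n.
          cnj (e v (w1 * n + a)) * W $$ (w1 * n + a, w2 * n + b) * e v (w2 * n + b))"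
        unfolding qform_carrier[OF Wc] sum_blocks ..
      also have "\<dots> = (\<Sum>w1<D. \<Sum>a<n. \<Sum>w2<D. \<Sum>b<n.
          if w2 = w then if w1 = w then cnj (v a) * W $$ (w * n + a, w * n + b) * v b else 0 else 0)"
        by (intro sum.cong refl) (auto simp: e)
      also have "\<dots> = (\<Sum>w1<D. \<Sum>a<n. \<Sum>b<n. \<Sum>w2<D.
          if w2 = w then if w1 = w then cnj (v a) * W $$ (w * n + a, w * n + b) * v b else 0 else 0)"
        by (intro sum.cong refl sum.swap)
      also have "\<dots> = (\<Sum>w1<D. \<Sum>a<n. \<Sum>b<n. if w1 = w then cnj (v a) * W $$ (w * n + a, w * n + b) * v b else 0)"
        using w by simp
      also have "\<dots> = (\<Sum>w1<D. if w1 = w then \<Sum>a<n. \<Sum>b<n. cnj (v a) * W $$ (w * n + a, w * n + b) * v b else 0)"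
        by (intro sum.cong refl) auto
      also have "\<dots> = qform (K w) v" using w unfolding qform_carrier[OF Kc] by (simp add: K_def)
      finally show ?thesis .
    qed
    moreover have "(\<Sum>i<D * n. (cmod (e v i))\<^sup>2) = (\<Sum>a<n. (cmod (v a))\<^sup>2)" for v
    proof -
      have "(\<Sum>i<D * n. (cmod (e v i))\<^sup>2) = (\<Sum>w1<D. \<Sum>a<n. if w1 = w then (cmod (v a))\<^sup>2 else 0)"
        unfolding sum_blocks by (intro sum.cong refl) (auto simp: e)
      also have "\<dots> = (\<Sum>w1<D. if w1 = w then \<Sum>a<n. (cmod (v a))\<^sup>2 else 0)"
        by (intro sum.cong refl) auto
      finally show ?thesis using w by simp
    qed
    ultimately show ?thesis using W Kc unfolding contraction_iff by metis
  qed
  moreover have "trace_ip (block_diag D n f) W = (\<Sum>w<D. trace_ip (f w) (K w))"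
  proof -
    have "trace_ip (block_diag D n f) W = (\<Sum>w<D. \<Sum>a<n. \<Sum>b<n.
       Re (block_diag D n f $$ (w * n + a, w * n + b) * W $$ (w * n + b, w * n + a)))"
      unfolding trace_ip_sum[OF block_diag_carrier Wc] by (rule sum_blocks_diag) (auto simp: block_diag_def)
    also have "\<dots> = (\<Sum>w<D. \<Sum>a<n. \<Sum>b<n. Re (f w $$ (a,b) * K w $$ (b,a)))"
      by (intro sum.cong refl) (auto simp: block_diag_def K_def block_index_less)
    also have "\<dots> = (\<Sum>w<D. trace_ip (f w) (K w))"
      by (intro sum.cong refl trace_ip_sum[symmetric] f Kc) auto
    finally show ?thesis .
  qed
  ultimately show ?thesis using tn by metis
qed

section \<open>Min-entropy as domination of each conditional state\<close>

lemma kron_proj: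
  assumes "i < M * n" "j < M * n" "A \<in> carrier_mat n n" "z < M"
  shows "kron (proj M z) A $$ (i,j) = (if i div n = z \<and> j div n = z then A $$ (i mod n, j mod n) else 0)"
proof -
  have "n > 0" using assms by (cases n) auto
  hence "i div n < M" "j div n < M" using assms by (auto simp: div_less_iff_less_mult mult.commute)
  thus ?thesis using assms by (simp add: kron_def proj_def)
qed

lemma cq_joint_block_diag:
  assumes "\<And>x. x < 2 ^ n \<Longrightarrow> \<rho> x \<in> carrier_mat dE dE"
  shows "cq_joint n dE \<rho> = block_diag (2 ^ n) dE \<rho>"
proof (rule eq_matI)
  fix i j assume "i < dim_row (block_diag (2 ^ n) dE \<rho>)" "j < dim_col (block_diag (2 ^ n) dE \<rho>)"
  hence ij: "i < 2 ^ n * dE" "j < 2 ^ n * dE" by (auto simp: block_diag_def)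
  hence "dE > 0" by (cases dE) auto
  hence w: "i div dE < 2 ^ n" using ij by (auto simp: div_less_iff_less_mult mult.commute)
  have "cq_joint n dE \<rho> $$ (i,j) = (\<Sum>x<2 ^ n. if i div dE = x \<and> j div dE = x then \<rho> x $$ (i mod dE, j mod dE) else 0)"
    unfolding cq_joint_def mat_sum_def using ij assms
    by (auto intro!: sum.cong kron_proj)
  also have "\<dots> = (\<Sum>x<2 ^ n. if x = i div dE then (if i div dE = j div dE then \<rho> (i div dE) $$ (i mod dE, j mod dE) else 0) else 0)"
    by (intro sum.cong refl) auto
  also have "\<dots> = block_diag (2 ^ n) dE \<rho> $$ (i,j)" using w ij by (simp add: block_diag_def)
  finally show "cq_joint n dE \<rho> $$ (i,j) = block_diag (2 ^ n) dE \<rho> $$ (i,j)" .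
qed (auto simp: block_diag_def cq_joint_def mat_sum_def)

lemma kron_one_block_diag:
  assumes "\<sigma> \<in> carrier_mat n n"
  shows "kron (1\<^sub>m D) \<sigma> = block_diag D n (\<lambda>_. \<sigma>)"
proof (rule eq_matI)
  fix i j assume "i < dim_row (block_diag D n (\<lambda>_. \<sigma>))" "j < dim_col (block_diag D n (\<lambda>_. \<sigma>))"
  hence ij: "i < D * n" "j < D * n" by (auto simp: block_diag_def)
  hence "n > 0" by (cases n) auto
  hence "i div n < D" "j div n < D" using ij by (auto simp: div_less_iff_less_mult mult.commute)
  thus "kron (1\<^sub>m D) \<sigma> $$ (i,j) = block_diag D n (\<lambda>_. \<sigma>) $$ (i,j)"
    using ij assms by (simp add: kron_def block_diag_def)
qed (use assms in \<open>auto simp: block_diag_def kron_def\<close>)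

text \<open>A crude entrywise estimate, meant to dominate a matrix by some multiple of the
  identity.\<close>

lemma qform_bound:
  assumes A: "A \<in> carrier_mat n n"
  shows "cmod (qform A v) \<le> (\<Sum>i<n. \<Sum>j<n. cmod (A $$ (i,j))) * (\<Sum>i<n. (cmod (v i))\<^sup>2)"
proof -
  let ?s = "\<Sum>i<n. (cmod (v i))\<^sup>2"
  have "cmod (qform A v) \<le> (\<Sum>i<n. cmod (\<Sum>j<n. cnj (v i) * A $$ (i,j) * v j))"
    unfolding qform_carrier[OF A] by (rule norm_sum)
  also have "\<dots> \<le> (\<Sum>i<n. \<Sum>j<n. cmod (cnj (v i) * A $$ (i,j) * v j))"
    by (intro sum_mono norm_sum)
  also have "\<dots> \<le> (\<Sum>i<n. \<Sum>j<n. cmod (A $$ (i,j)) * ?s)"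
  proof (intro sum_mono)
    fix i j assume ij: "i \<in> {..<n}" "j \<in> {..<n}"
    have "(cmod (v i))\<^sup>2 \<le> ?s" "(cmod (v j))\<^sup>2 \<le> ?s" using ij by (auto intro!: member_le_sum)
    moreover have "2 * (cmod (v i) * cmod (v j)) \<le> (cmod (v i))\<^sup>2 + (cmod (v j))\<^sup>2"
      using sum_squares_bound[of "cmod (v i)" "cmod (v j)"] by simp
    ultimately have "cmod (v i) * cmod (v j) \<le> ?s" by linarith
    hence "cmod (A $$ (i,j)) * (cmod (v i) * cmod (v j)) \<le> cmod (A $$ (i,j)) * ?s"
      by (intro mult_left_mono) auto
    thus "cmod (cnj (v i) * A $$ (i,j) * v j) \<le> cmod (A $$ (i,j)) * ?s" by (simp add: norm_mult mult_ac)
  qed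
  finally show ?thesis by (simp add: sum_distrib_right)
qed

text \<open>Both sides are direct sums over \<open>x\<close>, so the operator inequality can be
  checked block by block. This is the form in which min-entropy enters the one-bit bound.\<close>

lemma mat_le_cq_joint_iff:
  assumes "\<And>x. x < 2 ^ n \<Longrightarrow> \<rho> x \<in> carrier_mat dE dE" "\<sigma> \<in> carrier_mat dE dE"
  shows "mat_le (cq_joint n dE \<rho>) (c \<cdot>\<^sub>m kron (1\<^sub>m (2 ^ n)) \<sigma>) \<longleftrightarrow> (\<forall>x<2 ^ n. psd (c \<cdot>\<^sub>m \<sigma> - \<rho> x))"
proof -
  have cq: "cq_joint n dE \<rho> = block_diag (2 ^ n) dE \<rho>" using assms(1) by (rule cq_joint_block_diag)
  have "c \<cdot>\<^sub>m kron (1\<^sub>m (2 ^ n)) \<sigma> - cq_joint n dE \<rho> = block_diag (2 ^ n) dE (\<lambda>x. c \<cdot>\<^sub>m \<sigma> - \<rho> x)"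
    unfolding cq kron_one_block_diag[OF assms(2)]
  proof (rule eq_matI)
    fix i j assume "i < dim_row (block_diag (2 ^ n) dE (\<lambda>x. c \<cdot>\<^sub>m \<sigma> - \<rho> x))"
      "j < dim_col (block_diag (2 ^ n) dE (\<lambda>x. c \<cdot>\<^sub>m \<sigma> - \<rho> x))"
    hence ij: "i < 2 ^ n * dE" "j < 2 ^ n * dE" by (auto simp: block_diag_def)
    hence "dE > 0" by (cases dE) auto
    moreover from this have "i div dE < 2 ^ n" using ij by (auto simp: div_less_iff_less_mult mult.commute)
    ultimately show "(c \<cdot>\<^sub>m block_diag (2 ^ n) dE (\<lambda>_. \<sigma>) - block_diag (2 ^ n) dE \<rho>) $$ (i,j) =
       block_diag (2 ^ n) dE (\<lambda>x. c \<cdot>\<^sub>m \<sigma> - \<rho> x) $$ (i,j)"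
      using ij assms(1)[of "i div dE"] assms(2) by (auto simp: block_diag_def)
  qed (auto simp: block_diag_def)
  moreover have "c \<cdot>\<^sub>m \<sigma> - \<rho> x \<in> carrier_mat dE dE" if "x < 2 ^ n" for x
    using assms(1)[OF that] by (simp add: minus_carrier_mat)
  moreover have "dim_row (cq_joint n dE \<rho>) = dim_row (c \<cdot>\<^sub>m kron (1\<^sub>m (2 ^ n)) \<sigma>)"
    "dim_col (cq_joint n dE \<rho>) = dim_col (c \<cdot>\<^sub>m kron (1\<^sub>m (2 ^ n)) \<sigma>)"
    using assms(2) by (auto simp: cq_joint_def mat_sum_def kron_def)
  ultimately show ?thesis using psd_block_diag_iff[of "2 ^ n" "\<lambda>x. c \<cdot>\<^sub>m \<sigma> - \<rho> x" dE]
    unfolding mat_le_def by simp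
qed

text \<open>The supremum defining \<open>Hmin\<close> is a genuine one (over a nonempty set bounded above), so every
  smaller exponent is dominated by an attained one.\<close>
lemma Hmin_cq_witness:
  assumes cq: "cq_state n dE \<rho>" and H: "Hmin (2 ^ n) dE (cq_joint n dE \<rho>) > h"
  shows "\<exists>\<sigma> lam. lam > h \<and> density dE \<sigma> \<and> (\<forall>x<2 ^ n. psd (complex_of_real (2 powr (- lam)) \<cdot>\<^sub>m \<sigma> - \<rho> x))"
proof -
  have rc: "\<And>x. x < 2 ^ n \<Longrightarrow> \<rho> x \<in> carrier_mat dE dE" and rp: "\<And>x. x < 2 ^ n \<Longrightarrow> psd (\<rho> x)"
    and tr: "(\<Sum>x<2 ^ n. mtrace (\<rho> x)) = 1" using cq by (auto simp: cq_state_def)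
  define L where "L = {lam. \<exists>\<sigma>. density dE \<sigma> \<and> (\<forall>x<2 ^ n. psd (complex_of_real (2 powr (- lam)) \<cdot>\<^sub>m \<sigma> - \<rho> x))}"
  have "Hmin (2 ^ n) dE (cq_joint n dE \<rho>) = Sup L"
    unfolding Hmin_def L_def using mat_le_cq_joint_iff[OF rc, where c = "complex_of_real (2 powr (- _))"]
    by (intro arg_cong[where f = Sup] Collect_cong ex_cong) (auto simp: density_def)
  moreover have "L \<noteq> {}"
  proof -
    have dE: "dE > 0"
    proof (rule ccontr)
      assume "\<not> dE > 0"
      hence "mtrace (\<rho> x) = 0" if "x < 2 ^ n" for x using rc[OF that] by (simp add: mtrace_def)
      thus False using tr by simp
    qed
    \<comment> \<open>The maximally mixed state scaled by \<open>B * dE\<close> dominates every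
      \<open>\<rho> x\<close>, so \<open>- log 2 (B * dE)\<close> lies in \<open>L\<close>. The
      added 1 keeps the argument of the logarithm positive.\<close>
    define B where "B = (\<Sum>x<2 ^ n. \<Sum>i<dE. \<Sum>j<dE. cmod (\<rho> x $$ (i,j))) + 1"
    have B: "(\<Sum>i<dE. \<Sum>j<dE. cmod (\<rho> x $$ (i,j))) \<le> B" if "x < 2 ^ n" for x
      unfolding B_def using that
      by (intro order.trans[OF member_le_sum[of x "{..<2 ^ n}" "\<lambda>x. \<Sum>i<dE. \<Sum>j<dE. cmod (\<rho> x $$ (i,j))"]])
        (auto intro!: sum_nonneg)
    have B0: "B > 0" unfolding B_def by (intro add_nonneg_pos sum_nonneg) auto
    define \<sigma> where "\<sigma> = complex_of_real (1 / dE) \<cdot>\<^sub>m 1\<^sub>m dE"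
    have sc: "\<sigma> \<in> carrier_mat dE dE" by (simp add: \<sigma>_def)
    have qs: "qform \<sigma> v = of_real (1 / dE * (\<Sum>i<dE. (cmod (v i))\<^sup>2))" for v
      unfolding \<sigma>_def qform_smult[OF one_carrier_mat] qform_one by (simp only: of_real_mult)
    have "psd \<sigma>" by (intro psdI[OF sc]) (auto simp: qs intro!: mult_nonneg_nonneg divide_nonneg_nonneg sum_nonneg)
    moreover have "mtrace \<sigma> = 1" using dE by (simp add: \<sigma>_def mtrace_def)
    ultimately have "density dE \<sigma>" using sc by (simp add: density_def)
    moreover have "psd (complex_of_real (2 powr (- (- log 2 (B * dE)))) \<cdot>\<^sub>m \<sigma> - \<rho> x)" if x: "x < 2 ^ n" for x
    proof (rule psdI[of _ dE])
      have c: "complex_of_real (2 powr (- (- log 2 (B * dE)))) \<cdot>\<^sub>m \<sigma> \<in> carrier_mat dE dE" using sc by simp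
      have "2 powr (- (- log 2 (B * dE))) = B * dE" using B0 dE by simp
      hence q: "qform (complex_of_real (2 powr (- (- log 2 (B * dE)))) \<cdot>\<^sub>m \<sigma> - \<rho> x) v =
          of_real (B * (\<Sum>i<dE. (cmod (v i))\<^sup>2)) - qform (\<rho> x) v" for v
        unfolding qform_minus[OF c rc[OF x]] qform_smult[OF sc] qs using dE by (simp del: of_real_sum)
      show "Im (qform (complex_of_real (2 powr (- (- log 2 (B * dE)))) \<cdot>\<^sub>m \<sigma> - \<rho> x) v) = 0" for v
        unfolding q using psd_ImD[OF rp[OF x]] by simp
      have "Re (qform (\<rho> x) v) \<le> B * (\<Sum>i<dE. (cmod (v i))\<^sup>2)" for v
      proof -
        have "Re (qform (\<rho> x) v) \<le> cmod (qform (\<rho> x) v)" by (rule complex_Re_le_cmod)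
        also have "\<dots> \<le> (\<Sum>i<dE. \<Sum>j<dE. cmod (\<rho> x $$ (i,j))) * (\<Sum>i<dE. (cmod (v i))\<^sup>2)"
          by (rule qform_bound[OF rc[OF x]])
        also have "\<dots> \<le> B * (\<Sum>i<dE. (cmod (v i))\<^sup>2)"
          using B[OF x] by (intro mult_right_mono sum_nonneg) auto
        finally show ?thesis .
      qed
      thus "Re (qform (complex_of_real (2 powr (- (- log 2 (B * dE)))) \<cdot>\<^sub>m \<sigma> - \<rho> x) v) \<ge> 0" for v
        unfolding q by simp
    qed (use rc[OF x] in \<open>simp add: minus_carrier_mat\<close>)
    ultimately show ?thesis unfolding L_def by blast
  qed
  \<comment> \<open>Taking traces in the domination and summing over \<open>x\<close> shows that 1
    is at most \<open>2 powr (n - lam)\<close>: the min-entropy of an \<open>n\<close>-bit source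
    never exceeds \<open>n\<close>.\<close>
  moreover have "bdd_above L"
  proof (rule bdd_aboveI[of _ "real n"])
    fix lam assume "lam \<in> L"
    then obtain \<sigma> where \<sigma>: "density dE \<sigma>" and p: "\<And>x. x < 2 ^ n \<Longrightarrow> psd (complex_of_real (2 powr (- lam)) \<cdot>\<^sub>m \<sigma> - \<rho> x)"
      unfolding L_def by blast
    have sc: "\<sigma> \<in> carrier_mat dE dE" and st: "mtrace \<sigma> = 1" using \<sigma> by (auto simp: density_def)
    have "0 \<le> 2 powr (- lam) - Re (mtrace (\<rho> x))" if x: "x < 2 ^ n" for x
    proof -
      let ?M = "complex_of_real (2 powr (- lam)) \<cdot>\<^sub>m \<sigma> - \<rho> x"
      have Mc: "?M \<in> carrier_mat dE dE" using rc[OF x] by (simp add: minus_carrier_mat)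
      have "0 \<le> (\<Sum>i<dE. Re (?M $$ (i,i)))" using psd_diag[OF p[OF x] Mc] by (intro sum_nonneg) auto
      also have "\<dots> = 2 powr (- lam) * Re (mtrace \<sigma>) - Re (mtrace (\<rho> x))"
        unfolding mtrace_carrier[OF sc] mtrace_carrier[OF rc[OF x]] Re_sum sum_distrib_left sum_subtractf[symmetric]
        using sc rc[OF x] by (intro sum.cong refl) auto
      finally show ?thesis by (simp add: st)
    qed
    hence "0 \<le> (\<Sum>x<2 ^ n. 2 powr (- lam) - Re (mtrace (\<rho> x)))" by (intro sum_nonneg) auto
    also have "\<dots> = 2 ^ n * 2 powr (- lam) - 1"
      using arg_cong[OF tr, of Re] by (simp add: sum_subtractf)
    also have "(2::real) ^ n * 2 powr (- lam) = 2 powr (real n - lam)"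
      by (simp add: powr_diff powr_minus powr_realpow field_simps)
    finally have "2 powr (real n - lam) \<ge> 2 powr 0" by simp
    thus "lam \<le> real n" by (subst (asm) powr_le_cancel_iff) auto
  qed
  ultimately obtain lam where "lam \<in> L" "h < lam" using H less_cSup_iff[of L h] by auto
  thus ?thesis unfolding L_def by blast
qed

section \<open>Extractor errors\<close>

lemma index_smult_carrier:
  "A \<in> carrier_mat n n \<Longrightarrow> i < n \<Longrightarrow> j < n \<Longrightarrow> (c \<cdot>\<^sub>m A) $$ (i,j) = c * A $$ (i,j)"
  by auto

lemma eq_block_index_iff:
  fixes y D :: nat
  assumes "y < D"
  shows "w = z * D + y \<longleftrightarrow> w div D = z \<and> w mod D = y"
proof
  assume "w = z * D + y"
  thus "w div D = z \<and> w mod D = y" using assms by simp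
next
  assume "w div D = z \<and> w mod D = y"
  thus "w = z * D + y" using div_mult_mod_eq[of w D] by simp
qed

lemma kron_carrier:
  "A \<in> carrier_mat a b \<Longrightarrow> B \<in> carrier_mat c d \<Longrightarrow> kron A B \<in> carrier_mat (a * c) (b * d)"
  by (auto simp: kron_def)

lemma proj_carrier: "proj N i \<in> carrier_mat N N"
  by (simp add: proj_def)

lemma kron_proj_proj:
  assumes "z < M" "y < D"
  shows "kron (proj M z) (proj D y) = proj (M * D) (z * D + y)"
proof (rule eq_matI)
  fix i j assume "i < dim_row (proj (M * D) (z * D + y))" "j < dim_col (proj (M * D) (z * D + y))"
  hence ij: "i < M * D" "j < M * D" by (auto simp: proj_def)
  have "D > 0" using assms by simp
  thus "kron (proj M z) (proj D y) $$ (i,j) = proj (M * D) (z * D + y) $$ (i,j)"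
    using ij assms kron_proj[OF ij, of "proj D y" z]
      eq_block_index_iff[OF assms(2), of i z] eq_block_index_iff[OF assms(2), of j z]
    by (simp add: proj_def)
qed (auto simp: kron_def proj_def)

lemma kron_uniform_diag_state:
  "kron (complex_of_real u \<cdot>\<^sub>m 1\<^sub>m M) (diag_state D q) = diag_state (M * D) (\<lambda>w. u * q (w mod D))"
proof (rule eq_matI)
  fix i j assume "i < dim_row (diag_state (M * D) (\<lambda>w. u * q (w mod D)))"
    "j < dim_col (diag_state (M * D) (\<lambda>w. u * q (w mod D)))"
  hence ij: "i < M * D" "j < M * D" by (auto simp: diag_state_def)
  have D: "D > 0" using ij by (cases D) auto
  hence "i div D < M" "j div D < M" "i mod D < D" "j mod D < D" using ij by (auto simp: div_less_iff_less_mult mult.commute)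
  moreover have "i = j \<longleftrightarrow> i div D = j div D \<and> i mod D = j mod D" by (metis div_mult_mod_eq)
  ultimately show "kron (complex_of_real u \<cdot>\<^sub>m 1\<^sub>m M) (diag_state D q) $$ (i,j) =
      diag_state (M * D) (\<lambda>w. u * q (w mod D)) $$ (i,j)"
    using ij by (auto simp: kron_def diag_state_def)
qed (auto simp: kron_def diag_state_def)

lemma Hmin_cl_ge_iff:
  assumes "is_dist N p"
  shows "Hmin_cl N p \<ge> h \<longleftrightarrow> (\<forall>i<N. p i \<le> 2 powr (- h))"
proof -
  have "\<exists>i<N. p i > 0"
  proof (rule ccontr)
    assume "\<not> (\<exists>i<N. p i > 0)"
    hence "sum p {..<N} \<le> 0" by (intro sum_nonpos) auto
    thus False using assms by (simp add: is_dist_def)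
  qed
  then obtain i where i: "i < N" "p i > 0" by blast
  hence "p i \<le> Max (p ` {..<N})" by (intro Max_ge) auto
  hence "Max (p ` {..<N}) > 0" using i by linarith
  hence "Hmin_cl N p \<ge> h \<longleftrightarrow> Max (p ` {..<N}) \<le> 2 powr (- h)"
    unfolding Hmin_cl_def by (subst log_le_iff[symmetric]) auto
  also have "\<dots> \<longleftrightarrow> (\<forall>i<N. p i \<le> 2 powr (- h))" using i by (subst Max_le_iff) auto
  finally show ?thesis .
qed

text \<open>All registers are classical, so the error matrix is diagonal and its trace norm is an l1
  norm. For each seed the two output values deviate from 1/2 by opposite amounts of half the bias;
  together they give the full bias, and the 2 undoes the factor 1/2 in the extractor error.\<close>

lemma bit_extractor_bias:
  assumes C_bit: "\<forall>x<2^n. \<forall>y<2^t. C x y \<in> {0, 1}"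
    and ext: "strong_extractor n t 1 C k \<epsilon> s"
    and p: "is_dist (2^n) p" "\<And>x. x < 2^n \<Longrightarrow> p x \<le> 2 powr (- k)"
    and q: "is_dist (2^t) q" "\<And>y. y < 2^t \<Longrightarrow> q y \<le> 2 powr (- s)"
  shows "(\<Sum>y<2^t. q y * \<bar>\<Sum>x<2^n. (- 1) ^ C x y * p x\<bar>) \<le> 2 * \<epsilon>"
proof -
  define N where "N = 2 ^ 1 * (2::nat) ^ t"
  define \<rho>out where "\<rho>out = mat_sum N N
     (\<lambda>(x,y). complex_of_real (p x * q y) \<cdot>\<^sub>m kron (proj (2^1) (C x y)) (proj (2^t) y)) ({..<2^n} \<times> {..<2^t})"
  define \<rho>ideal where "\<rho>ideal = kron (complex_of_real (1 / 2^1) \<cdot>\<^sub>m 1\<^sub>m (2^1)) (diag_state (2^t) q)"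
  have bound: "1/2 * trace_norm (\<rho>out - \<rho>ideal) \<le> \<epsilon>"
    using ext p q unfolding strong_extractor_def \<rho>out_def \<rho>ideal_def N_def Let_def
    by (simp add: Hmin_cl_ge_iff)
  \<comment> \<open>The index \<open>w\<close> stands for the output bit \<open>w div 2^t\<close>
    with seed \<open>w mod 2^t\<close>; \<open>a w\<close> is the deviation of that pair from its
    ideal probability.\<close>
  define a where "a w = q (w mod 2^t) * ((\<Sum>x<2^n. if C x (w mod 2^t) = w div 2^t then p x else 0) - 1/2)" for w
  have "\<rho>out - \<rho>ideal = diag_state N a"
  proof (rule eq_matI)
    fix i j assume "i < dim_row (diag_state N a)" "j < dim_col (diag_state N a)"
    hence ij: "i < N" "j < N" by (auto simp: diag_state_def)
    have im: "i mod 2^t < 2^t" by simp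
    have "\<rho>out $$ (i,j) = (\<Sum>x<2^n. \<Sum>y<2^t. complex_of_real (p x * q y) * kron (proj (2^1) (C x y)) (proj (2^t) y) $$ (i,j))"
    proof -
      have "\<rho>out $$ (i,j) = (\<Sum>(x,y)\<in>{..<2^n} \<times> {..<2^t}. complex_of_real (p x * q y) * kron (proj (2^1) (C x y)) (proj (2^t) y) $$ (i,j))"
        using ij unfolding \<rho>out_def mat_sum_def
        by (auto intro!: sum.cong simp: N_def kron_def proj_def)
      thus ?thesis by (simp only: sum.cartesian_product)
    qed
    also have "\<dots> = (\<Sum>x<2^n. \<Sum>y<2^t. if y = i mod 2^t then (if i = j \<and> C x (i mod 2^t) = i div 2^t then of_real (p x * q (i mod 2^t)) else 0) else 0)"
    proof (intro sum.cong refl)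
      fix x y assume "x \<in> {..<(2::nat)^n}" "y \<in> {..<(2::nat)^t}"
      hence xy: "x < 2^n" "y < 2^t" by auto
      hence "C x y < 2^1" using C_bit by fastforce
      hence "kron (proj (2^1) (C x y)) (proj (2^t) y) = proj N (C x y * 2^t + y)"
        unfolding N_def using xy by (intro kron_proj_proj)
      moreover have "proj N (C x y * 2^t + y) $$ (i,j) = (if i = j \<and> i div 2^t = C x y \<and> i mod 2^t = y then 1 else 0)"
        unfolding eq_block_index_iff[OF xy(2), symmetric] using ij by (auto simp: proj_def)
      ultimately show "complex_of_real (p x * q y) * kron (proj (2^1) (C x y)) (proj (2^t) y) $$ (i,j) =
         (if y = i mod 2^t then (if i = j \<and> C x (i mod 2^t) = i div 2^t then of_real (p x * q (i mod 2^t)) else 0) else 0)"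
        by auto
    qed
    also have "\<dots> = (\<Sum>x<2^n. if i = j \<and> C x (i mod 2^t) = i div 2^t then of_real (p x * q (i mod 2^t)) else 0)"
      using im by (subst sum.delta) auto
    also have "\<dots> = (if i = j then of_real (q (i mod 2^t) * (\<Sum>x<2^n. if C x (i mod 2^t) = i div 2^t then p x else 0)) else 0)"
      by (auto simp: sum_distrib_left of_real_sum intro!: sum.cong)
    finally have "\<rho>out $$ (i,j) = (if i = j then of_real (q (i mod 2^t) * (\<Sum>x<2^n. if C x (i mod 2^t) = i div 2^t then p x else 0)) else 0)" .
    moreover have "\<rho>ideal $$ (i,j) = (if i = j then of_real (1/2 * q (i mod 2^t)) else 0)"
      using ij unfolding \<rho>ideal_def kron_uniform_diag_state by (simp add: diag_state_def N_def)
    moreover have "i < dim_row \<rho>ideal" "j < dim_col \<rho>ideal"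
      using ij by (auto simp: \<rho>ideal_def kron_def diag_state_def N_def)
    ultimately show "(\<rho>out - \<rho>ideal) $$ (i,j) = diag_state N a $$ (i,j)"
      using ij by (simp add: diag_state_def a_def algebra_simps)
  qed (auto simp: \<rho>ideal_def kron_def diag_state_def N_def)
  hence "trace_norm (\<rho>out - \<rho>ideal) = (\<Sum>w<2 * 2^t. \<bar>a w\<bar>)" by (simp add: trace_norm_diag_state N_def)
  also have "\<dots> = (\<Sum>z<2. \<Sum>y<2^t. \<bar>a (z * 2^t + y)\<bar>)" by (rule sum_blocks)
  also have "\<dots> = (\<Sum>z<2::nat. \<Sum>y<2^t. q y * \<bar>\<Sum>x<2^n. (- 1) ^ C x y * p x\<bar> / 2)"
  proof (intro sum.cong refl)
    fix z y :: nat assume "z \<in> {..<2}" "y \<in> {..<2^t}"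
    hence z: "z = 0 \<or> z = 1" and y: "y < 2^t" by auto
    define b where "b = (\<Sum>x<2^n. (- 1) ^ C x y * p x)"
    have "(\<Sum>x<2^n. if C x y = z then p x else 0) - 1/2 = (\<Sum>x<2^n. (if C x y = z then p x else 0) - p x / 2)"
      using p by (simp add: is_dist_def sum_subtractf flip: sum_divide_distrib)
    also have "\<dots> = (\<Sum>x<2^n. (- 1) ^ z * ((- 1) ^ C x y * p x) / 2)"
    proof (intro sum.cong refl)
      fix x assume "x \<in> {..<(2::nat)^n}"
      hence "C x y \<in> {0,1}" using C_bit y by auto
      thus "(if C x y = z then p x else 0) - p x / 2 = (- 1) ^ z * ((- 1) ^ C x y * p x) / 2" using z by auto
    qed
    also have "\<dots> = (- 1) ^ z * b / 2" by (simp only: b_def sum_distrib_left sum_divide_distrib)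
    finally have e: "(\<Sum>x<2^n. if C x y = z then p x else 0) - 1/2 = (- 1) ^ z * b / 2" .
    have "\<bar>(\<Sum>x<2^n. if C x y = z then p x else 0) - 1/2\<bar> = \<bar>b\<bar> / 2" unfolding e by (simp add: abs_mult)
    moreover have "(z * 2^t + y) mod 2^t = y" "(z * 2^t + y) div 2^t = z" using y by auto
    moreover have "q y \<ge> 0" using q y by (auto simp: is_dist_def)
    ultimately show "\<bar>a (z * 2^t + y)\<bar> = q y * \<bar>b\<bar> / 2" unfolding a_def by (simp add: abs_mult)
  qed
  also have "\<dots> = (\<Sum>y<2^t. q y * \<bar>\<Sum>x<2^n. (- 1) ^ C x y * p x\<bar>)"
    by (simp add: numeral_2_eq_2 flip: sum_divide_distrib)
  finally show ?thesis using bound by simp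
qed

text \<open>By homogeneity: after division by the total mass, the flatness condition on
  \<open>P\<close> is exactly the min-entropy bound \<open>k\<close>. Mass 0 admits no
  normalisation, but there every term vanishes.\<close>

lemma bit_extractor_fools:
  assumes C_bit: "\<forall>x<2^n. \<forall>y<2^t. C x y \<in> {0, 1}"
    and ext: "strong_extractor n t 1 C k \<epsilon> s"
    and q: "is_dist (2^t) q" "\<And>y. y < 2^t \<Longrightarrow> q y \<le> 2 powr (- s)"
  shows "fools_seed {..<2^n} {..<2^t} q (\<lambda>x y. (- 1) ^ C x y) (2 powr k) (2 * \<epsilon>)"
  unfolding fools_seed_def
proof (intro allI impI)
  fix P :: "nat \<Rightarrow> real" assume P: "\<forall>x\<in>{..<2^n}. 0 \<le> P x" "\<forall>x\<in>{..<2^n}. 2 powr k * P x \<le> sum P {..<2^n}"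
  define S where "S = sum P {..<2^n}"
  have "S \<ge> 0" unfolding S_def using P by (intro sum_nonneg) auto
  show "(\<Sum>y<2^t. q y * \<bar>\<Sum>x<2^n. (- 1) ^ C x y * P x\<bar>) \<le> 2 * \<epsilon> * sum P {..<2^n}"
  proof (cases "S = 0")
    case True
    hence "\<forall>x\<in>{..<2^n}. P x = 0" unfolding S_def using P by (subst (asm) sum_nonneg_eq_0_iff) auto
    thus ?thesis by simp
  next
    case False
    hence S: "S > 0" using \<open>S \<ge> 0\<close> by simp
    define p where "p x = P x / S" for x
    have "is_dist (2^n) p" using P S by (auto simp: is_dist_def p_def S_def simp flip: sum_divide_distrib)
    moreover have "p x \<le> 2 powr (- k)" if "x < 2^n" for x
    proof -
      have "2 powr k * P x \<le> S" using P that by (auto simp: S_def)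
      thus ?thesis using S by (simp add: p_def powr_minus field_simps)
    qed
    ultimately have "(\<Sum>y<2^t. q y * \<bar>\<Sum>x<2^n. (- 1) ^ C x y * p x\<bar>) \<le> 2 * \<epsilon>"
      using bit_extractor_bias[OF C_bit ext _ _ q] by blast
    hence "S * (\<Sum>y<2^t. q y * \<bar>\<Sum>x<2^n. (- 1) ^ C x y * p x\<bar>) \<le> S * (2 * \<epsilon>)"
      using S by (intro mult_left_mono) auto
    also have "S * (\<Sum>y<2^t. q y * \<bar>\<Sum>x<2^n. (- 1) ^ C x y * p x\<bar>) = (\<Sum>y<2^t. q y * \<bar>\<Sum>x<2^n. (- 1) ^ C x y * P x\<bar>)"
      unfolding sum_distrib_left
    proof (intro sum.cong refl)
      fix y
      have "(\<Sum>x<2^n. (- 1) ^ C x y * P x) = S * (\<Sum>x<2^n. (- 1) ^ C x y * p x)"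
        unfolding sum_distrib_left using S by (intro sum.cong refl) (simp add: p_def)
      thus "S * (q y * \<bar>\<Sum>x<2^n. (- 1) ^ C x y * p x\<bar>) = q y * \<bar>\<Sum>x<2^n. (- 1) ^ C x y * P x\<bar>"
        using S by (simp add: abs_mult)
    qed
    finally show ?thesis by (simp add: S_def mult_ac)
  qed
qed

section \<open>The quantum error as a sum of tests on the side information\<close>

lemma trace_ip_mat_sum_left:
  assumes "\<And>x. x \<in> X \<Longrightarrow> A x \<in> carrier_mat n n" "K \<in> carrier_mat n n"
  shows "trace_ip (mat_sum n n (\<lambda>x. complex_of_real (u x) \<cdot>\<^sub>m A x) X) K = (\<Sum>x\<in>X. u x * trace_ip (A x) K)"
proof -
  have M: "mat_sum n n (\<lambda>x. complex_of_real (u x) \<cdot>\<^sub>m A x) X \<in> carrier_mat n n" by (simp add: mat_sum_def)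
  have "trace_ip (mat_sum n n (\<lambda>x. complex_of_real (u x) \<cdot>\<^sub>m A x) X) K =
      (\<Sum>i<n. \<Sum>j<n. \<Sum>x\<in>X. u x * Re (A x $$ (i,j) * K $$ (j,i)))"
    unfolding trace_ip_sum[OF M assms(2)]
  proof (intro sum.cong refl)
    fix i j assume ij: "i \<in> {..<n}" "j \<in> {..<n}"
    have "mat_sum n n (\<lambda>x. complex_of_real (u x) \<cdot>\<^sub>m A x) X $$ (i,j) = (\<Sum>x\<in>X. of_real (u x) * A x $$ (i,j))"
      using ij assms(1) by (auto simp: mat_sum_def index_smult_carrier[where n = n] intro!: sum.cong)
    hence "Re (mat_sum n n (\<lambda>x. complex_of_real (u x) \<cdot>\<^sub>m A x) X $$ (i,j) * K $$ (j,i)) =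
        (\<Sum>x\<in>X. Re (of_real (u x) * A x $$ (i,j) * K $$ (j,i)))"
      by (simp only: sum_distrib_right Re_sum)
    thus "Re (mat_sum n n (\<lambda>x. complex_of_real (u x) \<cdot>\<^sub>m A x) X $$ (i,j) * K $$ (j,i)) =
        (\<Sum>x\<in>X. u x * Re (A x $$ (i,j) * K $$ (j,i)))"
      by (simp add: algebra_simps)
  qed
  also have "\<dots> = (\<Sum>x\<in>X. \<Sum>i<n. \<Sum>j<n. u x * Re (A x $$ (i,j) * K $$ (j,i)))"
    by (subst (2) sum.swap, subst sum.swap) (rule refl)
  also have "\<dots> = (\<Sum>x\<in>X. u x * trace_ip (A x) K)"
    using assms by (intro sum.cong refl) (simp add: trace_ip_sum[where n = n] sum_distrib_left)
  finally show ?thesis .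
qed

lemma trace_ip_commute:
  assumes "A \<in> carrier_mat n n" "B \<in> carrier_mat n n"
  shows "trace_ip A B = trace_ip B A"
  unfolding trace_ip_def using mtrace_mult_commute[OF assms] by simp

text \<open>The unit ball is convex and symmetric. This merges the tests for all values of the
  output bits from position \<open>i\<close> on into a single test in the hybrid argument.\<close>

lemma contraction_combination:
  assumes K: "\<And>x. x \<in> X \<Longrightarrow> contraction n (K x)" and u: "(\<Sum>x\<in>X. \<bar>u x\<bar>) \<le> 1"
  shows "contraction n (mat_sum n n (\<lambda>x. complex_of_real (u x) \<cdot>\<^sub>m K x) X)"
  unfolding contraction_iff
proof (intro conjI allI)
  fix v
  let ?s = "\<Sum>i<n. (cmod (v i))\<^sup>2"
  have Kc: "\<And>x. x \<in> X \<Longrightarrow> K x \<in> carrier_mat n n" using K by (simp add: contraction_def)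
  have q: "qform (mat_sum n n (\<lambda>x. complex_of_real (u x) \<cdot>\<^sub>m K x) X) v = (\<Sum>x\<in>X. complex_of_real (u x) * qform (K x) v)"
    using Kc by (subst qform_sum) (auto simp: qform_smult[where n = n] intro!: sum.cong)
  have K': "Im (qform (K x) v) = 0" "\<bar>Re (qform (K x) v)\<bar> \<le> ?s" if "x \<in> X" for x
    using K[OF that] unfolding contraction_iff by auto
  show "Im (qform (mat_sum n n (\<lambda>x. complex_of_real (u x) \<cdot>\<^sub>m K x) X) v) = 0"
    unfolding q using K' by simp
  have "\<bar>Re (qform (mat_sum n n (\<lambda>x. complex_of_real (u x) \<cdot>\<^sub>m K x) X) v)\<bar> \<le> (\<Sum>x\<in>X. \<bar>u x * Re (qform (K x) v)\<bar>)"
    unfolding q by (simp add: sum_abs)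
  also have "\<dots> \<le> (\<Sum>x\<in>X. \<bar>u x\<bar> * ?s)"
    using K' by (intro sum_mono) (auto simp: abs_mult intro!: mult_left_mono)
  also have "\<dots> = (\<Sum>x\<in>X. \<bar>u x\<bar>) * ?s" by (simp only: sum_distrib_right)
  also have "\<dots> \<le> ?s" using u by (intro mult_left_le_one_le) (auto intro!: sum_nonneg)
  finally show "\<bar>Re (qform (mat_sum n n (\<lambda>x. complex_of_real (u x) \<cdot>\<^sub>m K x) X) v)\<bar> \<le> ?s" .
qed (simp add: mat_sum_def)

text \<open>The error matrix is block diagonal in output and seed, so the adversary holds a separate
  test \<open>K z y\<close> for each pair. The trace norm then compares the test at the actual
  output with its average over a uniformly random output.\<close>

lemma extractor_error_attained:
  fixes \<rho> :: "nat \<Rightarrow> complex mat" and q :: "nat \<Rightarrow> real"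
  assumes rho: "\<And>x. x < 2^n \<Longrightarrow> \<rho> x \<in> carrier_mat dE dE" "\<And>x. x < 2^n \<Longrightarrow> psd (\<rho> x)"
    and Ext: "\<And>x y. x < 2^n \<Longrightarrow> y < 2^d \<Longrightarrow> Ext x y < 2^m"
  defines "N \<equiv> 2^m * 2^d * dE"
  defines "\<rho>out \<equiv> mat_sum N N (\<lambda>(x,y). complex_of_real (q y) \<cdot>\<^sub>m
                   kron (kron (proj (2^m) (Ext x y)) (proj (2^d) y)) (\<rho> x)) ({..<2^n} \<times> {..<2^d})"
  defines "\<rho>ideal \<equiv> kron (kron (complex_of_real (1 / 2^m) \<cdot>\<^sub>m 1\<^sub>m (2^m)) (diag_state (2^d) q)) (cq_marginal n dE \<rho>)"
  shows "\<exists>K. (\<forall>z<2^m. \<forall>y<2^d. contraction dE (K z y)) \<and>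
     trace_norm (\<rho>out - \<rho>ideal) = (\<Sum>y<2^d. q y * (\<Sum>x<2^n.
        trace_ip (\<rho> x) (K (Ext x y) y) - (\<Sum>z<2^m. trace_ip (\<rho> x) (K z y)) / 2^m))"
proof -
  let ?D = "(2::nat)^d" and ?M = "(2::nat)^m"
  \<comment> \<open>The coefficient of \<open>\<rho> x\<close> in the block of output
    \<open>w div 2^d\<close> and seed \<open>w mod 2^d\<close>: real minus ideal.\<close>
  define u where "u w x = q (w mod ?D) * ((if Ext x (w mod ?D) = w div ?D then 1 else 0) - 1 / 2^m)" for w x
  define f where "f w = mat_sum dE dE (\<lambda>x. complex_of_real (u w x) \<cdot>\<^sub>m \<rho> x) {..<2^n}" for w
  have fc: "f w \<in> carrier_mat dE dE" for w by (simp add: f_def mat_sum_def)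
  have fe: "f w $$ (a,b) = (\<Sum>x<2^n. complex_of_real (u w x) * \<rho> x $$ (a,b))" if "a < dE" "b < dE" for w a b
    using that rho(1) by (auto simp: f_def mat_sum_def index_smult_carrier[where n = dE] intro!: sum.cong)
  have eq: "\<rho>out - \<rho>ideal = block_diag (?M * ?D) dE f"
  proof (rule eq_matI)
    fix i j assume "i < dim_row (block_diag (?M * ?D) dE f)" "j < dim_col (block_diag (?M * ?D) dE f)"
    hence ij: "i < ?M * ?D * dE" "j < ?M * ?D * dE" by (auto simp: block_diag_def)
    have dE: "dE > 0" using ij by (cases dE) auto
    define w where "w = i div dE"
    have w: "w < ?M * ?D" "j div dE < ?M * ?D" using ij dE by (auto simp: w_def div_less_iff_less_mult mult.commute)
    define a b where "a = i mod dE" and "b = j mod dE"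
    have ab: "a < dE" "b < dE" using dE by (auto simp: a_def b_def)
    have "\<rho>out $$ (i,j) = (\<Sum>x<2^n. \<Sum>y<?D. of_real (q y) * kron (kron (proj ?M (Ext x y)) (proj ?D y)) (\<rho> x) $$ (i,j))"
    proof -
      have "\<rho>out $$ (i,j) = (\<Sum>(x,y)\<in>{..<2^n} \<times> {..<?D}. of_real (q y) * kron (kron (proj ?M (Ext x y)) (proj ?D y)) (\<rho> x) $$ (i,j))"
        unfolding \<rho>out_def mat_sum_def N_def using ij
        by (auto intro!: sum.cong index_smult_carrier[OF kron_carrier] kron_carrier proj_carrier rho(1))
      thus ?thesis by (simp only: sum.cartesian_product)
    qed
    also have "\<dots> = (\<Sum>x<2^n. \<Sum>y<?D. if y = w mod ?D then (if w = j div dE \<and> Ext x (w mod ?D) = w div ?D then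
        of_real (q (w mod ?D)) * \<rho> x $$ (a,b) else 0) else 0)"
    proof (intro sum.cong refl)
      fix x y assume "x \<in> {..<(2::nat)^n}" "y \<in> {..<?D}"
      hence xy: "x < 2^n" "y < ?D" by auto
      hence E: "Ext x y < ?M" using Ext by blast
      have k: "kron (kron (proj ?M (Ext x y)) (proj ?D y)) (\<rho> x) $$ (i,j) =
         (if i div dE = Ext x y * ?D + y \<and> j div dE = Ext x y * ?D + y then \<rho> x $$ (a,b) else 0)"
        unfolding kron_proj_proj[OF E xy(2)] a_def b_def
        using ij rho(1)[OF xy(1)] block_index_less[OF E xy(2)] by (intro kron_proj)
      have "w = Ext x y * ?D + y \<and> j div dE = Ext x y * ?D + y \<longleftrightarrow> w = j div dE \<and> Ext x y = w div ?D \<and> y = w mod ?D"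
        using eq_block_index_iff[OF xy(2), of w "Ext x y"] by metis
      thus "of_real (q y) * kron (kron (proj ?M (Ext x y)) (proj ?D y)) (\<rho> x) $$ (i,j) =
         (if y = w mod ?D then (if w = j div dE \<and> Ext x (w mod ?D) = w div ?D then
            of_real (q (w mod ?D)) * \<rho> x $$ (a,b) else 0) else 0)"
        unfolding k w_def[symmetric] by auto
    qed
    also have "\<dots> = (\<Sum>x<2^n. if w = j div dE \<and> Ext x (w mod ?D) = w div ?D then of_real (q (w mod ?D)) * \<rho> x $$ (a,b) else 0)"
      by (subst sum.delta) auto
    finally have out: "\<rho>out $$ (i,j) = \<dots>" .
    have "\<rho>ideal $$ (i,j) = diag_state (?M * ?D) (\<lambda>w. 1 / 2^m * q (w mod ?D)) $$ (w, j div dE) * cq_marginal n dE \<rho> $$ (a,b)"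
      unfolding \<rho>ideal_def kron_uniform_diag_state using ij
      by (simp add: kron_def cq_marginal_def mat_sum_def diag_state_def w_def a_def b_def)
    also have "\<dots> = (\<Sum>x<2^n. if w = j div dE then of_real (1 / 2^m * q (w mod ?D)) * \<rho> x $$ (a,b) else 0)"
      using w ab by (simp add: diag_state_def cq_marginal_def mat_sum_def sum_distrib_left)
    finally have ideal: "\<rho>ideal $$ (i,j) = \<dots>" .
    have d: "i < dim_row \<rho>ideal" "j < dim_col \<rho>ideal"
      using ij by (auto simp: \<rho>ideal_def kron_def cq_marginal_def mat_sum_def diag_state_def)
    show "(\<rho>out - \<rho>ideal) $$ (i,j) = block_diag (?M * ?D) dE f $$ (i,j)"
    proof (cases "w = j div dE")
      case False
      thus ?thesis using ij d out ideal by (simp add: block_diag_def w_def)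
    next
      case True
      have "(\<rho>out - \<rho>ideal) $$ (i,j) = (\<Sum>x<2^n. of_real (u w x) * \<rho> x $$ (a,b))"
        using d True by (simp add: out ideal sum_subtractf[symmetric], intro sum.cong refl) (auto simp: u_def algebra_simps)
      also have "\<dots> = f w $$ (a,b)" by (rule fe[OF ab, symmetric])
      finally show ?thesis using True ij by (simp add: block_diag_def w_def a_def b_def)
    qed
  qed (auto simp: \<rho>ideal_def kron_def cq_marginal_def mat_sum_def diag_state_def block_diag_def)
  have fa: "adj (f w) = f w" for w
  proof (rule eq_matI)
    fix i j assume "i < dim_row (f w)" "j < dim_col (f w)"
    hence ij: "i < dE" "j < dE" using fc[of w] by auto
    have "cnj (\<rho> x $$ (j,i)) = \<rho> x $$ (i,j)" if "x < 2^n" for x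
      using hermitian_index[OF psd_adj[OF rho(2)[OF that] rho(1)[OF that]] rho(1)[OF that] ij(2,1)] .
    thus "adj (f w) $$ (i,j) = f w $$ (i,j)" using ij fc[of w] by (simp add: fe)
  qed (use fc[of w] in auto)
  obtain K where K: "\<And>w. w < ?M * ?D \<Longrightarrow> contraction dE (K w)"
    and tn: "trace_norm (block_diag (?M * ?D) dE f) = (\<Sum>w<?M * ?D. trace_ip (f w) (K w))"
    using trace_norm_block_diag_attained[of "?M * ?D" f dE] fc fa by blast
  define K' where "K' z y = K (z * ?D + y)" for z y
  have K'c: "contraction dE (K' z y)" if "z < ?M" "y < ?D" for z y
    unfolding K'_def using K block_index_less[OF that] .
  have "(\<Sum>w<?M * ?D. trace_ip (f w) (K w)) = (\<Sum>z<?M. \<Sum>y<?D. trace_ip (f (z * ?D + y)) (K' z y))"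
    unfolding sum_blocks K'_def ..
  also have "\<dots> = (\<Sum>z<?M. \<Sum>y<?D. \<Sum>x<2^n. q y * ((if z = Ext x y then trace_ip (\<rho> x) (K' z y) else 0) - trace_ip (\<rho> x) (K' z y) / 2^m))"
  proof (intro sum.cong refl)
    fix z y assume zy: "z \<in> {..<?M}" "y \<in> {..<?D}"
    have "trace_ip (f (z * ?D + y)) (K' z y) = (\<Sum>x<2^n. u (z * ?D + y) x * trace_ip (\<rho> x) (K' z y))"
      unfolding f_def using zy rho(1) K'c by (intro trace_ip_mat_sum_left) (auto simp: contraction_def)
    also have "\<dots> = (\<Sum>x<2^n. q y * ((if z = Ext x y then trace_ip (\<rho> x) (K' z y) else 0) - trace_ip (\<rho> x) (K' z y) / 2^m))"
      using zy by (intro sum.cong refl) (auto simp: u_def algebra_simps)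
    finally show "trace_ip (f (z * ?D + y)) (K' z y) = \<dots>" .
  qed
  also have "\<dots> = (\<Sum>y<?D. \<Sum>x<2^n. \<Sum>z<?M. q y * ((if z = Ext x y then trace_ip (\<rho> x) (K' z y) else 0) - trace_ip (\<rho> x) (K' z y) / 2^m))"
    by (subst sum.swap, intro sum.cong refl sum.swap)
  also have "\<dots> = (\<Sum>y<?D. q y * (\<Sum>x<2^n.
        trace_ip (\<rho> x) (K' (Ext x y) y) - (\<Sum>z<?M. trace_ip (\<rho> x) (K' z y)) / 2^m))"
    unfolding sum_distrib_left[symmetric]
  proof (rule sum.cong[OF refl], rule arg_cong2[where f = "(*)", OF refl], rule sum.cong[OF refl])
    fix y x assume "y \<in> {..<?D}" "x \<in> {..<(2::nat)^n}"
    hence "Ext x y < ?M" using Ext by auto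
    thus "(\<Sum>z<?M. (if z = Ext x y then trace_ip (\<rho> x) (K' z y) else 0) - trace_ip (\<rho> x) (K' z y) / 2^m) =
      trace_ip (\<rho> x) (K' (Ext x y) y) - (\<Sum>z<?M. trace_ip (\<rho> x) (K' z y)) / 2^m"
      by (simp add: sum_subtractf sum_divide_distrib)
  qed
  finally have "trace_norm (\<rho>out - \<rho>ideal) = (\<Sum>y<?D. q y * (\<Sum>x<2^n.
        trace_ip (\<rho> x) (K' (Ext x y) y) - (\<Sum>z<?M. trace_ip (\<rho> x) (K' z y)) / 2^m))"
    by (simp only: eq tn)
  thus ?thesis using K'c by blast
qed

section \<open>Seeds as sets of positions and the hybrid identity\<close>

lemma bit_set_encode: "finite Y \<Longrightarrow> bit (set_encode Y) b \<longleftrightarrow> b \<in> Y"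
proof -
  assume "finite Y"
  hence "b \<in> Y \<longleftrightarrow> b \<in> set_decode (set_encode Y)" by simp
  thus ?thesis by (simp add: set_decode_def bit_iff_odd)
qed

text \<open>With seeds as subsets of \<open>{..<d}\<close>, splitting a seed into its bits inside
  and outside a design set is a disjoint union instead of bit arithmetic.\<close>

lemma bij_set_encode: "bij_betw set_encode (Pow {..<d}) {..<2^d}"
proof -
  have inj: "inj_on set_encode (Pow {..<d})"
    by (rule inj_on_subset[OF inj_on_set_encode]) (auto intro: finite_subset)
  have "set_encode ` Pow {..<d} \<subseteq> {..<2^d}"
  proof
    fix y assume "y \<in> set_encode ` Pow {..<d}"
    then obtain Y where Y: "Y \<subseteq> {..<d}" "y = set_encode Y" by auto
    have "y \<le> (\<Sum>i<d. 2^i)" unfolding Y(2) set_encode_def using Y(1) by (intro sum_mono2) auto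
    also have "\<dots> = 2^d - 1" using sum_power2[of d] by (simp add: lessThan_atLeast0)
    also have "\<dots> < 2^d" by simp
    finally show "y \<in> {..<2^d}" by simp
  qed
  moreover have "card (set_encode ` Pow {..<d}) = card {..<(2::nat)^d}"
    using card_image[OF inj] by (simp add: card_Pow)
  ultimately have "set_encode ` Pow {..<d} = {..<2^d}" by (intro card_subset_eq) auto
  thus ?thesis using inj by (simp add: bij_betw_def)
qed

text \<open>The counterpart of \<open>restrict_bits\<close> for seeds given as sets; its value
  depends on \<open>V\<close> only through \<open>V \<inter> S\<close>.\<close>

definition set_code :: "nat set \<Rightarrow> nat set \<Rightarrow> nat" where
  "set_code S V = (\<Sum>j<card S. if sorted_list_of_set S ! j \<in> V then 2^j else 0)"

lemma restrict_bits_set_encode: "finite Y \<Longrightarrow> restrict_bits (set_encode Y) S = set_code S Y"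
  by (simp add: restrict_bits_def set_code_def bit_set_encode)

lemma set_code_cong:
  assumes "finite S" "V \<inter> S = V' \<inter> S"
  shows "set_code S V = set_code S V'"
  unfolding set_code_def
proof (intro sum.cong refl)
  fix j assume "j \<in> {..<card S}"
  hence "sorted_list_of_set S ! j \<in> S" using assms(1) nth_mem[of j "sorted_list_of_set S"] by simp
  thus "(if sorted_list_of_set S ! j \<in> V then 2^j else 0) = (if sorted_list_of_set S ! j \<in> V' then 2^j else (0::nat))"
    using assms(2) by auto
qed

lemma bij_set_code:
  assumes S: "finite S"
  shows "bij_betw (set_code S) (Pow S) {..<2 ^ card S}"
proof -
  let ?l = "sorted_list_of_set S"
  define J where "J V = {j \<in> {..<card S}. ?l ! j \<in> V}" for V
  have code: "set_code S V = set_encode (J V)" for V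
    unfolding set_code_def set_encode_def J_def by (rule sum.inter_filter[symmetric]) simp
  have img: "(!) ?l ` J V = V" if "V \<subseteq> S" for V
  proof
    show "V \<subseteq> (!) ?l ` J V"
    proof
      fix b assume b: "b \<in> V"
      hence "b \<in> set ?l" using that S by auto
      then obtain j where "j < card S" "?l ! j = b" by (auto simp: in_set_conv_nth)
      thus "b \<in> (!) ?l ` J V" using b by (auto simp: J_def)
    qed
  qed (auto simp: J_def)
  have inj: "inj_on (set_code S) (Pow S)"
  proof (rule inj_onI)
    fix V V' assume V: "V \<in> Pow S" "V' \<in> Pow S" "set_code S V = set_code S V'"
    have "finite (J V)" "finite (J V')" by (auto simp: J_def)
    hence "J V = J V'" using V(3) unfolding code by (simp add: set_encode_eq)
    hence "(!) ?l ` J V = (!) ?l ` J V'" by (rule arg_cong)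
    moreover have "(!) ?l ` J V = V" using V(1) by (intro img) auto
    moreover have "(!) ?l ` J V' = V'" using V(2) by (intro img) auto
    ultimately show "V = V'" by (simp only:)
  qed
  have "set_code S ` Pow S \<subseteq> {..<2 ^ card S}"
    using bij_set_encode[of "card S"] unfolding code bij_betw_def J_def by blast
  moreover have "card (set_code S ` Pow S) = card {..<(2::nat) ^ card S}"
    using card_image[OF inj] S by (simp add: card_Pow)
  ultimately have "set_code S ` Pow S = {..<2 ^ card S}" by (intro card_subset_eq) auto
  thus ?thesis using inj by (simp add: bij_betw_def)
qed

lemma set_code_less: "finite S \<Longrightarrow> set_code S V < 2 ^ card S"
  using bij_set_code[of S] set_code_cong[of S V "V \<inter> S"] by (fastforce simp: bij_betw_def)

section \<open>Splitting seeds, and the hybrid chain over output strings\<close>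

lemma sum_Pow_disjoint_Un:
  fixes F :: "'a set \<Rightarrow> 'b::comm_monoid_add"
  assumes "A \<inter> B = {}"
  shows "(\<Sum>Y\<in>Pow (A \<union> B). F Y) = (\<Sum>w\<in>Pow A. \<Sum>V\<in>Pow B. F (w \<union> V))"
proof -
  have "(\<Sum>(w,V)\<in>Pow A \<times> Pow B. F (w \<union> V)) = (\<Sum>Y\<in>Pow (A \<union> B). F Y)"
    by (rule sum.reindex_bij_witness[where i = "\<lambda>Y. (Y \<inter> A, Y \<inter> B)" and j = "\<lambda>(w,V). w \<union> V"])
      (use assms in \<open>auto intro!: arg_cong[where f = F]\<close>)
  thus ?thesis by (simp only: sum.cartesian_product)
qed

lemma bits_sum_less: "(\<And>j. j < i \<Longrightarrow> b j \<le> 1) \<Longrightarrow> (\<Sum>j<i. b j * 2^j) < (2::nat)^i"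
proof (induction i)
  case (Suc i)
  have "(\<Sum>j<i. b j * 2^j) < 2^i" using Suc by auto
  moreover have "b i * 2^i \<le> 1 * 2^i" using Suc.prems[of i] by (intro mult_right_mono) auto
  ultimately have "(\<Sum>j<i. b j * 2^j) + b i * 2^i < 2 * 2^i" by linarith
  thus ?case by simp
qed simp

lemma sum_pairs: "(\<Sum>c<2 * M. g c) = (\<Sum>c<M. g (2 * c) + g (2 * c + 1 :: nat))"
  for g :: "nat \<Rightarrow> 'a::comm_monoid_add"
  by (induction M) (simp_all add: add.assoc)

text \<open>A chain of averages leads from the uniform mean of \<open>h\<close> to its value at the
  actual string. Fixing bit \<open>i\<close> compares its actual value with the mean over both
  values, which leaves half their difference; hence the denominator \<open>2^(m - i)\<close>
  although only \<open>m - Suc i\<close> bits are averaged.\<close>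

lemma hybrid_telescope:
  fixes h :: "nat \<Rightarrow> real" and b :: "nat \<Rightarrow> nat"
  assumes b: "\<And>i. i < m \<Longrightarrow> b i \<in> {0,1}"
  defines "e \<equiv> \<lambda>i. \<Sum>j<i. b j * 2^j"
  shows "h (e m) - (\<Sum>z<2^m. h z) / 2^m =
    (\<Sum>i<m. (- 1) ^ b i * ((\<Sum>c<2^(m - Suc i). h (e i + 2^Suc i * c) - h (e i + 2^i + 2^Suc i * c)) / 2^(m - i)))"
proof -
  \<comment> \<open>The mean of \<open>h\<close> over all strings that agree with \<open>b\<close>
    in the lowest \<open>i\<close> bits; \<open>c\<close> runs through the remaining upper
    bits.\<close>
  define H where "H i = (\<Sum>c<2^(m - i). h (e i + 2^i * c)) / 2^(m - i)" for i
  have step: "H (Suc i) - H i = (- 1) ^ b i * ((\<Sum>c<2^(m - Suc i). h (e i + 2^Suc i * c) - h (e i + 2^i + 2^Suc i * c)) / 2^(m - i))"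
    if i: "i < m" for i
  proof -
    let ?M = "(2::nat)^(m - Suc i)"
    have M: "(2::nat)^(m - i) = 2 * ?M" "(2::real)^(m - i) = 2 * 2^(m - Suc i)" using i by (simp_all add: Suc_diff_Suc flip: power_Suc)
    define X where "X = (\<Sum>c<?M. h (e i + 2^Suc i * c))"
    define Y where "Y = (\<Sum>c<?M. h (e i + 2^i + 2^Suc i * c))"
    have "H i = (X + Y) / (2 * 2^(m - Suc i))"
      unfolding H_def M sum_pairs X_def Y_def by (simp add: sum.distrib algebra_simps)
    moreover have "H (Suc i) = (if b i = 0 then X else Y) / 2^(m - Suc i)"
      using b[OF i] unfolding H_def X_def Y_def by (auto simp: e_def)
    moreover have "(\<Sum>c<?M. h (e i + 2^Suc i * c) - h (e i + 2^i + 2^Suc i * c)) = X - Y"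
      by (simp only: X_def Y_def sum_subtractf)
    ultimately show ?thesis using b[OF i] by (auto simp: M field_simps)
  qed
  have "h (e m) - (\<Sum>z<2^m. h z) / 2^m = H m - H 0" by (simp add: H_def e_def)
  also have "\<dots> = (\<Sum>i<m. H (Suc i) - H i)" by (rule sum_lessThan_telescope[symmetric])
  also have "\<dots> = (\<Sum>i<m. (- 1) ^ b i * ((\<Sum>c<2^(m - Suc i). h (e i + 2^Suc i * c) - h (e i + 2^i + 2^Suc i * c)) / 2^(m - i)))"
    by (intro sum.cong refl step) auto
  finally show ?thesis .
qed

lemma bit_extractor_fools_subset_seed:
  assumes C_bit: "\<forall>x<2^n. \<forall>y<2^t. C x y \<in> {0, 1}"
    and ext: "strong_extractor n t 1 C k \<epsilon> s"
    and S: "finite S" "card S = t"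
    and q: "\<And>V. V \<subseteq> S \<Longrightarrow> 0 \<le> q V" "\<And>V. V \<subseteq> S \<Longrightarrow> q V \<le> 2 powr (- s)" "sum q (Pow S) = 1"
  shows "fools_seed {..<2^n} (Pow S) q (\<lambda>x V. (- 1) ^ C x (set_code S V)) (2 powr k) (2 * \<epsilon>)"
proof -
  have bij: "bij_betw (set_code S) (Pow S) {..<2^t}" using bij_set_code[OF S(1)] S(2) by simp
  define q' where "q' v = q (the_inv_into (Pow S) (set_code S) v)" for v
  have q': "q' (set_code S V) = q V" if "V \<subseteq> S" for V
    using bij that by (simp add: q'_def the_inv_into_f_f bij_betw_def)
  have sum': "(\<Sum>v<2^t. f v) = (\<Sum>V\<in>Pow S. f (set_code S V))" for f :: "nat \<Rightarrow> real"
    using sum.reindex_bij_betw[OF bij, of f] by simp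
  have ex: "\<exists>V. V \<subseteq> S \<and> set_code S V = v" if "v < 2^t" for v
    using bij that unfolding bij_betw_def by (metis (no_types, lifting) Pow_iff imageE lessThan_iff)
  have v: "q' v \<ge> 0" "q' v \<le> 2 powr (- s)" if v: "v < 2^t" for v
  proof -
    obtain V where "V \<subseteq> S" "set_code S V = v" using ex[OF v] by blast
    thus "q' v \<ge> 0" "q' v \<le> 2 powr (- s)" using q' q by auto
  qed
  have "(\<Sum>v<2^t. q' v) = sum q (Pow S)" unfolding sum' by (intro sum.cong refl) (simp add: q')
  hence "is_dist (2^t) q'" using v(1) q(3) by (simp add: is_dist_def)
  with v(2) have "fools_seed {..<2^n} {..<2^t} q' (\<lambda>x y. (- 1) ^ C x y) (2 powr k) (2 * \<epsilon>)"
    by (intro bit_extractor_fools[OF C_bit ext])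
  thus ?thesis unfolding fools_seed_def by (simp add: sum' q')
qed

section \<open>Trevisan's extractor\<close>

text \<open>The trivial estimate, meant for those outer seed bits after which the inner seed has too
  little entropy.\<close>

lemma bias_le_one:
  fixes \<rho> :: "nat \<Rightarrow> complex mat" and c :: "nat \<Rightarrow> real"
  assumes rho: "\<And>x. x \<in> X \<Longrightarrow> \<rho> x \<in> carrier_mat n n" "\<And>x. x \<in> X \<Longrightarrow> psd (\<rho> x)"
    and tr: "(\<Sum>x\<in>X. Re (mtrace (\<rho> x))) = 1"
    and c: "\<And>x. x \<in> X \<Longrightarrow> \<bar>c x\<bar> \<le> 1" and K: "\<And>x. x \<in> X \<Longrightarrow> contraction n (K x)"
  shows "(\<Sum>x\<in>X. c x * trace_ip (\<rho> x) (K x)) \<le> 1"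
proof -
  have "(\<Sum>x\<in>X. c x * trace_ip (\<rho> x) (K x)) \<le> (\<Sum>x\<in>X. Re (mtrace (\<rho> x)))"
  proof (intro sum_mono)
    fix x assume x: "x \<in> X"
    have "c x * trace_ip (\<rho> x) (K x) \<le> \<bar>c x\<bar> * \<bar>trace_ip (\<rho> x) (K x)\<bar>" by (metis abs_ge_self abs_mult)
    also have "\<dots> \<le> \<bar>trace_ip (\<rho> x) (K x)\<bar>" using c[OF x] by (intro mult_left_le_one_le) auto
    also have "\<dots> \<le> Re (mtrace (\<rho> x))" by (rule trace_ip_contraction_le[OF K[OF x] rho(1)[OF x] rho(2)[OF x]])
    finally show "c x * trace_ip (\<rho> x) (K x) \<le> Re (mtrace (\<rho> x))" .
  qed
  thus ?thesis using tr by simp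
qed

text \<open>The origin of the seed entropy in the theorem: the bound on \<open>q\<close> is exactly
  \<open>2 powr (- s)\<close> times the threshold on \<open>Q\<close>, so conditioning on an event
  of at least that weight leaves \<open>s\<close> bits.\<close>

lemma conditional_weight_le:
  fixes \<epsilon> s :: real and t d :: nat
  assumes \<epsilon>: "\<epsilon> > 0" and t: "t \<le> d"
    and q: "q \<le> 2 powr (- (d - (t - s - log 2 (1 / (3 * sqrt \<epsilon>)))))"
    and Q: "Q \<ge> 3 * sqrt \<epsilon> / 2^(d - t)"
  shows "q / Q \<le> 2 powr (- s)"
proof -
  let ?e = "3 * sqrt \<epsilon>"
  have e: "?e > 0" using \<epsilon> by simp
  have "2 powr (- (real d - (t - s - log 2 (1 / ?e)))) = 2 powr (- s + (- real (d - t)) + log 2 ?e)"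
    using t e by (simp add: log_divide of_nat_diff algebra_simps)
  also have "\<dots> = 2 powr (- s) * (?e / 2^(d - t))"
    unfolding powr_add using e by (simp add: powr_minus powr_realpow field_simps)
  also have "\<dots> \<le> 2 powr (- s) * Q" using Q by (intro mult_left_mono) auto
  finally have "q \<le> 2 powr (- s) * Q" using q by linarith
  moreover have "Q > 0" using Q e by (smt (verit) divide_pos_pos zero_less_power)
  ultimately show ?thesis by (simp add: divide_le_eq)
qed

text \<open>Split the seed as \<open>w \<union> V\<close> with \<open>V \<subseteq> S i\<close> the seed of bit \<open>i\<close>. For fixed \<open>w\<close>, the earlier
  output bits depend on \<open>x\<close> only through a truth table with \<open>\<Sum>\<^sub>j\<^sub><\<^sub>i 2\<^bsup>|S j \<inter> S i|\<^esup>\<close> entries, which is handed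
  over as classical side information. The conditional distribution of \<open>V\<close> given \<open>w\<close> has min-entropy
  at least \<open>s\<close> unless \<open>w\<close> belongs to a set of weight at most \<open>3 * sqrt \<epsilon>\<close>.\<close>
lemma hybrid_bound:
  fixes \<rho> :: "nat \<Rightarrow> complex mat" and C :: "nat \<Rightarrow> nat \<Rightarrow> nat" and S :: "nat \<Rightarrow> nat set"
    and k \<epsilon> s r :: real
  assumes \<epsilon>: "\<epsilon> > 0"
    and C_bit: "\<forall>x<2^n. \<forall>y<2^t. C x y \<in> {0, 1}"
    and C_ext: "strong_extractor n t 1 C k \<epsilon> s"
    and design: "weak_design m d t r S" and i: "i < m"
    and rho: "\<And>x. x < 2^n \<Longrightarrow> \<rho> x \<in> carrier_mat dE dE" "\<And>x. x < 2^n \<Longrightarrow> psd (\<rho> x)"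
    and tr: "(\<Sum>x<2^n. Re (mtrace (\<rho> x))) = 1"
    and sig: "density dE \<sigma>" and \<eta>: "\<eta> \<ge> 0" "2 powr k * \<eta> * 2 powr (r * m) \<le> 2 * \<epsilon>"
    and dom: "\<And>x. x < 2^n \<Longrightarrow> psd (complex_of_real \<eta> \<cdot>\<^sub>m \<sigma> - \<rho> x)"
    and q: "is_dist (2^d) q" "\<And>y. y < 2^d \<Longrightarrow> q y \<le> 2 powr (- (d - (t - s - log 2 (1 / (3 * sqrt \<epsilon>)))))"
    and K: "\<And>e y. e < 2^i \<Longrightarrow> y < 2^d \<Longrightarrow> contraction dE (K e y)"
  shows "(\<Sum>y<2^d. q y * (\<Sum>x<2^n. (- 1) ^ C x (restrict_bits y (S i)) *
      trace_ip (\<rho> x) (K (\<Sum>j<i. C x (restrict_bits y (S j)) * 2^j) y))) \<le> 6 * sqrt \<epsilon>"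
proof -
  have S: "S j \<subseteq> {..<d}" "card (S j) = t" "finite (S j)" if "j \<le> i" for j
  proof -
    have "j < m" using i that by simp
    thus "S j \<subseteq> {..<d}" "card (S j) = t" using design by (auto simp: weak_design_def)
    thus "finite (S j)" by (auto intro: finite_subset)
  qed
  have td: "t \<le> d" using card_mono[OF _ S(1)[of i]] S(2)[of i] by simp
  define A where "A = {..<d} - S i"
  have A: "finite A" "card A = d - t" "{..<d} = A \<union> S i" "A \<inter> S i = {}"
    using S[of i] by (auto simp: A_def card_Diff_subset)
  define B where "B w V x = (- 1) ^ C x (set_code (S i) V) *
     trace_ip (\<rho> x) (K (\<Sum>j<i. C x (set_code (S j) (w \<union> V)) * 2^j) (set_encode (w \<union> V)))" for w V x
  define Q where "Q w = (\<Sum>V\<in>Pow (S i). q (set_encode (w \<union> V)))" for w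
  \<comment> \<open>There are \<open>2^(d - t)\<close> choices of the outer bits \<open>w\<close>,
    so those of weight below \<open>\<tau>\<close> have total weight at most
    \<open>3 * sqrt \<epsilon>\<close>.\<close>
  define \<tau> where "\<tau> = 3 * sqrt \<epsilon> / 2^(d - t)"
  have \<tau>: "\<tau> > 0" using \<epsilon> by (simp add: \<tau>_def)
  have enc: "set_encode (w \<union> V) < 2^d" if "w \<subseteq> A" "V \<subseteq> S i" for w V
    using bij_betwE[OF bij_set_encode[of d]] that A(3) by blast
  have q0: "q (set_encode (w \<union> V)) \<ge> 0" if "w \<subseteq> A" "V \<subseteq> S i" for w V
    using q(1) enc[OF that] by (auto simp: is_dist_def)
  have Cb: "C x (set_code (S j) Y) \<in> {0,1}" if "x < 2^n" "j \<le> i" for x j Y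
    using C_bit that set_code_less[OF S(3)[OF that(2)], of Y] S(2)[OF that(2)] by simp
  have Kc: "contraction dE (K (\<Sum>j<i. C x (set_code (S j) (w \<union> V)) * 2^j) (set_encode (w \<union> V)))"
    if "w \<subseteq> A" "V \<subseteq> S i" "x < 2^n" for w V x
  proof (intro K bits_sum_less enc that(1,2))
    fix j assume "j < i"
    thus "C x (set_code (S j) (w \<union> V)) \<le> 1" using Cb[OF that(3), of j "w \<union> V"] by auto
  qed
  have reindex: "(\<Sum>y<2^d. f y) = (\<Sum>w\<in>Pow A. \<Sum>V\<in>Pow (S i). f (set_encode (w \<union> V)))" for f :: "nat \<Rightarrow> real"
  proof -
    have "(\<Sum>y<2^d. f y) = (\<Sum>Y\<in>Pow (A \<union> S i). f (set_encode Y))"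
      using sum.reindex_bij_betw[OF bij_set_encode, of f d] unfolding A(3) by simp
    thus ?thesis using sum_Pow_disjoint_Un[OF A(4), of "\<lambda>Y. f (set_encode Y)"] by simp
  qed
  have per_w: "(\<Sum>V\<in>Pow (S i). q (set_encode (w \<union> V)) * (\<Sum>x<2^n. B w V x)) \<le> 3 * sqrt \<epsilon> * Q w + \<tau>"
    if w: "w \<in> Pow A" for w
  proof (cases "Q w < \<tau>")
    case True
    have Q0: "Q w \<ge> 0" unfolding Q_def using q0 w by (intro sum_nonneg) auto
    have "(\<Sum>x<2^n. B w V x) \<le> 1" if "V \<subseteq> S i" for V
      unfolding B_def using rho tr Kc w that by (intro bias_le_one[where n = dE]) auto
    hence "(\<Sum>V\<in>Pow (S i). q (set_encode (w \<union> V)) * (\<Sum>x<2^n. B w V x)) \<le> (\<Sum>V\<in>Pow (S i). q (set_encode (w \<union> V)) * 1)"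
      using q0 w by (intro sum_mono mult_left_mono) auto
    also have "\<dots> = Q w" by (simp add: Q_def)
    finally show ?thesis using True mult_nonneg_nonneg[OF _ Q0, of "3 * sqrt \<epsilon>"] \<epsilon> by simp
  next
    case False
    hence Qpos: "Q w > 0" using \<tau> by linarith
    define q' where "q' V = q (set_encode (w \<union> V)) / Q w" for V
    have q': "q' V \<ge> 0" "q' V \<le> 2 powr (- s)" if "V \<subseteq> S i" for V
    proof -
      show "q' V \<ge> 0" using q0[of w V] w that Qpos by (simp add: q'_def)
      show "q' V \<le> 2 powr (- s)" unfolding q'_def
      proof (rule conditional_weight_le[OF \<epsilon> td])
        show "q (set_encode (w \<union> V)) \<le> 2 powr (- (d - (t - s - log 2 (1 / (3 * sqrt \<epsilon>)))))"
          using q(2)[OF enc[of w V]] w that by simp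
        show "3 * sqrt \<epsilon> / 2^(d - t) \<le> Q w" using False by (simp add: \<tau>_def)
      qed
    qed
    have q'1: "sum q' (Pow (S i)) = 1"
      unfolding q'_def sum_divide_distrib[symmetric] Q_def[symmetric] using Qpos by simp
    \<comment> \<open>The positions of the truth table: bit \<open>j\<close> sees only
      \<open>S j \<inter> S i\<close> of the inner seed. A table is stored as the subset of
      positions whose entry is 1, which makes \<open>Pow T\<close> the range of the side
      information.\<close>
    define T where "T = (SIGMA j:{..<i}. Pow (S j \<inter> S i))"
    define g where "g x = {(j,U) \<in> T. C x (set_code (S j) (w \<union> U)) = 1}" for x
    \<comment> \<open>Reads the first \<open>i\<close> output bits off a table once the inner seed
      is known. It is defined for arbitrary tables, as the tests must be contractions for every
      element of \<open>Pow T\<close>.\<close>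
    define dec :: "(nat \<times> nat set) set \<Rightarrow> nat set \<Rightarrow> nat"
      where "dec \<gamma> V = (\<Sum>j<i. (if (j, V \<inter> S j) \<in> \<gamma> then 1 else 0) * 2^j)" for \<gamma> V
    have finT: "finite T" using S(3) by (auto simp: T_def)
    have table: "(\<Sum>j<i. C x (set_code (S j) (w \<union> V)) * 2^j) = dec (g x) V" if "x < 2^n" "V \<subseteq> S i" for x V
      unfolding dec_def
    proof (intro sum.cong refl arg_cong2[where f = "(*)"])
      fix j assume "j \<in> {..<i}"
      hence j: "j < i" "j \<le> i" by auto
      have "set_code (S j) (w \<union> V) = set_code (S j) (w \<union> (V \<inter> S j))"
        using S(3)[OF j(2)] by (intro set_code_cong) auto
      thus "C x (set_code (S j) (w \<union> V)) = (if (j, V \<inter> S j) \<in> g x then 1 else 0)"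
        using Cb[OF that(1) j(2), of "w \<union> V"] that(2) j by (auto simp: g_def T_def)
    qed
    \<comment> \<open>The design condition bounds the length of the table by \<open>r * m\<close>,
      hence the number of tables by its exponential.\<close>
    have card: "real (card (Pow T)) \<le> 2 powr (r * m)"
    proof -
      have "card T = (\<Sum>j<i. card (Pow (S j \<inter> S i)))" using S(3) by (simp add: T_def)
      also have "\<dots> = (\<Sum>j<i. 2 ^ card (S j \<inter> S i))" using S(3) by (intro sum.cong refl card_Pow) auto
      finally have "real (card T) = (\<Sum>j<i. (2::real) ^ card (S j \<inter> S i))" by simp
      also have "\<dots> \<le> r * m" using design i by (simp add: weak_design_def)
      finally have "2 powr real (card T) \<le> 2 powr (r * m)" by simp
      thus ?thesis using finT by (simp add: card_Pow powr_realpow)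
    qed
    \<comment> \<open>For fixed \<open>w\<close> the test depends on \<open>x\<close> only through
      the table \<open>g x\<close>, the shape that the one-bit bound with classical side information
      demands.\<close>
    have "(\<Sum>V\<in>Pow (S i). q' V * (\<Sum>x<2^n. (- 1) ^ C x (set_code (S i) V) *
        trace_ip (\<rho> x) (K (dec (g x) V) (set_encode (w \<union> V))))) \<le> 3 * sqrt \<epsilon>"
    proof (rule one_bit_side_information[where G = "Pow T" and kk = "2 powr k" and n = dE and \<sigma> = \<sigma> and \<eta> = \<eta>
          and K = "\<lambda>\<gamma> V. K (dec \<gamma> V) (set_encode (w \<union> V))"])
      show "fools_seed {..<2^n} (Pow (S i)) q' (\<lambda>x V. (- 1) ^ C x (set_code (S i) V)) (2 powr k) (2 * \<epsilon>)"
        using S q' q'1 by (intro bit_extractor_fools_subset_seed[OF C_bit C_ext]) auto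
      have "2 powr k * \<eta> * real (card (Pow T)) \<le> 2 powr k * \<eta> * 2 powr (r * m)"
        using card \<eta>(1) by (intro mult_left_mono) auto
      thus "2 powr k * \<eta> * real (card (Pow T)) \<le> 2 * \<epsilon>" using \<eta>(2) by linarith
      show "contraction dE (K (dec \<gamma> V) (set_encode (w \<union> V)))" if "V \<in> Pow (S i)" for \<gamma> V
        unfolding dec_def using that w by (intro K bits_sum_less enc) auto
      show "g x \<in> Pow T" for x by (auto simp: g_def)
    qed (use S finT \<epsilon> q' q'1 rho tr sig \<eta> dom in \<open>auto simp: density_def\<close>)
    also have "(\<Sum>V\<in>Pow (S i). q' V * (\<Sum>x<2^n. (- 1) ^ C x (set_code (S i) V) *
        trace_ip (\<rho> x) (K (dec (g x) V) (set_encode (w \<union> V))))) = (\<Sum>V\<in>Pow (S i). q' V * (\<Sum>x<2^n. B w V x))"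
      unfolding B_def by (intro sum.cong refl arg_cong2[where f = "(*)"]) (simp add: table)
    finally have "Q w * (\<Sum>V\<in>Pow (S i). q' V * (\<Sum>x<2^n. B w V x)) \<le> Q w * (3 * sqrt \<epsilon>)"
      using Qpos by (intro mult_left_mono) auto
    also have "Q w * (\<Sum>V\<in>Pow (S i). q' V * (\<Sum>x<2^n. B w V x)) = (\<Sum>V\<in>Pow (S i). q (set_encode (w \<union> V)) * (\<Sum>x<2^n. B w V x))"
      unfolding sum_distrib_left[of "Q w"] using Qpos by (intro sum.cong refl) (simp add: q'_def)
    finally show ?thesis using \<tau> by (simp add: mult.commute)
  qed
  have "(\<Sum>y<2^d. q y * (\<Sum>x<2^n. (- 1) ^ C x (restrict_bits y (S i)) *
      trace_ip (\<rho> x) (K (\<Sum>j<i. C x (restrict_bits y (S j)) * 2^j) y))) =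
    (\<Sum>w\<in>Pow A. \<Sum>V\<in>Pow (S i). q (set_encode (w \<union> V)) * (\<Sum>x<2^n. B w V x))"
    unfolding reindex
  proof (rule sum.cong[OF refl], rule sum.cong[OF refl])
    fix w V assume wV: "w \<in> Pow A" "V \<in> Pow (S i)"
    have fin: "finite (w \<union> V)" using wV A(1) S(3)[of i] by (auto intro: finite_subset)
    have "set_code (S i) (w \<union> V) = set_code (S i) V"
      using wV A(4) S(3)[of i] by (intro set_code_cong) auto
    thus "q (set_encode (w \<union> V)) * (\<Sum>x<2^n. (- 1) ^ C x (restrict_bits (set_encode (w \<union> V)) (S i)) *
      trace_ip (\<rho> x) (K (\<Sum>j<i. C x (restrict_bits (set_encode (w \<union> V)) (S j)) * 2^j) (set_encode (w \<union> V)))) =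
      q (set_encode (w \<union> V)) * (\<Sum>x<2^n. B w V x)"
      by (simp add: B_def restrict_bits_set_encode[OF fin])
  qed
  also have "\<dots> \<le> (\<Sum>w\<in>Pow A. 3 * sqrt \<epsilon> * Q w + \<tau>)" by (intro sum_mono per_w)
  also have "\<dots> = 3 * sqrt \<epsilon> * (\<Sum>w\<in>Pow A. Q w) + 2^(d - t) * \<tau>"
    using A by (simp add: sum.distrib sum_distrib_left card_Pow)
  also have "(\<Sum>w\<in>Pow A. Q w) = 1" using q(1) reindex[of q] by (simp add: Q_def is_dist_def)
  also have "3 * sqrt \<epsilon> * 1 + 2^(d - t) * \<tau> = 6 * sqrt \<epsilon>" by (simp add: \<tau>_def)
  finally show ?thesis .
qed

theorem mainTheorem4:
  fixes n t d m :: nat and C :: "nat \<Rightarrow> nat \<Rightarrow> nat" and S :: "nat \<Rightarrow> nat set"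
    and k \<epsilon> s r :: real
  assumes eps_pos: "\<epsilon> > 0"
    and C_bit: "\<forall>x<2^n. \<forall>y<2^t. C x y \<in> {0, 1}"
    and C_ext: "strong_extractor n t 1 C k \<epsilon> s"
    and design: "weak_design m d t r S"
  shows "quantum_proof_strong_extractor n d m (trevisan_ext C m S)
           (k + r * m + log 2 (1 / \<epsilon>)) (6 * m * sqrt \<epsilon>)
           (d - (t - s - log 2 (1 / (3 * sqrt \<epsilon>))))"
  unfolding quantum_proof_strong_extractor_def Let_def
proof (intro allI impI)
  fix dE \<rho> and q :: "nat \<Rightarrow> real"
  assume cq: "cq_state n dE \<rho>"
    and H: "k + r * m + log 2 (1 / \<epsilon>) \<le> Hmin (2^n) dE (cq_joint n dE \<rho>)"
    and q: "is_dist (2^d) q" and Hq: "d - (t - s - log 2 (1 / (3 * sqrt \<epsilon>))) \<le> Hmin_cl (2^d) q"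
  have rho: "\<And>x. x < 2^n \<Longrightarrow> \<rho> x \<in> carrier_mat dE dE" "\<And>x. x < 2^n \<Longrightarrow> psd (\<rho> x)"
    using cq by (auto simp: cq_state_def)
  have tr: "(\<Sum>x<2^n. Re (mtrace (\<rho> x))) = 1"
    unfolding Re_sum[symmetric] using cq by (simp add: cq_state_def)
  have q_le: "q y \<le> 2 powr (- (d - (t - s - log 2 (1 / (3 * sqrt \<epsilon>)))))" if "y < 2^d" for y
    using Hq that unfolding Hmin_cl_ge_iff[OF q] by blast
  \<comment> \<open>Giving away one bit of entropy yields an exponent witnessed by some
    \<open>\<sigma>\<close>, without attaining the supremum. The bit turns \<open>\<epsilon>\<close>
    into the \<open>2 * \<epsilon>\<close> of the guessing bound.\<close>
  have "k + r * m + log 2 (1 / \<epsilon>) - 1 < Hmin (2^n) dE (cq_joint n dE \<rho>)" using H by linarith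
  from Hmin_cq_witness[OF cq this] obtain \<sigma> lam where
    lam: "lam > k + r * m + log 2 (1 / \<epsilon>) - 1" and \<sigma>: "density dE \<sigma>"
    and dom: "\<And>x. x < 2^n \<Longrightarrow> psd (complex_of_real (2 powr (- lam)) \<cdot>\<^sub>m \<sigma> - \<rho> x)" by blast
  have \<eta>: "2 powr k * 2 powr (- lam) * 2 powr (r * m) \<le> 2 * \<epsilon>"
  proof -
    have "2 powr k * 2 powr (- lam) * 2 powr (r * m) = 2 powr (k - lam + r * m)"
      by (simp flip: powr_add)
    also have "\<dots> \<le> 2 powr (1 + log 2 \<epsilon>)"
      using lam eps_pos by (simp add: log_divide)
    also have "\<dots> = 2 * \<epsilon>" unfolding powr_add using eps_pos by simp
    finally show ?thesis .
  qed
  have bitC: "C x (restrict_bits y (S i)) \<in> {0,1}" if "x < 2^n" "i < m" for x y i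
  proof -
    have "S i \<subseteq> {..<d}" "card (S i) = t" using design that by (auto simp: weak_design_def)
    moreover from this have "finite (S i)" by (auto intro: finite_subset)
    ultimately have "set_code (S i) (set_decode y) < 2^t" using set_code_less[of "S i"] by simp
    hence "restrict_bits y (S i) < 2^t" using restrict_bits_set_encode[of "set_decode y" "S i"] by simp
    thus ?thesis using C_bit that by blast
  qed
  have Ext: "trevisan_ext C m S x y < 2^m" if "x < 2^n" for x y
    unfolding trevisan_ext_def
  proof (rule bits_sum_less)
    fix j assume "j < m"
    thus "C x (restrict_bits y (S j)) \<le> 1" using bitC[OF that, of j y] by auto
  qed
  let ?\<rho>out = "mat_sum (2^m * 2^d * dE) (2^m * 2^d * dE) (\<lambda>(x,y). complex_of_real (q y) \<cdot>\<^sub>m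
      kron (kron (proj (2^m) (trevisan_ext C m S x y)) (proj (2^d) y)) (\<rho> x)) ({..<2^n} \<times> {..<2^d})"
  let ?\<rho>ideal = "kron (kron (complex_of_real (1 / 2^m) \<cdot>\<^sub>m 1\<^sub>m (2^m)) (diag_state (2^d) q)) (cq_marginal n dE \<rho>)"
  obtain K where K: "\<And>z y. z < 2^m \<Longrightarrow> y < 2^d \<Longrightarrow> contraction dE (K z y)"
    and tn: "trace_norm (?\<rho>out - ?\<rho>ideal) = (\<Sum>y<2^d. q y * (\<Sum>x<2^n.
        trace_ip (\<rho> x) (K (trevisan_ext C m S x y) y) - (\<Sum>z<2^m. trace_ip (\<rho> x) (K z y)) / 2^m))"
    using extractor_error_attained[where n = n and \<rho> = \<rho> and dE = dE and d = d and m = m and q = q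
        and Ext = "trevisan_ext C m S"] rho Ext by blast
  define e where "e i x y = (\<Sum>j<i. C x (restrict_bits y (S j)) * 2^j)" for i x y
  \<comment> \<open>The first component holds the output bits above position \<open>i\<close>, the
    second the value of bit \<open>i\<close> itself.\<close>
  define I where "I i = {..<(2::nat)^(m - Suc i)} \<times> {..<(2::nat)}" for i
  define u :: "nat \<Rightarrow> nat \<times> nat \<Rightarrow> real" where "u i z = (- 1) ^ snd z / 2^(m - i)" for i z
  \<comment> \<open>The test of bit \<open>i\<close> once the earlier bits \<open>a\<close> are
    known: the tests for all completions of \<open>a\<close>, averaged with a sign given by the
    value of bit \<open>i\<close>. There are \<open>2^(m - i)\<close> completions, so the absolute
    weights sum to 1 and \<open>L\<close> is a contraction.\<close>
  define L where "L i a y = mat_sum dE dE (\<lambda>z. complex_of_real (u i z) \<cdot>\<^sub>m K (a + snd z * 2^i + 2^Suc i * fst z) y) (I i)" for i a y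
  have idx: "a + b * 2^i + 2^Suc i * c < 2^m" if "i < m" "a < 2^i" "b < 2" "c < 2^(m - Suc i)" for i a b c :: nat
  proof -
    have "b * 2^i \<le> 1 * (2::nat)^i" using that by (intro mult_right_mono) auto
    hence "a + b * 2^i < 2 * 2^i" using that(2) by linarith
    hence "a + b * 2^i < 2^Suc i" by simp
    from block_index_less[OF that(4) this] have "c * 2^Suc i + (a + b * 2^i) < 2^(m - Suc i) * 2^Suc i" .
    also have "(2::nat)^(m - Suc i) * 2^Suc i = 2^m" unfolding power_add[symmetric] using that by simp
    finally show ?thesis by (simp add: mult.commute add.commute)
  qed
  have LK: "contraction dE (K (a + snd z * 2^i + 2^Suc i * fst z) y)"
    if "i < m" "a < 2^i" "y < 2^d" "z \<in> I i" for i a y z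
    using that by (intro K idx) (auto simp: I_def)
  have Lc: "contraction dE (L i a y)" if "i < m" "a < 2^i" "y < 2^d" for i a y
    unfolding L_def
  proof (rule contraction_combination[OF LK[OF that]])
    have "(2::real)^(m - i) = 2 * 2^(m - Suc i)" using that(1) by (simp add: Suc_diff_Suc flip: power_Suc)
    thus "(\<Sum>z\<in>I i. \<bar>u i z\<bar>) \<le> 1" by (simp add: u_def I_def)
  qed
  have Lt: "trace_ip (\<rho> x) (L i a y) = (\<Sum>c<2^(m - Suc i). trace_ip (\<rho> x) (K (a + 2^Suc i * c) y)
      - trace_ip (\<rho> x) (K (a + 2^i + 2^Suc i * c) y)) / 2^(m - i)"
    if "x < 2^n" "i < m" "a < 2^i" "y < 2^d" for x i a y
  proof -
    have Lcar: "L i a y \<in> carrier_mat dE dE" by (simp add: L_def mat_sum_def)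
    have Kcar: "K (a + snd z * 2^i + 2^Suc i * fst z) y \<in> carrier_mat dE dE" if "z \<in> I i" for z
      using LK that \<open>i < m\<close> \<open>a < 2^i\<close> \<open>y < 2^d\<close> by (auto simp: contraction_def)
    have "trace_ip (\<rho> x) (L i a y) = (\<Sum>z\<in>I i. u i z * trace_ip (K (a + snd z * 2^i + 2^Suc i * fst z) y) (\<rho> x))"
      unfolding trace_ip_commute[OF rho(1)[OF that(1)] Lcar] unfolding L_def
      using Kcar rho(1)[OF that(1)] by (intro trace_ip_mat_sum_left) auto
    also have "\<dots> = (\<Sum>z\<in>I i. u i z * trace_ip (\<rho> x) (K (a + snd z * 2^i + 2^Suc i * fst z) y))"
      using Kcar rho(1)[OF that(1)] by (intro sum.cong refl arg_cong2[where f = "(*)"] trace_ip_commute[where n = dE]) auto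
    also have "\<dots> = (\<Sum>c<2^(m - Suc i). \<Sum>b<2. u i (c,b) * trace_ip (\<rho> x) (K (a + b * 2^i + 2^Suc i * c) y))"
      unfolding I_def by (simp add: sum.cartesian_product case_prod_beta)
    also have "\<dots> = (\<Sum>c<2^(m - Suc i). (trace_ip (\<rho> x) (K (a + 2^Suc i * c) y)
      - trace_ip (\<rho> x) (K (a + 2^i + 2^Suc i * c) y)) / 2^(m - i))"
      by (intro sum.cong refl) (simp add: numeral_2_eq_2 u_def diff_divide_distrib)
    finally show ?thesis by (simp only: sum_divide_distrib)
  qed
  have "trace_norm (?\<rho>out - ?\<rho>ideal) = (\<Sum>y<2^d. \<Sum>x<2^n. \<Sum>i<m. q y * ((- 1) ^ C x (restrict_bits y (S i)) *
      trace_ip (\<rho> x) (L i (e i x y) y)))"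
    unfolding tn sum_distrib_left
  proof (rule sum.cong[OF refl], rule sum.cong[OF refl])
    fix y x assume "y \<in> {..<(2::nat)^d}" "x \<in> {..<(2::nat)^n}"
    hence xy: "y < 2^d" "x < 2^n" by auto
    have ei: "e i x y < 2^i" if "i < m" for i
      unfolding e_def
    proof (rule bits_sum_less)
      fix j assume "j < i"
      thus "C x (restrict_bits y (S j)) \<le> 1" using bitC[OF xy(2), of j y] that by auto
    qed
    \<comment> \<open>The hybrid identity for
      \<open>\<lambda>z. trace_ip (\<rho> x) (K z y)\<close>; by linearity each hybrid difference is
      a single pairing with \<open>L i\<close>.\<close>
    have "trace_ip (\<rho> x) (K (trevisan_ext C m S x y) y) - (\<Sum>z<2^m. trace_ip (\<rho> x) (K z y)) / 2^m =
      (\<Sum>i<m. (- 1) ^ C x (restrict_bits y (S i)) * trace_ip (\<rho> x) (L i (e i x y) y))"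
      unfolding trevisan_ext_def
      using hybrid_telescope[of m "\<lambda>i. C x (restrict_bits y (S i))" "\<lambda>z. trace_ip (\<rho> x) (K z y)"] bitC[OF xy(2)]
      by (simp add: Lt xy ei flip: e_def)
    thus "q y * (trace_ip (\<rho> x) (K (trevisan_ext C m S x y) y) - (\<Sum>z<2^m. trace_ip (\<rho> x) (K z y)) / 2^m) =
      (\<Sum>i<m. q y * ((- 1) ^ C x (restrict_bits y (S i)) * trace_ip (\<rho> x) (L i (e i x y) y)))"
      by (simp only: sum_distrib_left)
  qed
  also have "\<dots> = (\<Sum>y<2^d. \<Sum>i<m. \<Sum>x<2^n. q y * ((- 1) ^ C x (restrict_bits y (S i)) * trace_ip (\<rho> x) (L i (e i x y) y)))"
    by (intro sum.cong refl sum.swap)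
  also have "\<dots> = (\<Sum>i<m. \<Sum>y<2^d. \<Sum>x<2^n. q y * ((- 1) ^ C x (restrict_bits y (S i)) * trace_ip (\<rho> x) (L i (e i x y) y)))"
    by (rule sum.swap)
  also have "\<dots> = (\<Sum>i<m. \<Sum>y<2^d. q y * (\<Sum>x<2^n. (- 1) ^ C x (restrict_bits y (S i)) *
        trace_ip (\<rho> x) (L i (\<Sum>j<i. C x (restrict_bits y (S j)) * 2^j) y)))"
    by (simp only: sum_distrib_left e_def)
  also have "\<dots> \<le> (\<Sum>i<m. 6 * sqrt \<epsilon>)"
  proof (rule sum_mono)
    fix i assume "i \<in> {..<m}"
    hence i: "i < m" by simp
    show "(\<Sum>y<2^d. q y * (\<Sum>x<2^n. (- 1) ^ C x (restrict_bits y (S i)) *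
        trace_ip (\<rho> x) (L i (\<Sum>j<i. C x (restrict_bits y (S j)) * 2^j) y))) \<le> 6 * sqrt \<epsilon>"
      by (rule hybrid_bound[OF eps_pos C_bit C_ext design i rho tr \<sigma> _ \<eta> dom q q_le]) (use Lc i in auto)
  qed
  also have "\<dots> = 6 * m * sqrt \<epsilon>" by simp
  finally have "trace_norm (?\<rho>out - ?\<rho>ideal) \<le> 6 * m * sqrt \<epsilon>" .
  moreover have "6 * m * sqrt \<epsilon> \<ge> 0" using eps_pos by simp
  ultimately show "1/2 * trace_norm (?\<rho>out - ?\<rho>ideal) \<le> 6 * m * sqrt \<epsilon>" by linarith
qed

end
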